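(* Let $X_1,\dots,X_m$ be independent normally distributed random variables with common mean $\mu$ and variance $1$, let $S_0=0$, $S_j=\sum_{l=1}^{j}X_l$ for $1\le j\le m$, and for $0\le i<j<k\le m$ let $$Z_{i,j,k}=\frac{S_j-S_i-(j-i)\,(S_k-S_i)/(k-i)}{\big[(j-i)\big(1-(j-i)/(k-i)\big)\big]^{1/2}} .$$ Then, as $b\to\infty$ and $m\asymp b^2$, $$\mathbb P\Big\{\max_{0\le i<j<k\le m}|Z_{i,j,k}|\ge b\Big\}\sim \frac{b^6\,\Phi(-b)}{4}\sum_{\substack{u,v\in\{1,\dots,m\}\\ u+v\le m}}\frac{m-u-v}{uv(u+v)}\;\nu\!\left[b\Big(\frac{u}{v(u+v)}\Big)^{1/2}\right]\nu\!\left[b\Big(\frac{v}{u(u+v)}\Big)^{1/2}\right]\nu\!\left[b\Big(\frac{u+v}{uv}\Big)^{1/2}\right].$$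
   Context: $\Phi$ is the standard normal distribution function. The function $\nu:(0,\infty)\to(0,1)$ is $$\nu(x)=\frac{2}{x^{2}}\exp\Big(-2\sum_{n=1}^{\infty}\frac1n\,\Phi\big(-\tfrac{x\sqrt n}{2}\big)\Big).$$ Asymptotic notation: $m=m(b)$ is a positive integer depending on $b$; $A\asymp B$ means $0<c_1\le A/B\le c_2<\infty$ for two absolute constants $c_1,c_2$ (not depending on $b$); $A(b)\sim B(b)$ means $A(b)/B(b)\to1$ as $b\to\infty$. *)

theory Defs
  imports "HOL-Probability.Probability" "HOL-Library.Landau_Symbols"
begin

definition Phi :: "real \<Rightarrow> real" where
  "Phi x = cdf std_normal_distribution x"

(* Meaningful for x > 0 only, where the series converges.  The sum over n >= 1 is
   indexed by Suc n. *)
definition nu :: "real \<Rightarrow> real" where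
  "nu x = 2 / x\<^sup>2 *
     exp (- 2 * (\<Sum>n. 1 / real (Suc n) * Phi (- (x * sqrt (real (Suc n)) / 2))))"

definition partial_sum :: "(nat \<Rightarrow> 'a \<Rightarrow> real) \<Rightarrow> nat \<Rightarrow> 'a \<Rightarrow> real" where
  "partial_sum X j \<omega> = (\<Sum>l = 1..j. X l \<omega>)"

definition Z_stat :: "(nat \<Rightarrow> 'a \<Rightarrow> real) \<Rightarrow> nat \<Rightarrow> nat \<Rightarrow> nat \<Rightarrow> 'a \<Rightarrow> real" where
  "Z_stat X i j k \<omega> =
     (partial_sum X j \<omega> - partial_sum X i \<omega>
        - (real j - real i) * (partial_sum X k \<omega> - partial_sum X i \<omega>) / (real k - real i))
     / sqrt ((real j - real i) * (1 - (real j - real i) / (real k - real i)))"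

(* The set of triples is nonempty only for m >= 2; for smaller m this is Max {}. *)
definition max_abs_Z :: "(nat \<Rightarrow> 'a \<Rightarrow> real) \<Rightarrow> nat \<Rightarrow> 'a \<Rightarrow> real" where
  "max_abs_Z X m \<omega> = Max {\<bar>Z_stat X i j k \<omega>\<bar> | i j k. i < j \<and> j < k \<and> k \<le> m}"

end

theory Submission
  imports Defs "HOL-Real_Asymp.Real_Asymp"
begin

text \<open>Write \<open>Z\<^sub>t\<close> for the statistic at a triple \<open>t = (i, j, k)\<close>, put \<open>u = j - i\<close>, \<open>v = k - j\<close>, and subtract the
mean from the observations, which leaves \<open>Z\<close> unchanged.  Then \<open>Z\<^sub>t = \<langle>h\<^sub>t, W\<rangle>\<close> with iid standard normal \<open>W\<close>
and a unit step function \<open>h\<^sub>t\<close> (\<open>contrast\<close>) whose jumps at \<open>i\<close>, \<open>j\<close>, \<open>k\<close> have the sizes \<open>\<alpha>\<close>, \<open>\<alpha> + \<beta>\<close>, \<open>\<beta>\<close>.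
These jumps, times \<open>b\<close>, are the three arguments \<open>x\<close> of \<open>\<nu>\<close> in the formula, and
\<open>b\<^sup>6 / (u v (u + v))\<close> is the product of their squares.

The constant.  Spitzer's identity (\<open>stay_prob_tendsto\<close>) shows that \<open>x\<^sup>2 \<nu>(x) / 2 = p(x)\<^sup>2\<close>, where \<open>p(x)\<close>
(\<open>never_up\<close>) is the probability that a Gaussian walk with drift \<open>- x\<^sup>2 / 2\<close> and variance \<open>x\<^sup>2\<close> per step
never becomes positive.  So the right-hand side is \<open>2 \<Phi>(-b)\<close> times the sum over all triples of
\<open>\<Prod> p(x)\<^sup>2\<close>, one squared factor for each change point (\<open>main_sum_eq\<close>).

The reason.  If \<open>|Z|\<close> exceeds \<open>b\<close> anywhere, it does so at its maximiser; hence the probability is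
the sum over \<open>t\<close> and over both signs of the probability that \<open>Z\<^sub>t \<ge> b\<close> and \<open>t\<close> is the maximiser.  Given
\<open>Z\<^sub>t \<approx> b\<close>, the field \<open>b (Z\<^sub>s - Z\<^sub>t)\<close> for \<open>s\<close> near \<open>t\<close> is a sum of three independent two-sided Gaussian
walks, one for each coordinate, with drift \<open>- x\<^sup>2 / 2\<close> and variance \<open>x\<^sup>2\<close>.  A sum of functions of
separate coordinates has its maximum at \<open>t\<close> iff each of the six one-sided walks stays below \<open>0\<close>, and
this has probability \<open>\<Prod> p(x)\<^sup>2\<close>.

Making it precise.  All triples with \<open>u < \<epsilon> b\<^sup>2\<close> or \<open>v < \<epsilon> b\<^sup>2\<close> or near the ends of the sample are
\<open>O(\<epsilon> b\<^sup>6)\<close> many and are removed by the union bound (\<open>card_not_typical_le\<close>).  For the others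
the local picture holds uniformly in a cube of fixed radius \<open>D\<close> (\<open>peak_asymptotics\<close>).  The
part of \<open>Z\<^sub>s\<close> orthogonal to \<open>Z\<^sub>t\<close> is independent of \<open>Z\<^sub>t\<close> (\<open>prob_lin_indep\<close>), and the condition
\<open>Z\<^sub>s < Z\<^sub>t\<close> is monotone in \<open>Z\<^sub>t\<close>; the level \<open>Z\<^sub>t\<close> can thus be replaced by \<open>b\<close> below and by \<open>b + 1\<close> above.
Two exceedances at \<open>s\<close> and \<open>t\<close> outside the cube cost an extra factor \<open>exp (- b\<^sup>2 |h\<^sub>s - h\<^sub>t|\<^sup>2 / 8)\<close>
(\<open>prob_both_ge\<close>), which decays geometrically in the distance of \<open>s\<close> and \<open>t\<close> (\<open>separation\<close>); the total
contribution of such pairs is small once \<open>D\<close> is large (\<open>far_prob_small\<close>).\<close>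

section \<open>Spitzer's identity\<close>

text \<open>The first \<open>k\<close> coordinates and the shifted tail of an iid sequence are independent: gluing
  two independent sequences at position \<open>k\<close> reproduces the law of one sequence.\<close>

lemma (in sequence_space) prob_split_at:
  assumes [measurable]: "Measurable.pred S A" "Measurable.pred S B"
    and dep: "\<And>\<omega> \<omega>'. (\<And>i. i < k \<Longrightarrow> \<omega> i = \<omega>' i) \<Longrightarrow> A \<omega> = A \<omega>'"
  shows "\<P>(\<omega> in S. A \<omega> \<and> B (\<lambda>i. \<omega> (k + i))) = \<P>(\<omega> in S. A \<omega>) * \<P>(\<omega> in S. B \<omega>)"
proof -
  have [measurable]: "(\<lambda>\<omega> i. \<omega> (k + i)) \<in> S \<rightarrow>\<^sub>M S"
    by (rule measurable_PiM_single') (auto simp: space_PiM PiE_iff)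
  have sets: "{\<omega> \<in> space S. A \<omega> \<and> B (\<lambda>i. \<omega> (k + i))} \<in> sets S" by measurable
  interpret pr: pair_prob_space S S ..
  have *: "A (comb_seq k \<omega> \<omega>') = A \<omega>" "B (\<lambda>i. comb_seq k \<omega> \<omega>' (k + i)) = B \<omega>'" for \<omega> \<omega>'
    by (auto intro!: dep simp: comb_seq_def)
  have "emeasure S {\<omega> \<in> space S. A \<omega> \<and> B (\<lambda>i. \<omega> (k + i))}
      = emeasure (distr (S \<Otimes>\<^sub>M S) S (\<lambda>(\<omega>, \<omega>'). comb_seq k \<omega> \<omega>')) {\<omega> \<in> space S. A \<omega> \<and> B (\<lambda>i. \<omega> (k + i))}"
    by (simp add: PiM_comb_seq)
  also have "\<dots> = emeasure (S \<Otimes>\<^sub>M S) ({\<omega> \<in> space S. A \<omega>} \<times> {\<omega> \<in> space S. B \<omega>})"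
    using sets
    by (subst emeasure_distr)
       (auto simp: measurable_comb_seq * space_pair_measure space_PiM PiE_iff comb_seq_def intro!: arg_cong[where f="emeasure _"])
  also have "\<dots> = emeasure S {\<omega> \<in> space S. A \<omega>} * emeasure S {\<omega> \<in> space S. B \<omega>}"
    by (intro P.emeasure_pair_measure_Times) auto
  finally show ?thesis
    by (simp add: measure_def enn2real_mult)
qed

lemma (in sequence_space) prob_reindex:
  assumes [measurable]: "Measurable.pred S A" and "inj g"
  shows "\<P>(\<omega> in S. A (\<lambda>i. \<omega> (g i))) = \<P>(\<omega> in S. A \<omega>)"
proof -
  have [measurable]: "(\<lambda>\<omega> i. \<omega> (g i)) \<in> S \<rightarrow>\<^sub>M S"
    by (rule measurable_PiM_single') (auto simp: space_PiM PiE_iff)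
  have d: "distr S S (\<lambda>\<omega> i. \<omega> (g i)) = S"
    using distr_PiM_reindex[of UNIV "\<lambda>_. M" g UNIV] assms(2) M.prob_space_axioms
    by (simp add: restrict_UNIV)
  have "measure S {\<omega> \<in> space S. A \<omega>} = measure (distr S S (\<lambda>\<omega> i. \<omega> (g i))) {\<omega> \<in> space S. A \<omega>}"
    by (simp add: d)
  also have "\<dots> = measure S {\<omega> \<in> space S. A (\<lambda>i. \<omega> (g i))}"
    by (subst measure_distr) (measurable, auto simp: space_PiM PiE_iff intro!: arg_cong[where f="measure _"])
  finally show ?thesis by simp
qed

locale iid_steps = sequence_space M for M :: "'a measure" +
  fixes f :: "'a \<Rightarrow> real"
  assumes f_meas [measurable]: "f \<in> borel_measurable M"
begin

definition walk :: "nat \<Rightarrow> (nat \<Rightarrow> 'a) \<Rightarrow> real" where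
  "walk n \<omega> = (\<Sum>r<n. f (\<omega> r))"

lemma walk_measurable [measurable]: "walk n \<in> borel_measurable S"
  unfolding walk_def by measurable

lemma walk_0 [simp]: "walk 0 \<omega> = 0"
  by (simp add: walk_def)

lemma walk_cong: "(\<And>i. i < n \<Longrightarrow> \<omega> i = \<omega>' i) \<Longrightarrow> walk n \<omega> = walk n \<omega>'"
  by (simp add: walk_def)

lemma walk_shift: "walk n (\<lambda>i. \<omega> (k + i)) = walk (k + n) \<omega> - walk k \<omega>"
  by (induction n) (simp_all add: walk_def)

lemma walk_rotate:
  assumes "s \<le> n" "j \<le> n"
  shows "walk j (\<lambda>i. \<omega> (if i < n then (i + s) mod n else i)) =
    (if j \<le> n - s then walk (s + j) \<omega> - walk s \<omega>
     else walk n \<omega> - walk s \<omega> + walk (j - (n - s)) \<omega>)"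
  using \<open>j \<le> n\<close>
proof (induction j)
  case 0
  then show ?case by simp
next
  case (Suc j)
  have step: "walk (Suc i) \<omega> = walk i \<omega> + f (\<omega> i)" for i \<omega>
    by (simp add: walk_def)
  consider "Suc j \<le> n - s" | "j = n - s" | "j > n - s" by linarith
  then show ?case
  proof cases
    case 1
    then have "(j + s) mod n = s + j" using assms by simp
    with 1 Suc show ?thesis by (simp add: step add.commute)
  next
    case 2
    then have "(j + s) mod n = 0" "s > 0" using assms Suc.prems by auto
    with 2 Suc assms step[of 0] show ?thesis by (simp add: step)
  next
    case 3
    have "(j + s) mod n = j + s - n"
      using 3 Suc.prems assms by (simp add: mod_if)
    moreover have "Suc j - (n - s) = Suc (j - (n - s))" using 3 by simp
    moreover have "j - (n - s) = j + s - n" using 3 assms by simp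
    ultimately show ?thesis using 3 Suc by (simp add: step)
  qed
qed

definition pos_prob :: "nat \<Rightarrow> real" where
  "pos_prob n = \<P>(\<omega> in S. walk n \<omega> > 0)"

text \<open>The law of the first strict ascending ladder epoch.\<close>

definition first_prob :: "nat \<Rightarrow> real" where
  "first_prob k = \<P>(\<omega> in S. (\<forall>i\<in>{1..<k}. walk i \<omega> \<le> 0) \<and> walk k \<omega> > 0)"

text \<open>The probability that \<open>n\<close> is a strict ascending ladder epoch; as a sequence in \<open>n\<close> it is the
  renewal sequence generated by \<open>first_prob\<close>.\<close>

definition ladder_prob :: "nat \<Rightarrow> real" where
  "ladder_prob n = \<P>(\<omega> in S. \<forall>i<n. walk i \<omega> < walk n \<omega>)"

definition stay_prob :: "nat \<Rightarrow> real" where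
  "stay_prob n = \<P>(\<omega> in S. \<forall>i\<in>{1..n}. walk i \<omega> \<le> 0)"

text \<open>Once the walk has reached a new maximum at \<open>k\<close>, later record times depend only on the
  increments after \<open>k\<close>.\<close>

lemma first_and_ladder_prob:
  assumes "1 \<le> k" "k \<le> n"
  shows "\<P>(\<omega> in S. ((\<forall>i\<in>{1..<k}. walk i \<omega> \<le> 0) \<and> walk k \<omega> > 0) \<and> (\<forall>i<n. walk i \<omega> < walk n \<omega>))
    = first_prob k * ladder_prob (n - k)"
proof -
  let ?A = "\<lambda>\<omega>. (\<forall>i\<in>{1..<k}. walk i \<omega> \<le> 0) \<and> walk k \<omega> > 0"
  let ?B = "\<lambda>\<omega>. \<forall>i<n-k. walk i \<omega> < walk (n - k) \<omega>"
  have "?A \<omega> \<and> (\<forall>i<n. walk i \<omega> < walk n \<omega>) \<longleftrightarrow> ?A \<omega> \<and> ?B (\<lambda>i. \<omega> (k + i))" for \<omega>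
  proof (rule conj_cong[OF refl], rule iffI)
    assume "\<forall>i<n. walk i \<omega> < walk n \<omega>"
    then show "\<forall>i<n-k. walk i (\<lambda>i. \<omega> (k + i)) < walk (n - k) (\<lambda>i. \<omega> (k + i))"
      using assms by (auto simp: walk_shift)
  next
    assume A: "?A \<omega>" and B: "?B (\<lambda>i. \<omega> (k + i))"
    have B': "walk (k + i) \<omega> < walk n \<omega>" if "i < n - k" for i
      using B that assms by (auto simp: walk_shift)
    have kn: "walk k \<omega> \<le> walk n \<omega>" using B'[of 0] assms by (cases "k = n") auto
    show "\<forall>i<n. walk i \<omega> < walk n \<omega>"
    proof (intro allI impI)
      fix i assume "i < n"
      show "walk i \<omega> < walk n \<omega>"
      proof (cases "i < k")
        case True
        then have "walk i \<omega> \<le> 0" using A by (cases "i = 0") auto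
        then show ?thesis using A kn by simp
      next
        case False
        then show ?thesis using B'[of "i - k"] \<open>i < n\<close> by simp
      qed
    qed
  qed
  then have "\<P>(\<omega> in S. ?A \<omega> \<and> (\<forall>i<n. walk i \<omega> < walk n \<omega>)) = \<P>(\<omega> in S. ?A \<omega> \<and> ?B (\<lambda>i. \<omega> (k + i)))"
    by simp
  also have "\<dots> = \<P>(\<omega> in S. ?A \<omega>) * \<P>(\<omega> in S. ?B \<omega>)"
  proof (rule prob_split_at)
    fix \<omega> \<omega>' :: "nat \<Rightarrow> 'a" assume "\<And>i. i < k \<Longrightarrow> \<omega> i = \<omega>' i"
    then have "walk i \<omega> = walk i \<omega>'" if "i \<le> k" for i
      using that by (intro walk_cong) auto
    then show "?A \<omega> = ?A \<omega>'" by auto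
  qed measurable
  finally show ?thesis by (simp add: first_prob_def ladder_prob_def)
qed

lemma stay_and_ladder_prob:
  assumes "c < n"
  shows "\<P>(\<omega> in S. (\<forall>i\<in>{1..c}. walk i \<omega> \<le> 0) \<and> (\<forall>i<n. walk i \<omega> < walk n \<omega>))
    = (\<Sum>k\<in>{c<..n}. first_prob k * ladder_prob (n - k))"
proof -
  let ?L = "\<lambda>\<omega>. \<forall>i<n. walk i \<omega> < walk n \<omega>"
  define E where "E k = {\<omega> \<in> space S. ((\<forall>i\<in>{1..<k}. walk i \<omega> \<le> 0) \<and> walk k \<omega> > 0) \<and> ?L \<omega>}" for k
  have "{\<omega> \<in> space S. (\<forall>i\<in>{1..c}. walk i \<omega> \<le> 0) \<and> ?L \<omega>} = (\<Union>k\<in>{c<..n}. E k)"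
  proof (intro equalityI subsetI)
    fix \<omega> assume w: "\<omega> \<in> {\<omega> \<in> space S. (\<forall>i\<in>{1..c}. walk i \<omega> \<le> 0) \<and> ?L \<omega>}"
    define k where "k = (LEAST k. walk k \<omega> > 0)"
    have pos: "walk n \<omega> > 0" using w assms by (auto dest: spec[of _ 0])
    then have k: "walk k \<omega> > 0" "k \<le> n" unfolding k_def by (auto intro: LeastI Least_le)
    have less: "walk i \<omega> \<le> 0" if "i < k" for i
      using not_less_Least[of i "\<lambda>k. walk k \<omega> > 0"] that unfolding k_def by auto
    have "k \<noteq> 0" using k by (intro notI) simp
    have "c < k"
    proof (rule ccontr)
      assume "\<not> c < k"
      then have "k \<in> {1..c}" using \<open>k \<noteq> 0\<close> by simp
      then have "walk k \<omega> \<le> 0" using w by blast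
      then show False using k by simp
    qed
    then show "\<omega> \<in> (\<Union>k\<in>{c<..n}. E k)" using k less w \<open>c < k\<close> by (intro UN_I[of k]) (auto simp: E_def)
  qed (auto simp: E_def)
  then have "\<P>(\<omega> in S. (\<forall>i\<in>{1..c}. walk i \<omega> \<le> 0) \<and> ?L \<omega>) = measure S (\<Union>k\<in>{c<..n}. E k)"
    by simp
  also have "\<dots> = (\<Sum>k\<in>{c<..n}. measure S (E k))"
  proof (rule P.finite_measure_finite_Union)
    have "E k \<in> P.events" for k unfolding E_def by measurable
    then show "E ` {c<..n} \<subseteq> P.events" by auto
    have "False" if "k < l" "\<omega> \<in> E k" "\<omega> \<in> E l" "c < k" for k l \<omega>
    proof -
      have "walk k \<omega> > 0" using that by (simp add: E_def)
      moreover have "k \<in> {1..<l}" using that by simp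
      then have "walk k \<omega> \<le> 0" using that(3) unfolding E_def by blast
      ultimately show False by simp
    qed
    then show "disjoint_family_on E {c<..n}"
      unfolding disjoint_family_on_def disjoint_iff by (auto simp: nat_neq_iff)
  qed simp
  also have "\<dots> = (\<Sum>k\<in>{c<..n}. first_prob k * ladder_prob (n - k))"
  proof (intro sum.cong refl)
    fix k assume "k \<in> {c<..n}"
    then show "measure S (E k) = first_prob k * ladder_prob (n - k)"
      unfolding E_def by (intro first_and_ladder_prob) auto
  qed
  finally show ?thesis .
qed

lemma ladder_prob_0 [simp]: "ladder_prob 0 = 1"
  by (simp add: ladder_prob_def P.prob_space)

lemma ladder_prob_renewal:
  assumes "n > 0"
  shows "ladder_prob n = (\<Sum>k=1..n. first_prob k * ladder_prob (n - k))"
  using stay_and_ladder_prob[OF assms] by (simp add: ladder_prob_def atLeastSucAtMost_greaterThanAtMost)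

text \<open>Rotating the steps cyclically by \<open>s\<close> turns the event that \<open>s\<close> is the first maximiser over
  \<open>{1..n}\<close> and the walk ends above \<open>0\<close> into the event that \<open>n\<close> is a strict ladder epoch and the first
  \<open>n - s\<close> positions are not positive.  Iid steps do not feel the rotation.  This is the
  combinatorial core of Spitzer's identity.\<close>

lemma first_argmax_prob:
  assumes s: "1 \<le> s" "s \<le> n"
  shows "\<P>(\<omega> in S. walk n \<omega> > 0 \<and> (\<forall>j\<in>{1..<s}. walk j \<omega> < walk s \<omega>) \<and> (\<forall>j\<in>{s<..n}. walk j \<omega> \<le> walk s \<omega>))
    = \<P>(\<omega> in S. (\<forall>i\<in>{1..n-s}. walk i \<omega> \<le> 0) \<and> (\<forall>i<n. walk i \<omega> < walk n \<omega>))"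
proof -
  define g where "g i = (if i < n then (i + s) mod n else i)" for i
  have "inj g"
  proof (rule injI)
    fix i j assume eq: "g i = g j"
    have lt: "g i < n \<longleftrightarrow> i < n" for i using s by (auto simp: g_def)
    show "i = j"
    proof (cases "i < n")
      case True
      then have j: "j < n" using lt eq by metis
      have "(k + s) mod n = (if k + s < n then k + s else k + s - n)" if "k < n" for k
        using that s by (simp add: mod_if)
      then show ?thesis using True j eq by (auto simp: g_def split: if_splits)
    next
      case False
      then have "\<not> j < n" using lt eq by metis
      then show ?thesis using False eq by (simp add: g_def)
    qed
  qed
  let ?Q = "\<lambda>\<omega>. (\<forall>i\<in>{1..n-s}. walk i \<omega> \<le> 0) \<and> (\<forall>i<n. walk i \<omega> < walk n \<omega>)"
  have "walk n \<omega> > 0 \<and> (\<forall>j\<in>{1..<s}. walk j \<omega> < walk s \<omega>) \<and> (\<forall>j\<in>{s<..n}. walk j \<omega> \<le> walk s \<omega>)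
     \<longleftrightarrow> ?Q (\<lambda>i. \<omega> (g i))" (is "?P \<longleftrightarrow> _") for \<omega>
  proof -
    let ?w = "\<lambda>j. walk j (\<lambda>i. \<omega> (g i))"
    have rot: "?w j = (if j \<le> n - s then walk (s + j) \<omega> - walk s \<omega>
       else walk n \<omega> - walk s \<omega> + walk (j - (n - s)) \<omega>)" if "j \<le> n" for j
      unfolding g_def using walk_rotate[of s n j \<omega>] s that by simp
    have wn: "?w n = walk n \<omega>" using rot[of n] s by auto
    show ?thesis
    proof
      assume P: ?P
      have 1: "?w i \<le> 0" if "i \<in> {1..n-s}" for i
        using P that rot[of i] s by auto
      have "?w i < ?w n" if "i < n" for i
      proof (cases "i \<le> n - s")
        case True
        then have "?w i \<le> 0" using 1[of i] by (cases "i = 0") auto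
        then show ?thesis using wn P by simp
      next
        case False
        then have "i - (n - s) \<in> {1..<s}" using that s by auto
        then have "walk (i - (n - s)) \<omega> < walk s \<omega>" using P by blast
        then show ?thesis using False rot[of i] that wn by simp
      qed
      then show "?Q (\<lambda>i. \<omega> (g i))" using 1 by blast
    next
      assume Q: "?Q (\<lambda>i. \<omega> (g i))"
      have "walk n \<omega> > 0" using Q wn s by (auto dest: spec[of _ 0])
      moreover have "walk j \<omega> < walk s \<omega>" if "j \<in> {1..<s}" for j
      proof -
        have lt: "n - s + j < n" using that s by auto
        then have "?w (n - s + j) < ?w n" using Q by blast
        moreover have "?w (n - s + j) = walk n \<omega> - walk s \<omega> + walk j \<omega>"
          using rot[of "n - s + j"] that lt by simp
        ultimately show ?thesis using wn by simp
      qed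
      moreover have "walk j \<omega> \<le> walk s \<omega>" if "j \<in> {s<..n}" for j
      proof -
        have mem: "j - s \<in> {1..n-s}" using that by auto
        then have "?w (j - s) \<le> 0" using Q by blast
        moreover have "?w (j - s) = walk j \<omega> - walk s \<omega>"
          using rot[of "j - s"] mem that by auto
        ultimately show ?thesis by simp
      qed
      ultimately show ?P by blast
    qed
  qed
  then show ?thesis using prob_reindex[of ?Q g, OF _ \<open>inj g\<close>] by simp
qed

text \<open>On \<open>walk n > 0\<close> exactly one \<open>s\<close> is the first maximiser over \<open>{1..n}\<close>; summing
  \<open>first_argmax_prob\<close> over \<open>s\<close> counts each first ladder epoch \<open>k\<close> exactly \<open>k\<close> times.  In generating functions,
  with \<open>T\<close> for \<open>first_prob\<close> and \<open>Q = 1 / (1 - T)\<close> for \<open>ladder_prob\<close>, this says \<open>A = z T' Q\<close>.\<close>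

lemma pos_prob_ladder:
  assumes "n > 0"
  shows "pos_prob n = (\<Sum>k=1..n. real k * first_prob k * ladder_prob (n - k))"
proof -
  define E where "E s = {\<omega> \<in> space S. walk n \<omega> > 0 \<and> (\<forall>j\<in>{1..<s}. walk j \<omega> < walk s \<omega>) \<and> (\<forall>j\<in>{s<..n}. walk j \<omega> \<le> walk s \<omega>)}" for s
  have "{\<omega> \<in> space S. walk n \<omega> > 0} = (\<Union>s\<in>{1..n}. E s)"
  proof (intro equalityI subsetI)
    fix \<omega> assume w: "\<omega> \<in> {\<omega> \<in> space S. walk n \<omega> > 0}"
    define m where "m = Max ((\<lambda>j. walk j \<omega>) ` {1..n})"
    define s where "s = (LEAST s. s \<in> {1..n} \<and> walk s \<omega> = m)"
    have "m \<in> (\<lambda>j. walk j \<omega>) ` {1..n}" unfolding m_def using assms by (intro Max_in) auto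
    then have ex: "\<exists>s. s \<in> {1..n} \<and> walk s \<omega> = m" by auto
    have s: "s \<in> {1..n}" "walk s \<omega> = m" using LeastI_ex[OF ex] unfolding s_def by auto
    have le: "walk j \<omega> \<le> m" if "j \<in> {1..n}" for j unfolding m_def using that by (intro Max_ge) auto
    have ne: "walk j \<omega> \<noteq> m" if "j \<in> {1..<s}" for j
      using not_less_Least[of j "\<lambda>s. s \<in> {1..n} \<and> walk s \<omega> = m"] that s(1) unfolding s_def[symmetric] by auto
    have "walk j \<omega> < walk s \<omega>" if "j \<in> {1..<s}" for j
      using le[of j] ne[of j] that s by auto
    then have "\<omega> \<in> E s" using w s le by (auto simp: E_def)
    then show "\<omega> \<in> (\<Union>s\<in>{1..n}. E s)" using s by blast
  qed (auto simp: E_def)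
  then have "pos_prob n = measure S (\<Union>s\<in>{1..n}. E s)" by (simp add: pos_prob_def)
  also have "\<dots> = (\<Sum>s\<in>{1..n}. measure S (E s))"
  proof (rule P.finite_measure_finite_Union)
    have [measurable]: "Measurable.pred S (\<lambda>\<omega>. walk j \<omega> \<le> walk k \<omega>)" for j k
      unfolding pred_def by (intro borel_measurable_le walk_measurable)
    have "E k \<in> P.events" for k unfolding E_def by measurable
    then show "E ` {1..n} \<subseteq> P.events" by auto
    have "False" if "k < l" "\<omega> \<in> E k" "\<omega> \<in> E l" "1 \<le> k" "l \<le> n" for k l \<omega>
    proof -
      have "l \<in> {k<..n}" "k \<in> {1..<l}" using that by auto
      then have "walk l \<omega> \<le> walk k \<omega>" "walk k \<omega> < walk l \<omega>"
        using that(2,3) unfolding E_def by blast+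
      then show False by simp
    qed
    then show "disjoint_family_on E {1..n}"
      unfolding disjoint_family_on_def disjoint_iff by (auto simp: nat_neq_iff)
  qed simp
  also have "\<dots> = (\<Sum>s\<in>{1..n}. \<Sum>k\<in>{n-s<..n}. first_prob k * ladder_prob (n - k))"
  proof (intro sum.cong refl)
    fix s assume "s \<in> {1..n}"
    then show "measure S (E s) = (\<Sum>k\<in>{n-s<..n}. first_prob k * ladder_prob (n - k))"
      unfolding E_def using first_argmax_prob[of s n] stay_and_ladder_prob[of "n - s" n] by simp
  qed
  also have "\<dots> = (\<Sum>s\<in>{1..n}. \<Sum>k\<in>{1..n}. if n - s < k then first_prob k * ladder_prob (n - k) else 0)"
  proof (rule sum.cong[OF refl])
    fix s
    have "{n-s<..n} = {k \<in> {1..n}. n - s < k}" by auto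
    then show "(\<Sum>k\<in>{n-s<..n}. first_prob k * ladder_prob (n - k))
        = (\<Sum>k\<in>{1..n}. if n - s < k then first_prob k * ladder_prob (n - k) else 0)"
      using sum.inter_filter[of "{1..n}" "\<lambda>k. first_prob k * ladder_prob (n - k)" "\<lambda>k. n - s < k"] by simp
  qed
  also have "\<dots> = (\<Sum>k\<in>{1..n}. \<Sum>s\<in>{1..n}. if n - s < k then first_prob k * ladder_prob (n - k) else 0)"
    by (rule sum.swap)
  also have "\<dots> = (\<Sum>k\<in>{1..n}. real k * first_prob k * ladder_prob (n - k))"
  proof (intro sum.cong refl)
    fix k assume k: "k \<in> {1..n}"
    have "{s \<in> {1..n}. n - s < k} = {n-k<..n}" using k by auto
    then have "(\<Sum>s\<in>{1..n}. if n - s < k then first_prob k * ladder_prob (n - k) else 0)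
       = (\<Sum>s\<in>{n-k<..n}. first_prob k * ladder_prob (n - k))"
      by (subst sum.inter_filter[symmetric]) auto
    then show "(\<Sum>s\<in>{1..n}. if n - s < k then first_prob k * ladder_prob (n - k) else 0)
        = real k * first_prob k * ladder_prob (n - k)" using k by simp
  qed
  finally show ?thesis .
qed

lemma stay_prob_eq: "stay_prob n = 1 - (\<Sum>k=1..n. first_prob k)"
proof (induction n)
  case 0
  then show ?case by (simp add: stay_prob_def P.prob_space)
next
  case (Suc n)
  have "{\<omega> \<in> space S. \<forall>i\<in>{1..n}. walk i \<omega> \<le> 0}
     = {\<omega> \<in> space S. \<forall>i\<in>{1..Suc n}. walk i \<omega> \<le> 0}
       \<union> {\<omega> \<in> space S. (\<forall>i\<in>{1..<Suc n}. walk i \<omega> \<le> 0) \<and> walk (Suc n) \<omega> > 0}"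
    by (auto simp: le_Suc_eq not_le)
  then have "stay_prob n = stay_prob (Suc n) + first_prob (Suc n)"
    unfolding stay_prob_def first_prob_def
    by (subst P.finite_measure_Union[symmetric]) (auto dest: bspec[of _ _ "Suc n"])
  then show ?case using Suc by simp
qed

lemma first_prob_0 [simp]: "first_prob 0 = 0"
  by (simp add: first_prob_def)

lemma first_prob_nonneg: "first_prob k \<ge> 0"
  by (simp add: first_prob_def)

lemma first_prob_sums: "stay_prob \<longlonglongrightarrow> 1 - suminf first_prob" and summable_first_prob: "summable first_prob"
proof -
  have eq: "stay_prob n = 1 - (\<Sum>k\<le>n. first_prob k)" for n
    unfolding stay_prob_eq by (subst sum.atLeast0_atMost_Suc_shift[symmetric, THEN trans] | simp add: atMost_atLeast0 sum.atLeast_Suc_atMost)+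
  have "(\<Sum>k\<le>n. first_prob k) \<le> 1" for n
    using eq[of n] measure_nonneg[of S "{\<omega> \<in> space S. \<forall>i\<in>{1..n}. walk i \<omega> \<le> 0}"]
    unfolding stay_prob_def by linarith
  then have "(\<Sum>k<n. first_prob k) \<le> 1" for n
    using first_prob_nonneg by (cases n) (auto simp: lessThan_Suc_atMost)
  then show *: "summable first_prob"
    by (intro summableI_nonneg_bounded[where x=1] first_prob_nonneg)
  have "(\<lambda>n. \<Sum>k\<le>n. first_prob k) \<longlonglongrightarrow> suminf first_prob"
    using summable_LIMSEQ'[OF *] .
  then show "stay_prob \<longlonglongrightarrow> 1 - suminf first_prob"
    unfolding eq by (intro tendsto_intros)
qed

end

lemma continuous_on_power_series_unit_interval:
  fixes c :: "nat \<Rightarrow> real"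
  assumes "summable (\<lambda>n. \<bar>c n\<bar>)"
  shows "continuous_on {0..1} (\<lambda>z. \<Sum>n. c n * z ^ n)"
proof -
  have "uniform_limit {0..1} (\<lambda>n z. \<Sum>i<n. c i * z ^ i) (\<lambda>z. \<Sum>n. c n * z ^ n) sequentially"
  proof (rule Weierstrass_m_test[OF _ assms])
    fix n z assume "z \<in> {0..1::real}"
    then have "\<bar>z\<bar> ^ n \<le> 1" by (intro power_le_one) auto
    then show "norm (c n * z ^ n) \<le> \<bar>c n\<bar>"
      by (simp add: abs_mult power_abs mult_left_le)
  qed
  then show ?thesis
    by (rule uniform_limit_theorem[rotated]) (auto intro!: always_eventually continuous_intros)
qed

context iid_steps
begin

text \<open>Spitzer's identity at \<open>z = 1\<close>.  The relations \<open>Q (1 - T) = 1\<close> and \<open>A = z T' Q\<close> make the derivative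
  of \<open>(1 - T z) * exp (\<Sum> a\<^sub>n z\<^sup>n / n)\<close> vanish on \<open>(0, 1)\<close>; the function is continuous on \<open>[0, 1]\<close>, so
  its values at \<open>0\<close> and \<open>1\<close> agree.\<close>

theorem stay_prob_tendsto:
  assumes sum: "summable (\<lambda>n. pos_prob (Suc n) / real (Suc n))"
  shows "stay_prob \<longlonglongrightarrow> exp (- (\<Sum>n. pos_prob (Suc n) / real (Suc n)))"
proof -
  define b where "b n = pos_prob n / real n" for n
  have b0 [simp]: "b 0 = 0" by (simp add: b_def)
  have b_nonneg: "b n \<ge> 0" for n by (simp add: b_def pos_prob_def)
  have sb: "summable b" using sum by (subst summable_Suc_iff[symmetric]) (simp add: b_def)
  define T where "T z = (\<Sum>n. first_prob n * z ^ n)" for z :: real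
  define Q where "Q z = (\<Sum>n. ladder_prob n * z ^ n)" for z :: real
  define B where "B z = (\<Sum>n. b n * z ^ n)" for z :: real
  define F where "F z = (1 - T z) * exp (B z)" for z
  have F: "(F has_real_derivative 0) (at z)" if z: "0 < z" "z < 1" for z :: real
  proof -
    have nz: "norm z < 1" using z by simp
    let ?D = "\<lambda>n. real n * first_prob n * z ^ n"
    have sT: "summable (\<lambda>n. first_prob n * 1 ^ n)" and sB: "summable (\<lambda>n. b n * 1 ^ n)"
      using summable_first_prob sb by simp_all
    have dT: "(T has_real_derivative (\<Sum>n. diffs first_prob n * z ^ n)) (at z)"
      unfolding T_def using termdiffs_strong[OF sT] nz by simp
    have dB: "(B has_real_derivative (\<Sum>n. diffs b n * z ^ n)) (at z)"
      unfolding B_def using termdiffs_strong[OF sB] nz by simp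
    have diffs: "(\<lambda>n. real n * c n * z ^ n) sums (z * (\<Sum>n. diffs c n * z ^ n))"
      if "summable (\<lambda>n. c n * 1 ^ n)" for c :: "nat \<Rightarrow> real"
    proof -
      have "summable (\<lambda>n. diffs c n * z ^ n)"
        using termdiff_converges[of z 1 c] nz powser_inside[OF that] by simp
      then have "(\<lambda>n. z * (diffs c n * z ^ n)) sums (z * (\<Sum>n. diffs c n * z ^ n))"
        by (intro sums_mult summable_sums)
      then show ?thesis
        by (subst sums_Suc_iff[symmetric, where f="\<lambda>n. real n * c n * z ^ n", simplified] | simp add: diffs_def mult_ac)+
    qed
    have abs_bd: "summable (\<lambda>n. norm (c n * z ^ n))" if "\<And>n. \<bar>c n\<bar> \<le> 1" for c :: "nat \<Rightarrow> real"
      using that z by (intro summable_comparison_test'[OF summable_geometric[of z], of 0]) (auto simp: abs_mult power_abs mult_left_le_one_le)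
    have sQ: "summable (\<lambda>n. norm (ladder_prob n * z ^ n))"
      by (intro abs_bd) (simp add: ladder_prob_def)
    have sT': "summable (\<lambda>n. norm (first_prob n * z ^ n))"
      by (intro abs_bd) (simp add: first_prob_def)
    have sD: "summable (\<lambda>n. norm (?D n))"
      using sums_summable[OF diffs[OF sT]] z by (simp add: first_prob_nonneg)
    have cauchy: "(\<lambda>n. (\<Sum>i\<le>n. c i * ladder_prob (n - i)) * z ^ n) sums ((\<Sum>n. c n * z ^ n) * Q z)"
      if "summable (\<lambda>n. norm (c n * z ^ n))" for c :: "nat \<Rightarrow> real"
    proof -
      have "(\<Sum>i\<le>n. (c i * z ^ i) * (ladder_prob (n - i) * z ^ (n - i))) = (\<Sum>i\<le>n. c i * ladder_prob (n - i)) * z ^ n" for n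
        unfolding sum_distrib_right
        by (intro sum.cong refl) (simp add: mult_ac flip: power_add)
      with Cauchy_product_sums[OF that sQ] show ?thesis by (simp add: Q_def)
    qed
    have split0: "(\<Sum>k=1..n. c k) = (\<Sum>k\<le>n. c k)" if "c 0 = 0" for c :: "nat \<Rightarrow> real" and n
      using that by (simp add: atMost_atLeast0 sum.atLeast_Suc_atMost)
    have "T z * Q z = Q z - 1"
    proof -
      have "(\<lambda>n. ladder_prob n * z ^ n - (if n = 0 then 1 else 0)) sums (Q z - 1)"
        unfolding Q_def by (intro sums_diff summable_sums summable_norm_cancel[OF sQ] sums_single[of 0 "\<lambda>_. 1", simplified])
      moreover have "(\<Sum>i\<le>n. first_prob i * ladder_prob (n - i)) * z ^ n = ladder_prob n * z ^ n - (if n = 0 then 1 else 0)" for n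
        using ladder_prob_renewal[of n] split0[of "\<lambda>i. first_prob i * ladder_prob (n - i)" n] by simp
      ultimately show ?thesis
        using cauchy[OF sT'] sums_unique2 unfolding T_def by auto
    qed
    then have TQ: "(1 - T z) * Q z = 1" by (simp add: algebra_simps)
    have "(\<Sum>n. ?D n) * Q z = (\<Sum>n. real n * b n * z ^ n)"
    proof -
      have "(\<Sum>i\<le>n. real i * first_prob i * ladder_prob (n - i)) = real n * b n" for n
        using pos_prob_ladder[of n] split0[of "\<lambda>i. real i * first_prob i * ladder_prob (n - i)" n]
        by (simp add: b_def)
      then show ?thesis
        using cauchy[OF sD] sums_unique by fastforce
    qed
    then have "z * (\<Sum>n. diffs first_prob n * z ^ n) * Q z = z * (\<Sum>n. diffs b n * z ^ n)"
      using sums_unique[OF diffs[OF sT]] sums_unique[OF diffs[OF sB]] by simp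
    then have "(\<Sum>n. diffs b n * z ^ n) = (\<Sum>n. diffs first_prob n * z ^ n) * Q z"
      using z by simp
    then have eq: "(1 - T z) * (\<Sum>n. diffs b n * z ^ n) = (\<Sum>n. diffs first_prob n * z ^ n)"
      using TQ by (metis mult.assoc mult.commute mult.right_neutral)
    have "(F has_real_derivative ((0 - (\<Sum>n. diffs first_prob n * z ^ n)) * exp (B z)
        + exp (B z) * (\<Sum>n. diffs b n * z ^ n) * (1 - T z))) (at z)"
      unfolding F_def by (intro DERIV_mult DERIV_diff DERIV_const dT DERIV_fun_exp dB)
    also have "(0 - (\<Sum>n. diffs first_prob n * z ^ n)) * exp (B z)
        + exp (B z) * (\<Sum>n. diffs b n * z ^ n) * (1 - T z)
      = exp (B z) * ((1 - T z) * (\<Sum>n. diffs b n * z ^ n) - (\<Sum>n. diffs first_prob n * z ^ n))"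
      by (simp add: algebra_simps)
    also have "\<dots> = 0" by (simp add: eq)
    finally show ?thesis .
  qed
  have "continuous_on {0..1} F"
    unfolding F_def T_def B_def
    using summable_first_prob sb first_prob_nonneg b_nonneg
    by (intro continuous_intros continuous_on_power_series_unit_interval) (simp_all add: abs_of_nonneg)
  then have "F 1 = F 0" using F by (intro DERIV_isconst_end) auto
  moreover have "F 0 = 1" by (simp add: F_def T_def B_def powser_zero)
  moreover have "F 1 = (1 - suminf first_prob) * exp (suminf b)" by (simp add: F_def T_def B_def)
  ultimately have "1 - suminf first_prob = exp (- suminf b)" by (simp add: exp_minus field_simps)
  moreover have "suminf b = (\<Sum>n. pos_prob (Suc n) / real (Suc n))"
    using suminf_split_head[OF sb] by (simp add: b_def)
  ultimately show ?thesis using first_prob_sums by simp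
qed

end

section \<open>Linear functionals of Gaussian white noise\<close>

abbreviation gauss :: "(nat \<Rightarrow> real) measure" where
  "gauss \<equiv> PiM UNIV (\<lambda>_. std_normal_distribution)"

lemma prob_space_std_normal: "prob_space std_normal_distribution"
  by (rule prob_space_normal_density) simp

interpretation std: prob_space std_normal_distribution
  by (rule prob_space_std_normal)

interpretation gs: sequence_space std_normal_distribution
  by unfold_locales

lemma space_gauss [simp]: "space gauss = UNIV"
  by (simp add: space_PiM)

lemma gauss_sets_Collect: "Measurable.pred gauss P \<Longrightarrow> {\<omega>. P \<omega>} \<in> sets gauss"
  by (simp add: pred_def)

lemma gauss_pred_ball:
  "finite S \<Longrightarrow> (\<And>s. s \<in> S \<Longrightarrow> Measurable.pred gauss (P s)) \<Longrightarrow> Measurable.pred gauss (\<lambda>\<omega>. \<forall>s\<in>S. P s \<omega>)"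
  by (intro pred_intros_finite) auto

lemma coordinate_measurable [measurable]: "(\<lambda>\<omega>. \<omega> i) \<in> borel_measurable gauss"
  using measurable_component_singleton[of i UNIV "\<lambda>_. std_normal_distribution"] by simp

lemma measurable_into_gauss:
  assumes "\<And>i. (\<lambda>\<omega>. F \<omega> i) \<in> borel_measurable N"
  shows "F \<in> N \<rightarrow>\<^sub>M gauss"
  by (rule measurable_PiM_single') (use assms in auto)

lemma gauss_coordinates_indep: "gs.P.indep_vars (\<lambda>_. borel) (\<lambda>i \<omega>. \<omega> i) UNIV"
proof -
  have "distr gauss borel (\<lambda>\<omega>. \<omega> i) = std_normal_distribution" for i
    using distr_PiM_component[of UNIV "\<lambda>_. std_normal_distribution" i] prob_space_std_normal
    by (metis (no_types, lifting) UNIV_I distr_cong sets_density sets_lborel)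
  moreover have "distr gauss (\<Pi>\<^sub>M i\<in>UNIV. borel) (\<lambda>x. x) = gauss"
    by (rule distr_id2) (rule sets_PiM_cong, auto)
  ultimately show ?thesis
    by (subst gs.P.indep_vars_iff_distr_eq_PiM) (auto simp: restrict_UNIV)
qed

lemma gauss_coordinate_distributed: "distributed gauss lborel (\<lambda>\<omega>. \<omega> i) std_normal_density"
proof -
  have "distr gauss lborel (\<lambda>\<omega>. \<omega> i) = std_normal_distribution" for i
    using distr_PiM_component[of UNIV "\<lambda>_. std_normal_distribution" i] prob_space_std_normal
    by (metis (no_types, lifting) UNIV_I distr_cong sets_density sets_lborel)
  then show ?thesis by (auto simp: distributed_def)
qed

lemma distr_eq_gauss:
  assumes "prob_space M" "prob_space.indep_vars M (\<lambda>_. borel) Y UNIV"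
    "\<And>i::nat. distributed M lborel (Y i) std_normal_density"
  shows "distr M gauss (\<lambda>x i. Y i x) = gauss"
proof -
  interpret prob_space M by fact
  have [measurable]: "Y i \<in> borel_measurable M" for i
    using assms(3)[of i] by (auto simp: distributed_def)
  have "distr M borel (Y i) = std_normal_distribution" for i
    using assms(3)[of i] by (auto simp: distributed_def cong: distr_cong)
  then have "distr M (\<Pi>\<^sub>M i\<in>UNIV. borel) (\<lambda>x. \<lambda>i\<in>UNIV. Y i x) = gauss"
    using assms(2) by (subst (asm) indep_vars_iff_distr_eq_PiM) auto
  moreover have "distr M gauss (\<lambda>x i. Y i x) = distr M (\<Pi>\<^sub>M i\<in>UNIV. borel) (\<lambda>x. \<lambda>i\<in>UNIV. Y i x)"
    by (rule distr_cong) (auto intro!: sets_PiM_cong simp: restrict_UNIV)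
  ultimately show ?thesis by simp
qed

lemma Phi_minus: "Phi (- y) = measure std_normal_distribution {y..}"
proof -
  have "emeasure std_normal_distribution {..-y} = (\<integral>\<^sup>+x. ennreal (std_normal_density x) * indicator {..-y} x \<partial>lborel)"
    by (subst emeasure_density) auto
  also have "\<dots> = (\<integral>\<^sup>+x. ennreal (std_normal_density (0 + (-1) * x)) * indicator {..-y} (0 + (-1) * x) \<partial>lborel)"
    by (subst nn_integral_real_affine[where c="-1" and t=0]) auto
  also have "\<dots> = (\<integral>\<^sup>+x. ennreal (std_normal_density x) * indicator {y..} x \<partial>lborel)"
    by (intro nn_integral_cong) (auto simp: indicator_def std_normal_density_def)
  also have "\<dots> = emeasure std_normal_distribution {y..}"
    by (subst emeasure_density) auto
  finally show ?thesis by (simp add: Phi_def cdf_def measure_def)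
qed

lemma Phi_eq_nn: "ennreal (Phi (- y)) = (\<integral>\<^sup>+z\<in>{0..}. std_normal_density (y + z) \<partial>lborel)"
proof -
  have "ennreal (Phi (- y)) = (\<integral>\<^sup>+x. ennreal (std_normal_density x) * indicator {y..} x \<partial>lborel)"
    unfolding Phi_minus std.emeasure_eq_measure[symmetric] by (subst emeasure_density) auto
  also have "\<dots> = (\<integral>\<^sup>+z. ennreal (std_normal_density (y + 1 * z)) * indicator {y..} (y + 1 * z) \<partial>lborel)"
    by (subst nn_integral_real_affine[where c=1 and t=y]) auto
  finally show ?thesis by (simp add: indicator_def)
qed

text \<open>The Mills ratio decreases: shifting the density gives
  \<open>\<phi>(y' + z) \<le> exp (- (y'\<^sup>2 - y\<^sup>2) / 2) * \<phi>(y + z)\<close> for \<open>z \<ge> 0\<close>.\<close>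

lemma Phi_minus_le:
  assumes "0 \<le> y" "y \<le> y'"
  shows "Phi (- y') \<le> exp (- (y'\<^sup>2 - y\<^sup>2) / 2) * Phi (- y)"
proof -
  have "ennreal (Phi (- y')) \<le> (\<integral>\<^sup>+z. ennreal (exp (- (y'\<^sup>2 - y\<^sup>2) / 2)) * (ennreal (std_normal_density (y + z)) * indicator {0..} z) \<partial>lborel)"
    unfolding Phi_eq_nn
  proof (rule nn_integral_mono)
    fix z
    have "std_normal_density (y' + z) \<le> exp (- (y'\<^sup>2 - y\<^sup>2) / 2) * std_normal_density (y + z)" if "z \<ge> 0"
    proof -
      have "- ((y' + z)\<^sup>2 / 2) \<le> - (y'\<^sup>2 - y\<^sup>2) / 2 + - ((y + z)\<^sup>2 / 2)"
        using mult_right_mono[OF assms(2) that] by (simp add: power2_eq_square field_simps)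
      then have "exp (- ((y' + z)\<^sup>2 / 2)) \<le> exp (- (y'\<^sup>2 - y\<^sup>2) / 2) * exp (- ((y + z)\<^sup>2 / 2))"
        unfolding exp_add[symmetric] by simp
      then show ?thesis by (simp add: std_normal_density_def divide_right_mono)
    qed
    then show "ennreal (std_normal_density (y' + z)) * indicator {0..} z
      \<le> ennreal (exp (- (y'\<^sup>2 - y\<^sup>2) / 2)) * (ennreal (std_normal_density (y + z)) * indicator {0..} z)"
      by (auto simp: indicator_def ennreal_mult[symmetric])
  qed
  also have "\<dots> = ennreal (exp (- (y'\<^sup>2 - y\<^sup>2) / 2)) * ennreal (Phi (- y))"
    unfolding Phi_eq_nn by (rule nn_integral_cmult) auto
  finally show ?thesis
    by (simp add: ennreal_mult[symmetric] Phi_def cdf_def)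
qed

lemma Phi_nonneg [simp]: "Phi x \<ge> 0" and Phi_le_1 [simp]: "Phi x \<le> 1"
  by (simp_all add: Phi_def cdf_def)

lemma Phi_mono: "x \<le> y \<Longrightarrow> Phi x \<le> Phi y"
  unfolding Phi_def cdf_def by (intro std.finite_measure_mono) auto

lemma Phi_minus_le_exp: "0 \<le> y \<Longrightarrow> Phi (- y) \<le> exp (- y\<^sup>2 / 2)"
  using Phi_minus_le[of 0 y] Phi_le_1[of 0] by (smt (verit) exp_ge_zero mult_left_le diff_zero zero_power2 minus_zero)

lemma Phi_pos: "Phi x > 0"
proof -
  have "Phi x \<noteq> 0"
  proof
    assume "Phi x = 0"
    then have "emeasure std_normal_distribution {..x} = 0"
      by (simp add: Phi_def cdf_def std.emeasure_eq_measure)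
    moreover have nz: "std_normal_density z \<noteq> 0" for z
      using normal_density_pos[of 1 0 z] by simp
    ultimately have "AE z in lborel. z \<notin> {..x}"
      by (subst (asm) emeasure_density, simp, simp, subst (asm) nn_integral_0_iff_AE)
         (auto simp: nz indicator_def elim!: eventually_mono split: if_splits)
    then have "emeasure lborel {..x} = 0" by (subst (asm) AE_iff_measurable[OF _ refl]) (auto simp: atMost_def)
    moreover have "emeasure lborel {x-1..x} \<le> emeasure lborel {..x}" by (intro emeasure_mono) auto
    ultimately show False by simp
  qed
  then show ?thesis using Phi_nonneg[of x] by linarith
qed

definition lin :: "nat set \<Rightarrow> (nat \<Rightarrow> real) \<Rightarrow> (nat \<Rightarrow> real) \<Rightarrow> real" where
  "lin I g \<omega> = (\<Sum>l\<in>I. g l * \<omega> l)"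

lemma lin_measurable [measurable]: "lin I g \<in> borel_measurable gauss"
  unfolding lin_def by measurable

lemma lin_distributed:
  assumes "finite I" "(\<Sum>l\<in>I. (g l)\<^sup>2) = \<sigma>\<^sup>2" "\<sigma> > 0"
  shows "distributed gauss lborel (lin I g) (normal_density 0 \<sigma>)"
proof -
  let ?J = "{l\<in>I. g l \<noteq> 0}"
  have sum: "(\<Sum>l\<in>?J. \<bar>g l\<bar>\<^sup>2) = \<sigma>\<^sup>2"
    unfolding power2_abs assms(2)[symmetric] by (intro sum.mono_neutral_left) (use assms in auto)
  have "?J \<noteq> {}"
  proof
    assume "?J = {}"
    then have "\<sigma>\<^sup>2 = 0" unfolding sum[symmetric] by (simp only: sum.empty)
    then show False using assms(3) by simp
  qed
  have "gs.P.indep_vars (\<lambda>_. borel) (\<lambda>i \<omega>. g i * \<omega> i) UNIV"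
    by (rule gs.P.indep_vars_compose2[OF gauss_coordinates_indep]) auto
  then have "gs.P.indep_vars (\<lambda>_. borel) (\<lambda>i \<omega>. g i * \<omega> i) ?J"
    by (rule gs.P.indep_vars_subset) auto
  moreover have "distributed gauss lborel (\<lambda>\<omega>. g l * \<omega> l) (normal_density 0 \<bar>g l\<bar>)" if "l \<in> ?J" for l
    using gs.P.normal_density_affine[OF gauss_coordinate_distributed, of "g l" 0] that by simp
  ultimately have "distributed gauss lborel (\<lambda>\<omega>. \<Sum>l\<in>?J. g l * \<omega> l) (normal_density (\<Sum>l\<in>?J. 0) (sqrt (\<Sum>l\<in>?J. \<bar>g l\<bar>\<^sup>2)))"
    using \<open>?J \<noteq> {}\<close> assms(1) by (intro gs.P.sum_indep_normal) auto
  moreover have "(\<Sum>l\<in>?J. g l * \<omega> l) = lin I g \<omega>" for \<omega>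
    unfolding lin_def by (intro sum.mono_neutral_left) (use assms in auto)
  ultimately show ?thesis using assms(3) sum by simp
qed

lemma distributed_lin_std:
  assumes "finite I" "(\<Sum>l\<in>I. (g l)\<^sup>2) = \<sigma>\<^sup>2" "\<sigma> > 0" and A: "A \<in> sets borel"
  shows "\<P>(\<omega> in gauss. lin I g \<omega> / \<sigma> \<in> A) = measure std_normal_distribution A"
proof -
  have "distributed gauss lborel (\<lambda>\<omega>. (lin I g \<omega> - 0) / \<sigma>) std_normal_density"
    using lin_distributed[OF assms(1-3)] gs.P.normal_standard_normal_convert[OF assms(3)] by blast
  then have "distr gauss lborel (\<lambda>\<omega>. lin I g \<omega> / \<sigma>) = std_normal_distribution"
    by (simp add: distributed_def)
  then have "measure std_normal_distribution A = measure (distr gauss lborel (\<lambda>\<omega>. lin I g \<omega> / \<sigma>)) A"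
    by simp
  also have "\<dots> = \<P>(\<omega> in gauss. lin I g \<omega> / \<sigma> \<in> A)"
    using A by (subst measure_distr) (auto intro!: arg_cong[where f="measure _"])
  finally show ?thesis by simp
qed

lemma prob_lin_ge:
  assumes "finite I" "(\<Sum>l\<in>I. (g l)\<^sup>2) = \<sigma>\<^sup>2" "\<sigma> > 0"
  shows "\<P>(\<omega> in gauss. lin I g \<omega> \<ge> y) = Phi (- (y / \<sigma>))"
proof -
  have "\<P>(\<omega> in gauss. lin I g \<omega> \<ge> y) = \<P>(\<omega> in gauss. lin I g \<omega> / \<sigma> \<in> {y / \<sigma>..})"
    using assms(3) by (auto intro!: arg_cong[where f="measure _"] simp: divide_le_cancel)
  also have "\<dots> = Phi (- (y / \<sigma>))"
    unfolding Phi_minus by (rule distributed_lin_std[OF assms]) auto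
  finally show ?thesis .
qed

lemma prob_abs_lin_ge:
  assumes "finite I" "(\<Sum>l\<in>I. (g l)\<^sup>2) \<le> (\<eta> / K)\<^sup>2" "\<eta> > 0" "K > 0"
  shows "\<P>(\<omega> in gauss. \<bar>lin I g \<omega>\<bar> \<ge> \<eta>) \<le> 2 * Phi (- K)"
proof -
  define \<sigma> where "\<sigma> = sqrt (\<Sum>l\<in>I. (g l)\<^sup>2)"
  have nn: "(\<Sum>l\<in>I. (g l)\<^sup>2) \<ge> 0" by (intro sum_nonneg) auto
  show ?thesis
  proof (cases "\<sigma> = 0")
    case True
    then have "(\<Sum>l\<in>I. (g l)\<^sup>2) = 0" by (simp add: \<sigma>_def)
    then have "lin I g \<omega> = 0" for \<omega>
      unfolding lin_def using assms(1) by (subst (asm) sum_nonneg_eq_0_iff) (auto intro!: sum.neutral)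
    then show ?thesis using assms(3) by simp
  next
    case False
    then have s: "\<sigma> > 0" and s2: "(\<Sum>l\<in>I. (g l)\<^sup>2) = \<sigma>\<^sup>2" using nn by (auto simp: \<sigma>_def less_le)
    have s2': "(\<Sum>l\<in>I. (- g l)\<^sup>2) = \<sigma>\<^sup>2" using s2 by simp
    have "\<sigma> \<le> \<eta> / K" using assms s2 s by (intro power2_le_imp_le[of \<sigma>]) auto
    then have "K \<le> \<eta> / \<sigma>" using s assms by (simp add: field_simps)
    then have le: "Phi (- (\<eta> / \<sigma>)) \<le> Phi (- K)" by (intro Phi_mono) simp
    have "lin I (\<lambda>l. - g l) \<omega> = - lin I g \<omega>" for \<omega> by (simp add: lin_def sum_negf)
    then have "{\<omega> \<in> space gauss. \<bar>lin I g \<omega>\<bar> \<ge> \<eta>} \<subseteq> {\<omega> \<in> space gauss. lin I g \<omega> \<ge> \<eta>} \<union> {\<omega> \<in> space gauss. lin I (\<lambda>l. - g l) \<omega> \<ge> \<eta>}"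
      by auto
    then have "\<P>(\<omega> in gauss. \<bar>lin I g \<omega>\<bar> \<ge> \<eta>) \<le> measure gauss ({\<omega> \<in> space gauss. lin I g \<omega> \<ge> \<eta>} \<union> {\<omega> \<in> space gauss. lin I (\<lambda>l. - g l) \<omega> \<ge> \<eta>})"
      by (intro gs.P.finite_measure_mono) measurable
    also have "\<dots> \<le> \<P>(\<omega> in gauss. lin I g \<omega> \<ge> \<eta>) + \<P>(\<omega> in gauss. lin I (\<lambda>l. - g l) \<omega> \<ge> \<eta>)"
      by (rule measure_Un_le) (auto intro!: gauss_sets_Collect)
    also have "\<dots> = 2 * Phi (- (\<eta> / \<sigma>))"
      using prob_lin_ge[OF assms(1) s2 s] prob_lin_ge[OF assms(1) s2' s] by simp
    finally show ?thesis using le by linarith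
  qed
qed

lemma prob_lin_between:
  assumes "finite I" "(\<Sum>l\<in>I. (g l)\<^sup>2) = \<sigma>\<^sup>2" "\<sigma> > 0" "a \<le> c"
  shows "\<P>(\<omega> in gauss. a \<le> lin I g \<omega> \<and> lin I g \<omega> \<le> c) \<le> (c - a) / \<sigma>"
proof -
  have "\<P>(\<omega> in gauss. a \<le> lin I g \<omega> \<and> lin I g \<omega> \<le> c) = \<P>(\<omega> in gauss. lin I g \<omega> / \<sigma> \<in> {a / \<sigma>..c / \<sigma>})"
    using assms(3) by (auto intro!: arg_cong[where f="measure _"] simp: divide_le_cancel)
  also have "\<dots> = measure std_normal_distribution {a / \<sigma>..c / \<sigma>}"
    by (rule distributed_lin_std[OF assms(1-3)]) auto
  finally have eq: "\<P>(\<omega> in gauss. a \<le> lin I g \<omega> \<and> lin I g \<omega> \<le> c) = measure std_normal_distribution {a / \<sigma>..c / \<sigma>}" .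
  have le1: "std_normal_density x \<le> 1" for x
  proof -
    have "1 \<le> sqrt (2 * pi)" using pi_gt3 by (intro real_le_rsqrt) simp
    moreover have "exp (- (x\<^sup>2 / 2)) \<le> 1" by simp
    ultimately have "exp (- (x\<^sup>2 / 2)) \<le> 1 * sqrt (2 * pi)" by linarith
    then have "exp (- (x\<^sup>2 / 2)) / sqrt (2 * pi) \<le> 1" by (subst pos_divide_le_eq) simp_all
    then show ?thesis by (simp add: std_normal_density_def)
  qed
  have "emeasure std_normal_distribution {a / \<sigma>..c / \<sigma>} = (\<integral>\<^sup>+x. ennreal (std_normal_density x) * indicator {a / \<sigma>..c / \<sigma>} x \<partial>lborel)"
    by (subst emeasure_density) auto
  also have "\<dots> \<le> (\<integral>\<^sup>+x. indicator {a / \<sigma>..c / \<sigma>} x \<partial>lborel)"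
    by (intro nn_integral_mono) (auto simp: le1 indicator_def)
  also have "\<dots> = ennreal ((c - a) / \<sigma>)"
    using assms by (simp add: divide_right_mono diff_divide_distrib)
  finally show ?thesis
    unfolding eq using assms by (simp add: std.emeasure_eq_measure)
qed

lemma std_normal_shift:
  assumes [measurable]: "F \<in> borel_measurable borel"
  shows "(\<integral>\<^sup>+x. F (x + c) \<partial>std_normal_distribution)
     = (\<integral>\<^sup>+x. F x * ennreal (exp (c * x - c\<^sup>2 / 2)) \<partial>std_normal_distribution)"
proof -
  have "(\<integral>\<^sup>+x. F x * ennreal (exp (c * x - c\<^sup>2 / 2)) \<partial>std_normal_distribution)
     = (\<integral>\<^sup>+x. ennreal (std_normal_density x) * (F x * ennreal (exp (c * x - c\<^sup>2 / 2))) \<partial>lborel)"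
    by (subst nn_integral_density) auto
  also have "\<dots> = (\<integral>\<^sup>+x. ennreal (std_normal_density (c + 1 * x)) * (F (c + 1 * x) * ennreal (exp (c * (c + 1 * x) - c\<^sup>2 / 2))) \<partial>lborel)"
    by (subst nn_integral_real_affine[where c=1 and t=c]) auto
  also have "\<dots> = (\<integral>\<^sup>+x. ennreal (std_normal_density x) * F (x + c) \<partial>lborel)"
  proof (intro nn_integral_cong)
    fix x
    have "std_normal_density (c + x) * exp (c * (c + x) - c\<^sup>2 / 2) = std_normal_density x"
    proof -
      have "- ((c + x)\<^sup>2 / 2) + (c * (c + x) - c\<^sup>2 / 2) = - (x\<^sup>2 / 2)"
        by (simp add: power2_eq_square field_simps)
      then have "exp (- ((c + x)\<^sup>2 / 2)) * exp (c * (c + x) - c\<^sup>2 / 2) = exp (- (x\<^sup>2 / 2))"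
        unfolding exp_add[symmetric] by simp
      then show ?thesis by (simp add: std_normal_density_def)
    qed
    then have "ennreal (std_normal_density (c + x)) * ennreal (exp (c * (c + x) - c\<^sup>2 / 2)) = ennreal (std_normal_density x)"
      by (simp add: ennreal_mult[symmetric])
    then show "ennreal (std_normal_density (c + 1 * x)) * (F (c + 1 * x) * ennreal (exp (c * (c + 1 * x) - c\<^sup>2 / 2)))
      = ennreal (std_normal_density x) * F (x + c)"
      by (simp add: mult_ac add.commute)
  qed
  also have "\<dots> = (\<integral>\<^sup>+x. F (x + c) \<partial>std_normal_distribution)"
    by (subst nn_integral_density) auto
  finally show ?thesis by simp
qed

lemma gauss_upd_measurable [measurable]:
  "(\<lambda>\<omega>. fun_upd \<omega> i (\<omega> i + c)) \<in> gauss \<rightarrow>\<^sub>M gauss"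
  by (rule measurable_into_gauss) (auto simp: fun_upd_def)

lemma nn_integral_gauss_split:
  assumes [measurable]: "F \<in> borel_measurable gauss"
  shows "(\<integral>\<^sup>+\<omega>. F \<omega> \<partial>gauss) = (\<integral>\<^sup>+\<omega>. (\<integral>\<^sup>+x. F (fun_upd \<omega> i x) \<partial>std_normal_distribution) \<partial>PiM (UNIV - {i}) (\<lambda>_. std_normal_distribution))"
proof -
  let ?R = "PiM (UNIV - {i}) (\<lambda>_. std_normal_distribution)"
  interpret R: prob_space ?R by (intro prob_space_PiM prob_space_std_normal)
  interpret pair: pair_sigma_finite std_normal_distribution ?R ..
  have ins: "insert i (UNIV - {i}) = UNIV" by auto
  have meas: "(\<lambda>(x, X). fun_upd X i x) \<in> std_normal_distribution \<Otimes>\<^sub>M ?R \<rightarrow>\<^sub>M gauss"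
    using measurable_fun_upd[where I=UNIV and J="UNIV - {i}" and M="\<lambda>_. std_normal_distribution" and i=i] by measurable
  have "gauss = distr (std_normal_distribution \<Otimes>\<^sub>M ?R) gauss (\<lambda>(x, X). fun_upd X i x)"
    using distr_pair_PiM_eq_PiM[of "UNIV - {i}" "\<lambda>_. std_normal_distribution" i] ins
    by (simp add: prob_space_std_normal)
  then have "(\<integral>\<^sup>+\<omega>. F \<omega> \<partial>gauss) = (\<integral>\<^sup>+\<omega>. F \<omega> \<partial>distr (std_normal_distribution \<Otimes>\<^sub>M ?R) gauss (\<lambda>(x, X). fun_upd X i x))"
    by simp
  also have "\<dots> = (\<integral>\<^sup>+p. F (case p of (x, X) \<Rightarrow> fun_upd X i x) \<partial>(std_normal_distribution \<Otimes>\<^sub>M ?R))"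
    by (rule nn_integral_distr[OF meas]) measurable
  also have "\<dots> = (\<integral>\<^sup>+\<omega>. (\<integral>\<^sup>+x. F (fun_upd \<omega> i x) \<partial>std_normal_distribution) \<partial>?R)"
    using meas by (subst pair.nn_integral_snd[symmetric]) (auto intro: measurable_compose)
  finally show ?thesis .
qed

lemma gauss_shift_coordinate:
  assumes [measurable]: "F \<in> borel_measurable gauss"
  shows "(\<integral>\<^sup>+\<omega>. F (fun_upd \<omega> i (\<omega> i + c)) \<partial>gauss) = (\<integral>\<^sup>+\<omega>. F \<omega> * ennreal (exp (c * \<omega> i - c\<^sup>2 / 2)) \<partial>gauss)"
proof -
  have upd: "(\<lambda>x. fun_upd \<omega> i x) \<in> borel \<rightarrow>\<^sub>M gauss" for \<omega> :: "nat \<Rightarrow> real"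
    by (rule measurable_into_gauss) (auto simp: fun_upd_def)
  show ?thesis
    by (subst (1 2) nn_integral_gauss_split[where i=i])
       (auto intro!: nn_integral_cong std_normal_shift[of "\<lambda>x. F (fun_upd _ i x)", simplified] measurable_compose[OF upd])
qed

text \<open>The Cameron-Martin formula, one coordinate at a time.\<close>

lemma gauss_shift:
  assumes "finite J" and [measurable]: "F \<in> borel_measurable gauss"
  shows "(\<integral>\<^sup>+\<omega>. F (\<lambda>l. \<omega> l + (if l \<in> J then h l else 0)) \<partial>gauss)
    = (\<integral>\<^sup>+\<omega>. F \<omega> * ennreal (exp (lin J h \<omega> - (\<Sum>l\<in>J. (h l)\<^sup>2) / 2)) \<partial>gauss)"
  using assms
proof (induction J arbitrary: F rule: finite_induct)
  case empty
  then show ?case by (simp add: lin_def)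
next
  case (insert i J)
  note [measurable] = insert.prems
  let ?e = "\<lambda>\<omega>. ennreal (exp (lin J h \<omega> - (\<Sum>l\<in>J. (h l)\<^sup>2) / 2))"
  have inv: "?e (fun_upd \<omega> i x) = ?e \<omega>" for \<omega> x
    using insert.hyps by (auto simp: lin_def intro!: arg_cong[where f=ennreal] arg_cong[where f=exp] sum.cong)
  have "(\<integral>\<^sup>+\<omega>. F (\<lambda>l. \<omega> l + (if l \<in> insert i J then h l else 0)) \<partial>gauss)
      = (\<integral>\<^sup>+\<omega>. (\<lambda>\<omega>. F (fun_upd \<omega> i (\<omega> i + h i))) (\<lambda>l. \<omega> l + (if l \<in> J then h l else 0)) \<partial>gauss)"
    using insert.hyps by (intro nn_integral_cong arg_cong[where f=F]) (auto simp: fun_eq_iff)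
  also have "\<dots> = (\<integral>\<^sup>+\<omega>. F (fun_upd \<omega> i (\<omega> i + h i)) * ?e \<omega> \<partial>gauss)"
    by (rule insert.IH) measurable
  also have "\<dots> = (\<integral>\<^sup>+\<omega>. (\<lambda>\<omega>. F \<omega> * ?e \<omega>) (fun_upd \<omega> i (\<omega> i + h i)) \<partial>gauss)"
    by (simp only: inv)
  also have "\<dots> = (\<integral>\<^sup>+\<omega>. (F \<omega> * ?e \<omega>) * ennreal (exp (h i * \<omega> i - (h i)\<^sup>2 / 2)) \<partial>gauss)"
    by (rule gauss_shift_coordinate) measurable
  also have "\<dots> = (\<integral>\<^sup>+\<omega>. F \<omega> * ennreal (exp (lin (insert i J) h \<omega> - (\<Sum>l\<in>insert i J. (h l)\<^sup>2) / 2)) \<partial>gauss)"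
  proof (intro nn_integral_cong)
    fix \<omega>
    have "lin (insert i J) h \<omega> - (\<Sum>l\<in>insert i J. (h l)\<^sup>2) / 2
       = (lin J h \<omega> - (\<Sum>l\<in>J. (h l)\<^sup>2) / 2) + (h i * \<omega> i - (h i)\<^sup>2 / 2)"
      using insert.hyps by (simp add: lin_def add_divide_distrib)
    then show "F \<omega> * ?e \<omega> * ennreal (exp (h i * \<omega> i - (h i)\<^sup>2 / 2))
       = F \<omega> * ennreal (exp (lin (insert i J) h \<omega> - (\<Sum>l\<in>insert i J. (h l)\<^sup>2) / 2))"
      by (simp only: exp_add) (simp add: ennreal_mult mult.assoc)
  qed
  finally show ?case .
qed

lemma lin_add: "lin I g (\<lambda>l. \<omega> l + \<omega>' l) = lin I g \<omega> + lin I g \<omega>'"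
  by (simp add: lin_def algebra_simps sum.distrib)

text \<open>A Gaussian coordinate \<open>\<langle>h, W\<rangle>\<close> is independent of every event \<open>B\<close> that is invariant under shifts along
  \<open>h\<close>.  By \<open>gauss_shift\<close>, the expectations of \<open>1\<^sub>B 1\<^bsub>\<langle>h, W\<rangle> \<ge> b\<^esub> \<phi>(\<langle>h, W\<rangle> - \<theta>)\<close> and of
  \<open>1\<^sub>B 1\<^bsub>\<langle>h, W\<rangle> + \<theta> \<ge> b\<^esub> \<phi>(\<langle>h, W\<rangle> + \<theta>)\<close> agree; integrating over \<open>\<theta>\<close> gives the joint
  probability on the left and the product on the right.\<close>

lemma prob_lin_indep:
  assumes I: "finite I" and unit: "(\<Sum>l\<in>I. (h l)\<^sup>2) = 1"
    and [measurable]: "Measurable.pred gauss B"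
    and inv: "\<And>\<omega> \<theta>. B (\<lambda>l. \<omega> l + (if l \<in> I then \<theta> * h l else 0)) = B \<omega>"
  shows "\<P>(\<omega> in gauss. lin I h \<omega> \<ge> b \<and> B \<omega>) = Phi (- b) * \<P>(\<omega> in gauss. B \<omega>)"
proof -
  let ?\<phi> = "\<lambda>z. ennreal (std_normal_density z)"
  let ?B = "\<lambda>\<omega>. indicator {\<omega>. B \<omega>} \<omega> :: ennreal"
  let ?C = "\<lambda>z. indicator {b..} z :: ennreal"
  have Bm [measurable]: "{\<omega>. B \<omega>} \<in> sets gauss"
    using assms(3) by (simp add: pred_def)
  have shift: "(\<integral>\<^sup>+\<omega>. ?B \<omega> * ?C (lin I h \<omega>) * ?\<phi> (lin I h \<omega> - \<theta>) \<partial>gauss)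
     = (\<integral>\<^sup>+\<omega>. ?B \<omega> * (?C (lin I h \<omega> + \<theta>) * ?\<phi> (lin I h \<omega> + \<theta>)) \<partial>gauss)" for \<theta>
  proof -
    have lin_h: "lin I h (\<lambda>l. \<omega> l + (if l \<in> I then \<theta> * h l else 0)) = lin I h \<omega> + \<theta>" for \<omega>
    proof -
      have "lin I h (\<lambda>l. if l \<in> I then \<theta> * h l else 0) = \<theta> * (\<Sum>l\<in>I. (h l)\<^sup>2)"
        unfolding lin_def sum_distrib_left by (intro sum.cong) (auto simp: power2_eq_square)
      then show ?thesis by (simp add: lin_add unit)
    qed
    have "(\<integral>\<^sup>+\<omega>. ?B \<omega> * (?C (lin I h \<omega> + \<theta>) * ?\<phi> (lin I h \<omega> + \<theta>)) \<partial>gauss)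
       = (\<integral>\<^sup>+\<omega>. (\<lambda>\<omega>. ?B \<omega> * (?C (lin I h \<omega>) * ?\<phi> (lin I h \<omega>))) (\<lambda>l. \<omega> l + (if l \<in> I then \<theta> * h l else 0)) \<partial>gauss)"
      by (simp add: lin_h inv indicator_def)
    also have "\<dots> = (\<integral>\<^sup>+\<omega>. ?B \<omega> * (?C (lin I h \<omega>) * ?\<phi> (lin I h \<omega>)) * ennreal (exp (lin I (\<lambda>l. \<theta> * h l) \<omega> - (\<Sum>l\<in>I. (\<theta> * h l)\<^sup>2) / 2)) \<partial>gauss)"
      by (rule gauss_shift[OF I]) measurable
    also have "\<dots> = (\<integral>\<^sup>+\<omega>. ?B \<omega> * ?C (lin I h \<omega>) * ?\<phi> (lin I h \<omega> - \<theta>) \<partial>gauss)"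
    proof (intro nn_integral_cong)
      fix \<omega>
      have l: "lin I (\<lambda>l. \<theta> * h l) \<omega> = \<theta> * lin I h \<omega>" by (simp add: lin_def sum_distrib_left mult.assoc)
      have q: "(\<Sum>l\<in>I. (\<theta> * h l)\<^sup>2) = \<theta>\<^sup>2" by (simp add: power_mult_distrib sum_distrib_left[symmetric] unit)
      let ?z = "lin I h \<omega>"
      have "- (?z\<^sup>2 / 2) + (\<theta> * ?z - \<theta>\<^sup>2 / 2) = - ((?z - \<theta>)\<^sup>2 / 2)"
        by (simp add: power2_eq_square field_simps)
      then have "exp (- (?z\<^sup>2 / 2)) * exp (\<theta> * ?z - \<theta>\<^sup>2 / 2) = exp (- ((?z - \<theta>)\<^sup>2 / 2))"
        unfolding exp_add[symmetric] by simp
      then have "std_normal_density ?z * exp (\<theta> * ?z - \<theta>\<^sup>2 / 2) = std_normal_density (?z - \<theta>)"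
        by (simp add: std_normal_density_def)
      then have "?\<phi> ?z * ennreal (exp (\<theta> * ?z - \<theta>\<^sup>2 / 2)) = ?\<phi> (?z - \<theta>)"
        by (simp add: ennreal_mult[symmetric])
      then show "?B \<omega> * (?C ?z * ?\<phi> ?z) * ennreal (exp (lin I (\<lambda>l. \<theta> * h l) \<omega> - (\<Sum>l\<in>I. (\<theta> * h l)\<^sup>2) / 2))
        = ?B \<omega> * ?C ?z * ?\<phi> (?z - \<theta>)"
        unfolding l q by (simp add: mult.assoc)
    qed
    finally show ?thesis by simp
  qed
  have total: "(\<integral>\<^sup>+\<theta>. ?\<phi> \<theta> \<partial>lborel) = 1"
    using std.emeasure_space_1 by (simp add: emeasure_density)
  have "emeasure gauss {\<omega>. B \<omega> \<and> lin I h \<omega> \<ge> b} = (\<integral>\<^sup>+\<omega>. ?B \<omega> * ?C (lin I h \<omega>) \<partial>gauss)"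
    by (subst nn_integral_indicator[symmetric])
       (rule gauss_sets_Collect, measurable, auto intro!: nn_integral_cong simp: indicator_def)
  also have "\<dots> = (\<integral>\<^sup>+\<omega>. (\<integral>\<^sup>+\<theta>. ?B \<omega> * ?C (lin I h \<omega>) * ?\<phi> (lin I h \<omega> - \<theta>) \<partial>lborel) \<partial>gauss)"
  proof (intro nn_integral_cong)
    fix \<omega>
    have "(\<integral>\<^sup>+\<theta>. ?\<phi> (lin I h \<omega> - \<theta>) \<partial>lborel) = 1"
      using total by (subst (asm) nn_integral_real_affine[where c="-1" and t="lin I h \<omega>"]) auto
    then show "?B \<omega> * ?C (lin I h \<omega>) = (\<integral>\<^sup>+\<theta>. ?B \<omega> * ?C (lin I h \<omega>) * ?\<phi> (lin I h \<omega> - \<theta>) \<partial>lborel)"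
      by (subst nn_integral_cmult) auto
  qed
  also have "\<dots> = (\<integral>\<^sup>+\<theta>. (\<integral>\<^sup>+\<omega>. ?B \<omega> * ?C (lin I h \<omega>) * ?\<phi> (lin I h \<omega> - \<theta>) \<partial>gauss) \<partial>lborel)"
  proof -
    interpret pair_sigma_finite "lborel :: real measure" gauss ..
    show ?thesis by (rule Fubini') measurable
  qed
  also have "\<dots> = (\<integral>\<^sup>+\<theta>. (\<integral>\<^sup>+\<omega>. ?B \<omega> * (?C (lin I h \<omega> + \<theta>) * ?\<phi> (lin I h \<omega> + \<theta>)) \<partial>gauss) \<partial>lborel)"
    by (simp only: shift)
  also have "\<dots> = (\<integral>\<^sup>+\<omega>. (\<integral>\<^sup>+\<theta>. ?B \<omega> * (?C (lin I h \<omega> + \<theta>) * ?\<phi> (lin I h \<omega> + \<theta>)) \<partial>lborel) \<partial>gauss)"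
  proof -
    interpret pair_sigma_finite gauss "lborel :: real measure" ..
    show ?thesis by (rule Fubini') measurable
  qed
  also have "\<dots> = (\<integral>\<^sup>+\<omega>. ?B \<omega> * ennreal (Phi (- b)) \<partial>gauss)"
  proof (intro nn_integral_cong)
    fix \<omega>
    have "(\<integral>\<^sup>+z. ?\<phi> z * ?C z \<partial>lborel) = ennreal (Phi (- b))"
      unfolding Phi_minus std.emeasure_eq_measure[symmetric] by (subst emeasure_density) auto
    then have "(\<integral>\<^sup>+\<theta>. ?C (lin I h \<omega> + \<theta>) * ?\<phi> (lin I h \<omega> + \<theta>) \<partial>lborel) = ennreal (Phi (- b))"
      by (subst (asm) nn_integral_real_affine[where c="1" and t="lin I h \<omega>"]) (auto simp: mult.commute)
    then show "(\<integral>\<^sup>+\<theta>. ?B \<omega> * (?C (lin I h \<omega> + \<theta>) * ?\<phi> (lin I h \<omega> + \<theta>)) \<partial>lborel) = ?B \<omega> * ennreal (Phi (- b))"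
      by (subst nn_integral_cmult) auto
  qed
  also have "\<dots> = ennreal (Phi (- b)) * emeasure gauss {\<omega>. B \<omega>}"
    by (subst nn_integral_multc) (auto simp: mult.commute)
  finally have "emeasure gauss {\<omega>. B \<omega> \<and> lin I h \<omega> \<ge> b} = ennreal (Phi (- b)) * emeasure gauss {\<omega>. B \<omega>}" .
  then show ?thesis
    by (simp add: measure_def enn2real_mult conj_commute)
qed

section \<open>The Gaussian walk with negative drift\<close>

lemma gauss_prob_le_Un:
  assumes "A \<subseteq> B \<union> C" "B \<in> sets gauss" "C \<in> sets gauss"
  shows "measure gauss A \<le> measure gauss B + measure gauss C"
  using gs.P.finite_measure_mono[OF assms(1)] measure_Un_le[OF assms(2,3)] assms(2,3)
  by (meson order_trans sets.Un)

text \<open>The slack \<open>\<eta>\<close> absorbs the error of replacing the true local field by a sum of walks.\<close>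

definition stay :: "nat \<Rightarrow> real \<Rightarrow> real \<Rightarrow> real" where
  "stay D x \<eta> = \<P>(\<omega> in gauss. \<forall>n\<in>{1..D}. x * (\<Sum>r<n. \<omega> r) - x\<^sup>2 * real n / 2 \<le> \<eta>)"

definition never_up :: "real \<Rightarrow> real" where
  "never_up x = exp (- (\<Sum>n. 1 / real (Suc n) * Phi (- (x * sqrt (real (Suc n)) / 2))))"

text \<open>The function \<open>\<nu>\<close> is a squared walk probability in disguise: by \<open>stay_tendsto_never_up\<close> the number
  \<open>never_up x\<close> is the probability that the walk never becomes positive.\<close>

lemma nu_eq_never_up: "x \<noteq> 0 \<Longrightarrow> x\<^sup>2 / 2 * nu x = (never_up x)\<^sup>2"
  by (simp add: nu_def never_up_def power2_eq_square flip: exp_add)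

lemma summable_Phi_sqrt:
  assumes "x > 0"
  shows "summable (\<lambda>n. Phi (- (x * sqrt (real n) / 2)))"
proof (rule summable_comparison_test'[where N=0])
  show "summable (\<lambda>n. exp (- x\<^sup>2 / 8) ^ n)" using assms by (intro summable_geometric) simp
  fix n
  have "Phi (- (x * sqrt (real n) / 2)) \<le> exp (- (x * sqrt (real n) / 2)\<^sup>2 / 2)"
    using assms by (intro Phi_minus_le_exp) simp
  also have "\<dots> = exp (- x\<^sup>2 / 8) ^ n"
    by (simp add: exp_of_nat_mult[symmetric] power_mult_distrib power_divide mult.commute)
  finally show "norm (Phi (- (x * sqrt (real n) / 2))) \<le> exp (- x\<^sup>2 / 8) ^ n" by simp
qed

lemma summable_Phi_over_n:
  assumes "x > 0"
  shows "summable (\<lambda>n. 1 / real (Suc n) * Phi (- (x * sqrt (real (Suc n)) / 2)))"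
proof (rule summable_comparison_test'[where N=0])
  show "summable (\<lambda>n. Phi (- (x * sqrt (real (Suc n)) / 2)))"
    using summable_Phi_sqrt[OF assms] by (subst summable_Suc_iff)
  show "norm (1 / real (Suc n) * Phi (- (x * sqrt (real (Suc n)) / 2))) \<le> Phi (- (x * sqrt (real (Suc n)) / 2))" for n
    using mult_right_mono[of "1 / real (Suc n)" 1 "Phi (- (x * sqrt (real (Suc n)) / 2))"]
    by (simp del: of_nat_Suc)
qed

lemma never_up_pos: "never_up x > 0"
  by (simp add: never_up_def)

lemma never_up_le_1: "x > 0 \<Longrightarrow> never_up x \<le> 1"
  unfolding never_up_def using suminf_nonneg[OF summable_Phi_over_n] by simp

lemma never_up_mono:
  assumes "0 < x" "x \<le> y"
  shows "never_up x \<le> never_up y"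
proof -
  have "(\<Sum>n. 1 / real (Suc n) * Phi (- (y * sqrt (real (Suc n)) / 2)))
      \<le> (\<Sum>n. 1 / real (Suc n) * Phi (- (x * sqrt (real (Suc n)) / 2)))"
  proof (rule suminf_le)
    show "1 / real (Suc n) * Phi (- (y * sqrt (real (Suc n)) / 2))
        \<le> 1 / real (Suc n) * Phi (- (x * sqrt (real (Suc n)) / 2))" for n
      using assms by (intro mult_left_mono Phi_mono) (auto intro!: mult_right_mono)
    show "summable (\<lambda>n. 1 / real (Suc n) * Phi (- (y * sqrt (real (Suc n)) / 2)))"
      "summable (\<lambda>n. 1 / real (Suc n) * Phi (- (x * sqrt (real (Suc n)) / 2)))"
      using assms by (intro summable_Phi_over_n; linarith)+
  qed
  then show ?thesis by (simp add: never_up_def)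
qed

context
  fixes x :: real assumes x: "x > 0"
begin

interpretation w: iid_steps std_normal_distribution "\<lambda>y. x * y - x\<^sup>2 / 2"
  by unfold_locales simp

lemma walk_eq: "w.walk n \<omega> = x * (\<Sum>r<n. \<omega> r) - x\<^sup>2 * real n / 2"
  by (simp add: w.walk_def sum_subtractf sum_distrib_left)

lemma stay_eq: "w.stay_prob D = stay D x 0"
  unfolding w.stay_prob_def stay_def walk_eq ..

lemma pos_prob_eq:
  assumes "n > 0"
  shows "w.pos_prob n = Phi (- (x * sqrt (real n) / 2))"
proof -
  let ?g = "\<lambda>_::nat. x"
  let ?y = "x\<^sup>2 * real n / 2"
  have s: "(\<Sum>l\<in>{..<n}. (?g l)\<^sup>2) = (x * sqrt (real n))\<^sup>2" "x * sqrt (real n) > 0"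
    using x assms by (auto simp: power_mult_distrib)
  have w: "w.walk n \<omega> > 0 \<longleftrightarrow> lin {..<n} ?g \<omega> > ?y" for \<omega>
    unfolding walk_eq by (simp add: lin_def sum_distrib_left)
  have y: "?y / (x * sqrt (real n)) = x * sqrt (real n) / 2"
    using x assms real_sqrt_pow2[of "real n"] by (simp add: field_simps power2_eq_square)
  have ge: "\<P>(\<omega> in gauss. lin {..<n} ?g \<omega> \<ge> ?y) = Phi (- (x * sqrt (real n) / 2))"
    unfolding y[symmetric] by (rule prob_lin_ge[OF _ s]) simp
  have "\<P>(\<omega> in gauss. lin {..<n} ?g \<omega> \<ge> ?y) \<le> \<P>(\<omega> in gauss. lin {..<n} ?g \<omega> > ?y) + \<P>(\<omega> in gauss. ?y \<le> lin {..<n} ?g \<omega> \<and> lin {..<n} ?g \<omega> \<le> ?y)"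
    by (intro gauss_prob_le_Un) (auto intro!: gauss_sets_Collect)
  moreover have "\<P>(\<omega> in gauss. ?y \<le> lin {..<n} ?g \<omega> \<and> lin {..<n} ?g \<omega> \<le> ?y) \<le> 0"
    using prob_lin_between[OF _ s, of ?y ?y] by simp
  moreover have "\<P>(\<omega> in gauss. lin {..<n} ?g \<omega> > ?y) \<le> \<P>(\<omega> in gauss. lin {..<n} ?g \<omega> \<ge> ?y)"
    by (rule gs.P.finite_measure_mono) (auto intro!: gauss_sets_Collect)
  ultimately show ?thesis unfolding w.pos_prob_def w ge[symmetric] by linarith
qed

lemma stay_tendsto_never_up: "(\<lambda>D. stay D x 0) \<longlonglongrightarrow> never_up x"
proof -
  have "summable (\<lambda>n. w.pos_prob (Suc n) / real (Suc n))"
    using summable_Phi_over_n[OF x] by (simp add: pos_prob_eq)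
  from w.stay_prob_tendsto[OF this] show ?thesis
    unfolding stay_eq by (simp add: pos_prob_eq never_up_def)
qed

text \<open>A walk that stays below \<open>0\<close> up to time \<open>D\<close> but not forever is positive at some later
  time \<open>n\<close>, which has probability at most \<open>\<Phi>(- x \<surd>n / 2)\<close>.\<close>

lemma stay_minus_never_up:
  "0 \<le> stay D x 0 - never_up x" "stay D x 0 - never_up x \<le> (\<Sum>n. Phi (- (x * sqrt (real (n + Suc D)) / 2)))"
proof -
  have "1 - suminf w.first_prob = never_up x"
    using LIMSEQ_unique[OF w.first_prob_sums] stay_tendsto_never_up unfolding stay_eq by blast
  moreover have "stay D x 0 = 1 - (\<Sum>k<Suc D. w.first_prob k)"
    unfolding stay_eq[symmetric] w.stay_prob_eq
    by (simp only: lessThan_Suc_atMost atMost_atLeast0) (simp add: sum.atLeast_Suc_atMost)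
  ultimately have eq: "stay D x 0 - never_up x = (\<Sum>n. w.first_prob (n + Suc D))"
    using suminf_minus_initial_segment[OF w.summable_first_prob, of "Suc D"] by simp
  have le: "w.first_prob (n + Suc D) \<le> Phi (- (x * sqrt (real (n + Suc D)) / 2))" for n
  proof -
    have "w.first_prob (n + Suc D) \<le> w.pos_prob (n + Suc D)"
      unfolding w.first_prob_def w.pos_prob_def
      by (rule gs.P.finite_measure_mono) (auto intro!: gauss_sets_Collect)
    then show ?thesis by (subst (asm) pos_prob_eq) simp_all
  qed
  have s1: "summable (\<lambda>n. w.first_prob (n + Suc D))"
    using w.summable_first_prob by (rule summable_ignore_initial_segment)
  have s2: "summable (\<lambda>n. Phi (- (x * sqrt (real (n + Suc D)) / 2)))"
    using summable_Phi_sqrt[OF x] by (rule summable_ignore_initial_segment)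
  show "0 \<le> stay D x 0 - never_up x"
    unfolding eq by (rule suminf_nonneg[OF s1]) (rule w.first_prob_nonneg)
  show "stay D x 0 - never_up x \<le> (\<Sum>n. Phi (- (x * sqrt (real (n + Suc D)) / 2)))"
    unfolding eq by (rule suminf_le[OF le s1 s2])
qed

text \<open>Both events differ only if the walk hits an interval of length \<open>|\<eta>|\<close> at one of \<open>D\<close> times, and the
  density of the walk at these times is at most \<open>1 / x\<close>.\<close>

lemma stay_slack:
  "\<bar>stay D x \<eta> - stay D x 0\<bar> \<le> real D * \<bar>\<eta>\<bar> / x"
proof -
  define E where "E n = {\<omega> \<in> space gauss. min 0 \<eta> \<le> w.walk n \<omega> \<and> w.walk n \<omega> \<le> max 0 \<eta>}" for n
  have E [measurable]: "E n \<in> sets gauss" for n unfolding E_def by measurable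
  have prob: "measure gauss (E n) \<le> \<bar>\<eta>\<bar> / x" if "n \<in> {1..D}" for n
  proof -
    let ?g = "\<lambda>_::nat. x" and ?d = "x\<^sup>2 * real n / 2"
    have s: "(\<Sum>l\<in>{..<n}. (?g l)\<^sup>2) = (x * sqrt (real n))\<^sup>2" "x * sqrt (real n) > 0"
      using x that by (auto simp: power_mult_distrib)
    have "E n = {\<omega> \<in> space gauss. min 0 \<eta> + ?d \<le> lin {..<n} ?g \<omega> \<and> lin {..<n} ?g \<omega> \<le> max 0 \<eta> + ?d}"
      unfolding E_def walk_eq lin_def by (auto simp: sum_distrib_left)
    then have "measure gauss (E n) \<le> (max 0 \<eta> + ?d - (min 0 \<eta> + ?d)) / (x * sqrt (real n))"
      using prob_lin_between[OF _ s, of "min 0 \<eta> + ?d" "max 0 \<eta> + ?d"] by simp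
    also have "\<dots> = \<bar>\<eta>\<bar> / (x * sqrt (real n))" by (simp add: max_def min_def abs_if)
    also have "\<dots> \<le> \<bar>\<eta>\<bar> / x" using x that by (intro divide_left_mono) auto
    finally show ?thesis .
  qed
  have U: "measure gauss (\<Union>n\<in>{1..D}. E n) \<le> real D * \<bar>\<eta>\<bar> / x"
  proof -
    have "measure gauss (\<Union>n\<in>{1..D}. E n) \<le> (\<Sum>n\<in>{1..D}. measure gauss (E n))"
      by (intro measure_UNION_le) auto
    also have "\<dots> \<le> (\<Sum>n\<in>{1..D}. \<bar>\<eta>\<bar> / x)" by (intro sum_mono prob)
    finally show ?thesis by simp
  qed
  let ?A = "\<lambda>\<eta>. {\<omega> \<in> space gauss. \<forall>n\<in>{1..D}. w.walk n \<omega> \<le> \<eta>}"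
  have stay_A: "stay D x \<eta> = measure gauss (?A \<eta>)" for \<eta> unfolding stay_def walk_eq ..
  have Am [measurable]: "?A \<eta> \<in> sets gauss" for \<eta> by measurable
  have sub: "?A \<alpha> \<subseteq> ?A \<beta> \<union> (\<Union>n\<in>{1..D}. E n)" if ab: "{\<alpha>, \<beta>} = {0, \<eta>}" for \<alpha> \<beta>
  proof
    fix \<omega> assume A: "\<omega> \<in> ?A \<alpha>"
    show "\<omega> \<in> ?A \<beta> \<union> (\<Union>n\<in>{1..D}. E n)"
    proof (cases "\<exists>n\<in>{1..D}. w.walk n \<omega> > \<beta>")
      case True
      then obtain n where n: "n \<in> {1..D}" "w.walk n \<omega> > \<beta>" by blast
      moreover have "w.walk n \<omega> \<le> \<alpha>" using A n(1) by blast
      moreover have "min 0 \<eta> \<le> \<beta>" "\<alpha> \<le> max 0 \<eta>" using ab by (auto simp: doubleton_eq_iff)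
      ultimately have "\<omega> \<in> E n" by (simp add: E_def)
      then show ?thesis using n(1) by blast
    next
      case False
      then have "\<omega> \<in> ?A \<beta>" by (simp add: not_less)
      then show ?thesis by blast
    qed
  qed
  have Em: "(\<Union>n\<in>{1..D}. E n) \<in> sets gauss" by measurable
  have "measure gauss (?A \<eta>) \<le> measure gauss (?A 0) + measure gauss (\<Union>n\<in>{1..D}. E n)"
    "measure gauss (?A 0) \<le> measure gauss (?A \<eta>) + measure gauss (\<Union>n\<in>{1..D}. E n)"
    by (rule gauss_prob_le_Un[OF sub Am Em]; blast)+
  with U show ?thesis unfolding stay_A by linarith
qed

end

lemma stay_unif_never_up:
  assumes "x0 > 0" "\<delta> > 0"
  shows "\<exists>D0. \<forall>D\<ge>D0. \<forall>x\<ge>x0. \<bar>stay D x 0 - never_up x\<bar> \<le> \<delta>"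
proof -
  let ?c = "\<lambda>x n. Phi (- (x * sqrt (real n) / 2))"
  have sm: "summable (?c x0)" by (rule summable_Phi_sqrt[OF assms(1)])
  from suminf_exist_split[OF assms(2) sm] obtain N where N: "\<And>n. n \<ge> N \<Longrightarrow> norm (\<Sum>i. ?c x0 (i + n)) < \<delta>"
    by auto
  have "\<bar>stay D x 0 - never_up x\<bar> \<le> \<delta>" if "D \<ge> N" "x \<ge> x0" for D x
  proof -
    have x: "x > 0" using that assms by simp
    have "stay D x 0 - never_up x \<le> (\<Sum>n. ?c x (n + Suc D))" by (rule stay_minus_never_up(2)[OF x])
    also have "\<dots> \<le> (\<Sum>n. ?c x0 (n + Suc D))"
      using that by (intro suminf_le summable_ignore_initial_segment summable_Phi_sqrt assms x Phi_mono)
        (auto intro!: mult_right_mono)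
    also have "\<dots> \<le> \<delta>" using N[of "Suc D"] that by (simp only: real_norm_def) linarith
    finally show ?thesis using stay_minus_never_up(1)[OF x, of D] by simp
  qed
  then show ?thesis by blast
qed

lemma stay_le_1: "stay D x \<eta> \<le> 1" and stay_nonneg: "stay D x \<eta> \<ge> 0"
  unfolding stay_def by simp_all

section \<open>Independent windows\<close>

lemma gauss_sign:
  assumes "sg \<in> {1, -1::real}"
  shows "distr gauss gauss (\<lambda>\<omega> i. sg * \<omega> i) = gauss"
proof (rule distr_eq_gauss)
  show "prob_space gauss" by (rule gs.P.prob_space_axioms)
  show "gs.P.indep_vars (\<lambda>_. borel) (\<lambda>i \<omega>. sg * \<omega> i) UNIV"
    by (rule gs.P.indep_vars_compose2[OF gauss_coordinates_indep]) auto
  show "distributed gauss lborel (\<lambda>\<omega>. sg * \<omega> i) std_normal_density" for i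
    using gs.P.normal_density_affine[OF gauss_coordinate_distributed, of sg 0 i] assms by auto
qed

lemma prob_gauss_sign:
  assumes "sg \<in> {1, -1::real}" and [measurable]: "Measurable.pred gauss B"
  shows "\<P>(\<omega> in gauss. B (\<lambda>i. sg * \<omega> i)) = \<P>(\<omega> in gauss. B \<omega>)"
proof -
  have [measurable]: "(\<lambda>\<omega> i. sg * \<omega> i) \<in> gauss \<rightarrow>\<^sub>M gauss"
    by (rule measurable_into_gauss) measurable
  have "\<P>(\<omega> in gauss. B \<omega>) = measure (distr gauss gauss (\<lambda>\<omega> i. sg * \<omega> i)) {\<omega>. B \<omega>}"
    by (simp add: gauss_sign[OF assms(1)])
  also have "\<dots> = \<P>(\<omega> in gauss. B (\<lambda>i. sg * \<omega> i))"
    by (subst measure_distr) (auto intro!: gauss_sets_Collect arg_cong[where f="measure _"])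
  finally show ?thesis by simp
qed

text \<open>The law of the walk is the same along every window of distinct coordinates, in either
  direction and with either sign.\<close>

lemma stay_window:
  assumes "inj_on w {..<D}" "sg \<in> {1, -1::real}"
  shows "\<P>(\<omega> in gauss. \<forall>n\<in>{1..D}. x * (\<Sum>r<n. sg * \<omega> (w r)) - x\<^sup>2 * real n / 2 \<le> \<eta>) = stay D x \<eta>"
proof -
  (* An injective extension of the window to all indices: later indices are mapped above
     every coordinate of the window. *)
  define g where "g r = (if r < D then w r else Suc (\<Sum>s<D. w s) + r)" for r
  have wle: "w r \<le> (\<Sum>s<D. w s)" if "r < D" for r
    using that by (intro member_le_sum) auto
  have "inj g"
  proof (rule injI)
    fix r s assume "g r = g s"
    then show "r = s"
      using wle[of r] wle[of s] inj_onD[OF assms(1), of r s] by (auto simp: g_def split: if_splits)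
  qed
  let ?B = "\<lambda>\<omega>. \<forall>n\<in>{1..D}. x * (\<Sum>r<n. \<omega> r) - x\<^sup>2 * real n / 2 \<le> \<eta>"
  have "(\<Sum>r<n. sg * \<omega> (w r)) = (\<Sum>r<n. sg * \<omega> (g r))" if "n \<in> {1..D}" for n \<omega>
    using that by (intro sum.cong) (auto simp: g_def)
  then have "\<P>(\<omega> in gauss. \<forall>n\<in>{1..D}. x * (\<Sum>r<n. sg * \<omega> (w r)) - x\<^sup>2 * real n / 2 \<le> \<eta>)
      = \<P>(\<omega> in gauss. (\<lambda>\<omega>. ?B (\<lambda>i. sg * \<omega> i)) (\<lambda>i. \<omega> (g i)))"
    by simp
  also have "\<dots> = \<P>(\<omega> in gauss. ?B (\<lambda>i. sg * \<omega> i))"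
    by (rule gs.prob_reindex[OF _ \<open>inj g\<close>]) measurable
  also have "\<dots> = stay D x \<eta>"
    unfolding stay_def by (rule prob_gauss_sign[OF assms(2)]) measurable
  finally show ?thesis .
qed

lemma stay_windows:
  assumes fin: "finite Q" "Q \<noteq> {}"
    and inj: "inj_on (\<lambda>(q, r). w q r) (Q \<times> {..<D})"
    and sg: "\<And>q. q \<in> Q \<Longrightarrow> sg q \<in> {1, -1::real}"
  shows "\<P>(\<omega> in gauss. \<forall>q\<in>Q. \<forall>n\<in>{1..D}. x q * (\<Sum>r<n. sg q * \<omega> (w q r)) - (x q)\<^sup>2 * real n / 2 \<le> \<eta>)
    = (\<Prod>q\<in>Q. stay D (x q) \<eta>)"
proof -
  define K where "K q = w q ` {..<D}" for q
  define A where "A q = {y \<in> space (PiM (K q) (\<lambda>_. borel)). \<forall>n\<in>{1..D}. x q * (\<Sum>r<n. sg q * y (w q r)) - (x q)\<^sup>2 * real n / 2 \<le> \<eta>}" for q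
  have "disjoint_family_on K Q"
  proof (unfold disjoint_family_on_def, intro ballI impI)
    fix q q' assume q: "q \<in> Q" "q' \<in> Q" "q \<noteq> q'"
    have "w q r \<noteq> w q' r'" if "r < D" "r' < D" for r r'
      using inj_onD[OF inj, of "(q, r)" "(q', r')"] q that by auto
    then show "K q \<inter> K q' = {}" by (auto simp: K_def)
  qed
  then have ind: "gs.P.indep_vars (\<lambda>q. PiM (K q) (\<lambda>_. borel)) (\<lambda>q \<omega>. restrict \<omega> (K q)) Q"
    using gs.P.indep_vars_restrict[OF gauss_coordinates_indep, of Q K] by simp
  have A: "A q \<in> sets (PiM (K q) (\<lambda>_. borel))" if "q \<in> Q" for q
  proof -
    have [measurable]: "(\<lambda>y. y (w q r)) \<in> borel_measurable (PiM (K q) (\<lambda>_. borel))" if "r < D" for r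
      using that by (intro measurable_component_singleton) (auto simp: K_def)
    have "(\<lambda>y. x q * (\<Sum>r<n. sg q * y (w q r)) - (x q)\<^sup>2 * real n / 2) \<in> borel_measurable (PiM (K q) (\<lambda>_. borel))" if "n \<in> {1..D}" for n
    proof -
      have "(\<lambda>y. \<Sum>r<n. sg q * y (w q r)) \<in> borel_measurable (PiM (K q) (\<lambda>_. borel))"
        by (rule borel_measurable_sum, rule borel_measurable_times) (use that in auto)
      then show ?thesis by measurable
    qed
    then show ?thesis unfolding A_def
      by (intro sets.sets_Collect_finite_All borel_measurable_le) auto
  qed
  have mem: "restrict \<omega> (K q) \<in> A q \<longleftrightarrow> (\<forall>n\<in>{1..D}. x q * (\<Sum>r<n. sg q * \<omega> (w q r)) - (x q)\<^sup>2 * real n / 2 \<le> \<eta>)" for q \<omega>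
  proof -
    have "(\<Sum>r<n. sg q * restrict \<omega> (K q) (w q r)) = (\<Sum>r<n. sg q * \<omega> (w q r))" if "n \<in> {1..D}" for n
      using that by (intro sum.cong) (auto simp: K_def)
    then show ?thesis by (auto simp: A_def space_PiM)
  qed
  have "{\<omega> \<in> space gauss. \<forall>q\<in>Q. \<forall>n\<in>{1..D}. x q * (\<Sum>r<n. sg q * \<omega> (w q r)) - (x q)\<^sup>2 * real n / 2 \<le> \<eta>}
    = (\<Inter>q\<in>Q. (\<lambda>\<omega>. restrict \<omega> (K q)) -` A q \<inter> space gauss)"
    using fin by (auto simp: mem)
  then have "\<P>(\<omega> in gauss. \<forall>q\<in>Q. \<forall>n\<in>{1..D}. x q * (\<Sum>r<n. sg q * \<omega> (w q r)) - (x q)\<^sup>2 * real n / 2 \<le> \<eta>)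
    = (\<Prod>q\<in>Q. measure gauss ((\<lambda>\<omega>. restrict \<omega> (K q)) -` A q \<inter> space gauss))"
    using gs.P.indep_varsD_finite[OF ind fin(2,1) A] by simp
  also have "\<dots> = (\<Prod>q\<in>Q. stay D (x q) \<eta>)"
  proof (rule prod.cong[OF refl])
    fix q assume q: "q \<in> Q"
    have "inj_on (w q) {..<D}"
      using inj q by (auto simp: inj_on_def)
    from stay_window[OF this sg[OF q]] show "measure gauss ((\<lambda>\<omega>. restrict \<omega> (K q)) -` A q \<inter> space gauss) = stay D (x q) \<eta>"
      by (simp add: vimage_def mem)
  qed
  finally show ?thesis .
qed

section \<open>Local maxima above a high level\<close>

lemma lin_scale: "lin I (\<lambda>l. c * g l) \<omega> = c * lin I g \<omega>"
  by (simp add: lin_def sum_distrib_left mult.assoc)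

lemma lin_diff_fun: "lin I (\<lambda>l. g l - h l) \<omega> = lin I g \<omega> - lin I h \<omega>"
  by (simp add: lin_def algebra_simps sum_subtractf)

lemma lin_add_fun: "lin I (\<lambda>l. g l + h l) \<omega> = lin I g \<omega> + lin I h \<omega>"
  by (simp add: lin_def algebra_simps sum.distrib)

lemma lin_shift_along:
  "lin I r (\<lambda>l. \<omega> l + (if l \<in> I then \<theta> * h l else 0)) = lin I r \<omega> + \<theta> * (\<Sum>l\<in>I. r l * h l)"
proof -
  have "lin I r (\<lambda>l. if l \<in> I then \<theta> * h l else 0) = \<theta> * (\<Sum>l\<in>I. r l * h l)"
    unfolding lin_def sum_distrib_left by (intro sum.cong) auto
  then show ?thesis by (simp add: lin_add)
qed

text \<open>Here \<open>h\<close> is the contrast at the peak, \<open>g s\<close> are the contrasts of its neighbours, and \<open>local_part s\<close>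
  approximates \<open>b (g s - h)\<close> by a vector supported near the change points.  The approximation error is
  measured together with the contribution \<open>b (1 - \<rho> s) h\<close> of the peak itself, so that \<open>b\<close> times
  the part of \<open>g s\<close> orthogonal to \<open>h\<close> is the local part plus this error.\<close>

locale local_max =
  fixes I :: "nat set" and h :: "nat \<Rightarrow> real" and S :: "'s set" and g :: "'s \<Rightarrow> nat \<Rightarrow> real"
    and local_part :: "'s \<Rightarrow> nat \<Rightarrow> real" and \<rho> c :: "'s \<Rightarrow> real" and b \<eta> K :: real
  assumes I: "finite I" and S: "finite S" and unit: "(\<Sum>l\<in>I. (h l)\<^sup>2) = 1"
    and \<rho>: "\<And>s. s \<in> S \<Longrightarrow> (\<Sum>l\<in>I. g s l * h l) = \<rho> s"
    and \<rho>_le: "\<And>s. s \<in> S \<Longrightarrow> \<rho> s \<le> 1"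
    and err: "\<And>s. s \<in> S \<Longrightarrow> (\<Sum>l\<in>I. (b * (g s l - h l) - local_part s l + b * (1 - \<rho> s) * h l)\<^sup>2) \<le> (\<eta> / K)\<^sup>2"
    and pos: "b > 0" "\<eta> > 0" "K > 0"
begin

definition r where "r s l = g s l - \<rho> s * h l"

lemma orth: "s \<in> S \<Longrightarrow> (\<Sum>l\<in>I. r s l * h l) = 0"
proof -
  assume s: "s \<in> S"
  have "(\<Sum>l\<in>I. r s l * h l) = (\<Sum>l\<in>I. g s l * h l) - \<rho> s * (\<Sum>l\<in>I. (h l)\<^sup>2)"
    by (simp add: r_def algebra_simps sum_subtractf sum_distrib_left power2_eq_square)
  then show ?thesis using \<rho>[OF s] unit by simp
qed

lemma lin_r: "lin I (r s) \<omega> = lin I (g s) \<omega> - \<rho> s * lin I h \<omega>"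
  unfolding r_def lin_diff_fun lin_scale ..

definition e where "e s l = b * (g s l - h l) - local_part s l + b * (1 - \<rho> s) * h l"

lemma lin_e: "b * lin I (r s) \<omega> = lin I (local_part s) \<omega> + lin I (e s) \<omega>"
  unfolding e_def lin_r lin_add_fun lin_diff_fun lin_scale by (simp add: algebra_simps)

definition bad where "bad = {\<omega> \<in> space gauss. \<exists>s\<in>S. \<bar>lin I (e s) \<omega>\<bar> \<ge> \<eta>}"

lemma bad_sets [measurable]: "bad \<in> sets gauss"
  unfolding bad_def using S by measurable

lemma prob_bad: "measure gauss bad \<le> real (card S) * (2 * Phi (- K))"
proof -
  have "bad = (\<Union>s\<in>S. {\<omega> \<in> space gauss. \<bar>lin I (e s) \<omega>\<bar> \<ge> \<eta>})" by (auto simp: bad_def)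
  then have "measure gauss bad \<le> (\<Sum>s\<in>S. \<P>(\<omega> in gauss. \<bar>lin I (e s) \<omega>\<bar> \<ge> \<eta>))"
    using S by (simp only:) (intro measure_UNION_le, auto intro!: gauss_sets_Collect)
  also have "\<dots> \<le> (\<Sum>s\<in>S. 2 * Phi (- K))"
    using err pos I unfolding e_def by (intro sum_mono prob_abs_lin_ge) auto
  finally show ?thesis by simp
qed

text \<open>Since \<open>\<rho> s \<le> 1\<close>, replacing the peak height by \<open>b\<close> in \<open>\<langle>r s, W\<rangle> < (1 - \<rho> s) \<langle>h, W\<rangle>\<close> makes the condition
  stronger; it then no longer involves the peak height and is independent of it.\<close>

lemma prob_peak_ge:
  assumes c: "\<And>s. s \<in> S \<Longrightarrow> c s - \<eta> \<le> b\<^sup>2 * (1 - \<rho> s)"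
  shows "Phi (- b) * (\<P>(\<omega> in gauss. \<forall>s\<in>S. lin I (local_part s) \<omega> \<le> c s - 2 * \<eta>) - real (card S) * (2 * Phi (- K)))
    \<le> \<P>(\<omega> in gauss. lin I h \<omega> \<ge> b \<and> (\<forall>s\<in>S. lin I (g s) \<omega> < lin I h \<omega>))"
proof -
  let ?B = "\<lambda>\<omega>. \<forall>s\<in>S. lin I (r s) \<omega> < (1 - \<rho> s) * b"
  have [measurable]: "Measurable.pred gauss ?B" by (intro gauss_pred_ball S) measurable
  have Lm: "Measurable.pred gauss (\<lambda>\<omega>. \<forall>s\<in>S. lin I (local_part s) \<omega> \<le> c s - 2 * \<eta>)" by (intro gauss_pred_ball S) measurable
  have Rm: "Measurable.pred gauss (\<lambda>\<omega>. lin I h \<omega> \<ge> b \<and> (\<forall>s\<in>S. lin I (g s) \<omega> < lin I h \<omega>))"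
    by (intro pred_intros_logic gauss_pred_ball S) measurable
  have "{\<omega> \<in> space gauss. \<forall>s\<in>S. lin I (local_part s) \<omega> \<le> c s - 2 * \<eta>} \<subseteq> {\<omega> \<in> space gauss. ?B \<omega>} \<union> bad"
  proof safe
    fix \<omega> s assume L: "\<forall>s\<in>S. lin I (local_part s) \<omega> \<le> c s - 2 * \<eta>" and ok: "\<omega> \<notin> bad" and s: "s \<in> S"
    have "b * lin I (r s) \<omega> < c s - 2 * \<eta> + \<eta>"
      using L ok s unfolding lin_e bad_def by force
    also have "\<dots> \<le> b * ((1 - \<rho> s) * b)" using c[OF s] by (simp add: power2_eq_square algebra_simps)
    finally show "lin I (r s) \<omega> < (1 - \<rho> s) * b" using pos by simp
  qed
  then have "\<P>(\<omega> in gauss. \<forall>s\<in>S. lin I (local_part s) \<omega> \<le> c s - 2 * \<eta>) \<le> \<P>(\<omega> in gauss. ?B \<omega>) + measure gauss bad"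
    by (intro gauss_prob_le_Un) (auto intro!: gauss_sets_Collect)
  then have "\<P>(\<omega> in gauss. \<forall>s\<in>S. lin I (local_part s) \<omega> \<le> c s - 2 * \<eta>) - real (card S) * (2 * Phi (- K)) \<le> \<P>(\<omega> in gauss. ?B \<omega>)"
    using prob_bad by linarith
  then have "Phi (- b) * (\<P>(\<omega> in gauss. \<forall>s\<in>S. lin I (local_part s) \<omega> \<le> c s - 2 * \<eta>) - real (card S) * (2 * Phi (- K)))
    \<le> Phi (- b) * \<P>(\<omega> in gauss. ?B \<omega>)"
    by (intro mult_left_mono) auto
  also have "\<dots> = \<P>(\<omega> in gauss. lin I h \<omega> \<ge> b \<and> ?B \<omega>)"
    by (rule prob_lin_indep[OF I unit, symmetric]) (auto simp: lin_shift_along orth)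
  also have "\<dots> \<le> \<P>(\<omega> in gauss. lin I h \<omega> \<ge> b \<and> (\<forall>s\<in>S. lin I (g s) \<omega> < lin I h \<omega>))"
  proof (rule gs.P.finite_measure_mono)
    show "{\<omega> \<in> space gauss. lin I h \<omega> \<ge> b \<and> ?B \<omega>} \<subseteq> {\<omega> \<in> space gauss. lin I h \<omega> \<ge> b \<and> (\<forall>s\<in>S. lin I (g s) \<omega> < lin I h \<omega>)}"
    proof safe
      fix \<omega> s assume B: "?B \<omega>" and b: "b \<le> lin I h \<omega>" and s: "s \<in> S"
      have "(1 - \<rho> s) * b \<le> (1 - \<rho> s) * lin I h \<omega>" using \<rho>_le[OF s] b by (intro mult_left_mono) auto
      then show "lin I (g s) \<omega> < lin I h \<omega>" using B s by (force simp: lin_r algebra_simps)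
    qed
  qed (use Rm in \<open>simp add: gauss_sets_Collect\<close>)
  finally show ?thesis .
qed

text \<open>As before, but peaks higher than \<open>b + 1\<close> are discarded first; on the remaining event the peak
  height may be replaced by \<open>b + 1\<close>.\<close>

lemma prob_weak_peak_le:
  assumes c: "\<And>s. s \<in> S \<Longrightarrow> (1 - \<rho> s) * b * (b + 1) \<le> c s + \<eta>"
  shows "\<P>(\<omega> in gauss. lin I h \<omega> \<ge> b \<and> (\<forall>s\<in>S. lin I (g s) \<omega> \<le> lin I h \<omega>))
    \<le> Phi (- b) * (\<P>(\<omega> in gauss. \<forall>s\<in>S. lin I (local_part s) \<omega> \<le> c s + 2 * \<eta>) + real (card S) * (2 * Phi (- K))) + Phi (- (b + 1))"
proof -
  let ?B = "\<lambda>\<omega>. \<forall>s\<in>S. lin I (r s) \<omega> \<le> (1 - \<rho> s) * (b + 1)"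
  have Bm [measurable]: "Measurable.pred gauss ?B" by (intro gauss_pred_ball S) measurable
  have Lm: "Measurable.pred gauss (\<lambda>\<omega>. \<forall>s\<in>S. lin I (local_part s) \<omega> \<le> c s + 2 * \<eta>)" by (intro gauss_pred_ball S) measurable
  have LBm: "Measurable.pred gauss (\<lambda>\<omega>. lin I h \<omega> \<ge> b \<and> ?B \<omega>)" by measurable
  have hm: "Measurable.pred gauss (\<lambda>\<omega>. lin I h \<omega> \<ge> b + 1)" by measurable
  have "{\<omega> \<in> space gauss. lin I h \<omega> \<ge> b \<and> (\<forall>s\<in>S. lin I (g s) \<omega> \<le> lin I h \<omega>)}
      \<subseteq> {\<omega> \<in> space gauss. lin I h \<omega> \<ge> b \<and> ?B \<omega>} \<union> {\<omega> \<in> space gauss. lin I h \<omega> \<ge> b + 1}"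
  proof safe
    fix \<omega> s assume h: "b \<le> lin I h \<omega>" "\<not> b + 1 \<le> lin I h \<omega>" "\<forall>s\<in>S. lin I (g s) \<omega> \<le> lin I h \<omega>" and s: "s \<in> S"
    have "lin I (r s) \<omega> \<le> (1 - \<rho> s) * lin I h \<omega>" using h s by (simp add: lin_r algebra_simps)
    also have "\<dots> \<le> (1 - \<rho> s) * (b + 1)" using \<rho>_le[OF s] h by (intro mult_left_mono) auto
    finally show "lin I (r s) \<omega> \<le> (1 - \<rho> s) * (b + 1)" .
  qed
  then have "\<P>(\<omega> in gauss. lin I h \<omega> \<ge> b \<and> (\<forall>s\<in>S. lin I (g s) \<omega> \<le> lin I h \<omega>))
      \<le> \<P>(\<omega> in gauss. lin I h \<omega> \<ge> b \<and> ?B \<omega>) + \<P>(\<omega> in gauss. lin I h \<omega> \<ge> b + 1)"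
    using LBm hm by (intro gauss_prob_le_Un) (auto simp: pred_def)
  also have "\<P>(\<omega> in gauss. lin I h \<omega> \<ge> b \<and> ?B \<omega>) = Phi (- b) * \<P>(\<omega> in gauss. ?B \<omega>)"
    by (rule prob_lin_indep[OF I unit]) (auto simp: lin_shift_along orth)
  also have "\<P>(\<omega> in gauss. lin I h \<omega> \<ge> b + 1) = Phi (- (b + 1))"
    using prob_lin_ge[OF I, of h 1] unit by simp
  finally have 1: "\<P>(\<omega> in gauss. lin I h \<omega> \<ge> b \<and> (\<forall>s\<in>S. lin I (g s) \<omega> \<le> lin I h \<omega>))
      \<le> Phi (- b) * \<P>(\<omega> in gauss. ?B \<omega>) + Phi (- (b + 1))" .
  have "{\<omega> \<in> space gauss. ?B \<omega>} \<subseteq> {\<omega> \<in> space gauss. \<forall>s\<in>S. lin I (local_part s) \<omega> \<le> c s + 2 * \<eta>} \<union> bad"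
  proof safe
    fix \<omega> s assume B: "?B \<omega>" and ok: "\<omega> \<notin> bad" and s: "s \<in> S"
    have "b * lin I (r s) \<omega> \<le> b * ((1 - \<rho> s) * (b + 1))" using B s pos by (intro mult_left_mono) auto
    also have "\<dots> \<le> c s + \<eta>" using c[OF s] by (simp add: mult_ac)
    finally have "b * lin I (r s) \<omega> \<le> c s + \<eta>" .
    moreover have "\<bar>lin I (e s) \<omega>\<bar> < \<eta>" using ok s unfolding bad_def by force
    ultimately show "lin I (local_part s) \<omega> \<le> c s + 2 * \<eta>" unfolding lin_e by linarith
  qed
  then have "\<P>(\<omega> in gauss. ?B \<omega>) \<le> \<P>(\<omega> in gauss. \<forall>s\<in>S. lin I (local_part s) \<omega> \<le> c s + 2 * \<eta>) + measure gauss bad"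
    using Lm by (intro gauss_prob_le_Un) (auto simp: pred_def)
  then have "\<P>(\<omega> in gauss. ?B \<omega>) \<le> \<P>(\<omega> in gauss. \<forall>s\<in>S. lin I (local_part s) \<omega> \<le> c s + 2 * \<eta>) + real (card S) * (2 * Phi (- K))"
    using prob_bad by linarith
  then have "Phi (- b) * \<P>(\<omega> in gauss. ?B \<omega>) \<le> Phi (- b) * (\<P>(\<omega> in gauss. \<forall>s\<in>S. lin I (local_part s) \<omega> \<le> c s + 2 * \<eta>) + real (card S) * (2 * Phi (- K)))"
    by (intro mult_left_mono) auto
  with 1 show ?thesis by linarith
qed

end

text \<open>If both functionals exceed \<open>b\<close>, their sum exceeds \<open>2 b\<close>, and its variance is
  \<open>4 - |h - g|\<^sup>2\<close> by the parallelogram law.\<close>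

lemma prob_both_ge:
  assumes I: "finite I" and "(\<Sum>l\<in>I. (h l)\<^sup>2) = 1" "(\<Sum>l\<in>I. (g l)\<^sup>2) = 1" and b: "b \<ge> 0"
  shows "\<P>(\<omega> in gauss. lin I h \<omega> \<ge> b \<and> lin I g \<omega> \<ge> b)
    \<le> Phi (- b) * exp (- b\<^sup>2 * (\<Sum>l\<in>I. (h l - g l)\<^sup>2) / 8)"
proof -
  define q where "q = (\<Sum>l\<in>I. (h l - g l)\<^sup>2)"
  define v where "v = (\<Sum>l\<in>I. (h l + g l)\<^sup>2)"
  have qv: "q + v = 4"
  proof -
    have "q + v = (\<Sum>l\<in>I. 2 * (h l)\<^sup>2 + 2 * (g l)\<^sup>2)"
      unfolding q_def v_def sum.distrib[symmetric] by (intro sum.cong) (auto simp: power2_eq_square algebra_simps)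
    then show ?thesis using assms by (simp add: sum.distrib sum_distrib_left[symmetric])
  qed
  have nn: "q \<ge> 0" "v \<ge> 0" by (auto simp: q_def v_def intro!: sum_nonneg)
  have sub: "\<P>(\<omega> in gauss. lin I h \<omega> \<ge> b \<and> lin I g \<omega> \<ge> b) \<le> \<P>(\<omega> in gauss. lin I (\<lambda>l. h l + g l) \<omega> \<ge> 2 * b)"
    by (rule gs.P.finite_measure_mono) (auto simp: lin_add_fun intro!: gauss_sets_Collect)
  show ?thesis
  proof (cases "b = 0 \<or> v = 0")
    case True
    then consider "b = 0" | "b > 0" "v = 0" using b by force
    then show ?thesis
    proof cases
      case 1
      have "\<P>(\<omega> in gauss. lin I h \<omega> \<ge> b \<and> lin I g \<omega> \<ge> b) \<le> \<P>(\<omega> in gauss. lin I h \<omega> \<ge> b)"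
        by (rule gs.P.finite_measure_mono) (auto intro!: gauss_sets_Collect)
      also have "\<dots> = Phi (- b)" using prob_lin_ge[OF I, of h 1 b] assms by simp
      finally show ?thesis using 1 by simp
    next
      case 2
      then have "lin I (\<lambda>l. h l + g l) \<omega> = 0" for \<omega>
      proof -
        have "\<forall>l\<in>I. (h l + g l)\<^sup>2 = 0"
          using 2(2) I unfolding v_def by (subst (asm) sum_nonneg_eq_0_iff) auto
        then show ?thesis unfolding lin_def by (intro sum.neutral) auto
      qed
      then have "\<P>(\<omega> in gauss. lin I h \<omega> \<ge> b \<and> lin I g \<omega> \<ge> b) \<le> 0" using sub 2 by simp
      also have "0 \<le> Phi (- b) * exp (- b\<^sup>2 * q / 8)" by simp
      finally show ?thesis by (simp add: q_def)
    qed
  next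
    case False
    then have v: "v > 0" and b': "b > 0" using nn b by auto
    define y where "y = 2 * b / sqrt v"
    have "sqrt v \<le> sqrt 4" using qv nn by (intro real_sqrt_le_mono) simp
    then have "b * sqrt v \<le> 2 * b" using b' by simp
    then have y: "b \<le> y" using v by (simp add: y_def le_divide_eq)
    have "y\<^sup>2 - b\<^sup>2 = b\<^sup>2 * (4 / v - 1)" using v by (simp add: y_def power_mult_distrib power_divide algebra_simps)
    also have "4 / v - 1 \<ge> q / 4"
    proof -
      have "v * (1 + q / 4) \<le> 4"
      proof -
        have v': "v = 4 - q" using qv by simp
        have "v * (1 + q / 4) = 4 - q * q / 4" unfolding v' by (simp add: field_simps)
        then show ?thesis using nn by simp
      qed
      then have "1 + q / 4 \<le> 4 / v" using v by (simp add: le_divide_eq mult.commute)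
      then show ?thesis by simp
    qed
    then have "b\<^sup>2 * (4 / v - 1) \<ge> b\<^sup>2 * (q / 4)" by (intro mult_left_mono) auto
    finally have sq: "y\<^sup>2 - b\<^sup>2 \<ge> b\<^sup>2 * (q / 4)" .
    have "\<P>(\<omega> in gauss. lin I (\<lambda>l. h l + g l) \<omega> \<ge> 2 * b) = Phi (- y)"
      using prob_lin_ge[OF I, of "\<lambda>l. h l + g l" "sqrt v" "2 * b"] v by (simp add: v_def y_def)
    also have "\<dots> \<le> exp (- (y\<^sup>2 - b\<^sup>2) / 2) * Phi (- b)" by (rule Phi_minus_le[OF b y])
    also have "\<dots> \<le> exp (- b\<^sup>2 * q / 8) * Phi (- b)" using sq by (intro mult_right_mono) (auto simp: field_simps)
    finally show ?thesis using sub by (simp add: q_def mult.commute)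
  qed
qed

section \<open>The contrast vectors\<close>

text \<open>The height of the contrast left of the change point \<open>j\<close>, its depth right of \<open>j\<close>, and
  the jump at \<open>j\<close>.\<close>

definition ampL :: "real \<Rightarrow> real \<Rightarrow> real" where "ampL u v = sqrt (v / (u * (u + v)))"
definition ampR :: "real \<Rightarrow> real \<Rightarrow> real" where "ampR u v = sqrt (u / (v * (u + v)))"
definition ampM :: "real \<Rightarrow> real \<Rightarrow> real" where "ampM u v = sqrt ((u + v) / (u * v))"

context
  fixes u v :: real assumes u: "u > 0" and v: "v > 0"
begin

lemma ampL_sq: "(ampL u v)\<^sup>2 = 1 / u - 1 / (u + v)"
  and ampR_sq: "(ampR u v)\<^sup>2 = 1 / v - 1 / (u + v)"
  and ampM_sq: "(ampM u v)\<^sup>2 = 1 / u + 1 / v"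
  using u v unfolding ampL_def ampR_def ampM_def by (simp_all add: divide_simps)

lemma ampL_pos: "ampL u v > 0" and ampR_pos: "ampR u v > 0" and ampM_pos: "ampM u v > 0"
  using u v by (simp_all add: ampL_def ampR_def ampM_def)

lemma ampL_q: "ampL u v = v / sqrt (u * v * (u + v))"
  and ampR_q: "ampR u v = u / sqrt (u * v * (u + v))"
  and ampM_q: "ampM u v = (u + v) / sqrt (u * v * (u + v))"
proof -
  have q: "sqrt (u * v * (u + v)) > 0" "(sqrt (u * v * (u + v)))\<^sup>2 = u * v * (u + v)" using u v by auto
  have nz: "u \<noteq> 0" "v \<noteq> 0" "u + v \<noteq> 0" using u v by auto
  have s: "sqrt (w\<^sup>2 / (u * v * (u + v))) = w / sqrt (u * v * (u + v))" if "w > 0" for w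
    using that by (simp add: real_sqrt_divide)
  have "v / (u * (u + v)) = v\<^sup>2 / (u * v * (u + v))"
    by (subst frac_eq_eq) (use nz in \<open>simp_all add: power2_eq_square mult_ac\<close>)
  then show "ampL u v = v / sqrt (u * v * (u + v))" unfolding ampL_def using s[OF v] by simp
  have "u / (v * (u + v)) = u\<^sup>2 / (u * v * (u + v))"
    by (subst frac_eq_eq) (use nz in \<open>simp_all add: power2_eq_square mult_ac\<close>)
  then show "ampR u v = u / sqrt (u * v * (u + v))" unfolding ampR_def using s[OF u] by simp
  have "(u + v) / (u * v) = (u + v)\<^sup>2 / (u * v * (u + v))"
    by (subst frac_eq_eq) (use nz in \<open>simp_all add: power2_eq_square mult_ac\<close>)
  then show "ampM u v = (u + v) / sqrt (u * v * (u + v))" unfolding ampM_def using s[of "u + v"] u v by simp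
qed

lemma ampM_eq: "ampM u v = ampL u v + ampR u v"
  unfolding ampL_q ampR_q ampM_q by (simp add: add_divide_distrib add.commute)

end

definition beyond :: "nat \<Rightarrow> nat \<Rightarrow> real" where "beyond p l = (if p < l then 1 else 0)"

text \<open>Written as a combination of the three step functions \<open>beyond i\<close>, \<open>beyond j\<close>, \<open>beyond k\<close>, so that moving one
  change point alters one summand; \<open>contrast_step\<close> gives the values.\<close>

definition contrast :: "nat \<Rightarrow> nat \<Rightarrow> nat \<Rightarrow> nat \<Rightarrow> real" where
  "contrast i j k l = (let u = real j - real i; v = real k - real j in
     ampL u v * beyond i l - ampM u v * beyond j l + ampR u v * beyond k l)"

lemma contrast_step:
  assumes "i < j" "j < k"
  shows "contrast i j k l = (if l \<le> i then 0 else if l \<le> j then ampL (real j - real i) (real k - real j)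
     else if l \<le> k then - ampR (real j - real i) (real k - real j) else 0)"
  using assms ampM_eq[of "real j - real i" "real k - real j"] by (auto simp: contrast_def Let_def beyond_def)

lemma sum_indicator_interval:
  fixes p q m :: nat
  assumes "p \<le> q" "q \<le> m"
  shows "(\<Sum>l=1..m. if p < l \<and> l \<le> q then (f l :: real) else 0) = (\<Sum>l\<in>{p<..q}. f l)"
proof -
  have "{p<..q} = {l \<in> {1..m}. p < l \<and> l \<le> q}" using assms by auto
  then show ?thesis by (simp only: sum.inter_filter finite_atLeastAtMost)
qed

lemma sum_step:
  assumes "i \<le> j" "j \<le> k" "k \<le> m"
  shows "(\<Sum>l=1..m. (if l \<le> i then 0 else if l \<le> j then a else if l \<le> k then c else (0::real)))
     = (real j - real i) * a + (real k - real j) * c"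
proof -
  have "(\<Sum>l=1..m. (if l \<le> i then 0 else if l \<le> j then a else if l \<le> k then c else 0))
    = (\<Sum>l=1..m. (if i < l \<and> l \<le> j then a else 0) + (if j < l \<and> l \<le> k then c else 0))"
    using assms by (intro sum.cong) auto
  then show ?thesis using assms by (simp add: sum.distrib sum_indicator_interval of_nat_diff del: One_nat_def)
qed

lemma contrast_unit:
  assumes "i < j" "j < k" "k \<le> m"
  shows "(\<Sum>l=1..m. (contrast i j k l)\<^sup>2) = 1"
proof -
  let ?u = "real j - real i" and ?v = "real k - real j"
  have uv: "?u > 0" "?v > 0" using assms by auto
  have "(\<Sum>l=1..m. (contrast i j k l)\<^sup>2) = (\<Sum>l=1..m. (if l \<le> i then 0 else if l \<le> j then (ampL ?u ?v)\<^sup>2 else if l \<le> k then (ampR ?u ?v)\<^sup>2 else 0))"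
    unfolding contrast_step[OF assms(1,2)] by (intro sum.cong) auto
  also have "\<dots> = ?u * (ampL ?u ?v)\<^sup>2 + ?v * (ampR ?u ?v)\<^sup>2"
    using assms by (intro sum_step) auto
  also have "\<dots> = 1" unfolding ampL_sq[OF uv] ampR_sq[OF uv] using uv by (simp add: divide_simps del: diff_gt_0_iff_gt)
  finally show ?thesis .
qed

lemma lin_beyond: "p \<le> m \<Longrightarrow> lin {1..m} (beyond p) \<omega> = (\<Sum>l=1..m. \<omega> l) - (\<Sum>l=1..p. \<omega> l)"
proof -
  assume p: "p \<le> m"
  have "lin {1..m} (beyond p) \<omega> = (\<Sum>l=1..m. if p < l \<and> l \<le> m then \<omega> l else 0)"
    unfolding lin_def by (intro sum.cong) (auto simp: beyond_def)
  also have "\<dots> = (\<Sum>l\<in>{p<..m}. \<omega> l)" using p by (intro sum_indicator_interval) auto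
  also have "\<dots> = (\<Sum>l=1..m. \<omega> l) - (\<Sum>l=1..p. \<omega> l)"
  proof -
    have "{1..m} = {1..p} \<union> {p<..m}" using p by auto
    then have "(\<Sum>l=1..m. \<omega> l) = (\<Sum>l=1..p. \<omega> l) + (\<Sum>l\<in>{p<..m}. \<omega> l)"
      by (metis (no_types, lifting) sum.union_disjoint finite_atLeastAtMost finite_greaterThanAtMost ivl_disj_int_two(8) Int_commute disjoint_iff atLeastAtMost_iff greaterThanAtMost_iff not_le)
    then show ?thesis by simp
  qed
  finally show ?thesis .
qed

lemma lin_contrast:
  assumes "i < j" "j < k" "k \<le> m"
  shows "lin {1..m} (contrast i j k) \<omega> = ampM (real j - real i) (real k - real j) * (\<Sum>l=1..j. \<omega> l)
     - ampL (real j - real i) (real k - real j) * (\<Sum>l=1..i. \<omega> l) - ampR (real j - real i) (real k - real j) * (\<Sum>l=1..k. \<omega> l)"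
proof -
  let ?u = "real j - real i" and ?v = "real k - real j"
  have "contrast i j k = (\<lambda>l. (ampL ?u ?v * beyond i l - ampM ?u ?v * beyond j l) + ampR ?u ?v * beyond k l)"
    by (simp add: contrast_def Let_def fun_eq_iff)
  then have "lin {1..m} (contrast i j k) \<omega> = ampL ?u ?v * lin {1..m} (beyond i) \<omega> - ampM ?u ?v * lin {1..m} (beyond j) \<omega> + ampR ?u ?v * lin {1..m} (beyond k) \<omega>"
    by (simp only: lin_add_fun lin_diff_fun lin_scale)
  then show ?thesis using assms ampM_eq[of ?u ?v] by (simp add: lin_beyond algebra_simps del: One_nat_def)
qed

lemma Z_stat_eq_lin:
  assumes "i < j" "j < k" "k \<le> m"
  shows "Z_stat X i j k \<omega> = lin {1..m} (contrast i j k) (\<lambda>l. X l \<omega> - \<mu>)"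
proof -
  let ?u = "real j - real i" and ?v = "real k - real j"
  have uv: "?u > 0" "?v > 0" using assms by auto
  define P where "P n = (\<Sum>l=1..n. X l \<omega> - \<mu>)" for n
  have ps: "partial_sum X n \<omega> = P n + real n * \<mu>" for n
    by (simp add: P_def partial_sum_def sum_subtractf)
  define u v where "u = ?u" and "v = ?v"
  have ki: "real k - real i = u + v" by (simp add: u_def v_def)
  have uv': "u > 0" "v > 0" using uv by (simp_all add: u_def v_def)
  have num: "partial_sum X j \<omega> - partial_sum X i \<omega> - u * (partial_sum X k \<omega> - partial_sum X i \<omega>) / (u + v)
     = ((u + v) * P j - v * P i - u * P k) / (u + v)"
  proof -
    have "real j = real i + u" "real k = real i + u + v" by (simp_all add: u_def v_def)
    then show ?thesis using uv' unfolding ps by (simp add: field_simps)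
  qed
  have den: "u * (1 - u / (u + v)) = (u * v * (u + v)) / (u + v)\<^sup>2"
  proof -
    have "1 - u / (u + v) = v / (u + v)" using uv' by (simp add: field_simps)
    then show ?thesis using uv' by (simp add: power2_eq_square)
  qed
  have "Z_stat X i j k \<omega> = ((u + v) * P j - v * P i - u * P k) / (u + v) / (sqrt (u * v * (u + v)) / (u + v))"
    unfolding Z_stat_def ki u_def[symmetric] num den using uv' by (simp add: real_sqrt_divide)
  also have "\<dots> = ((u + v) * P j - v * P i - u * P k) / sqrt (u * v * (u + v))"
    using uv' by simp
  also have "\<dots> = ampM u v * P j - ampL u v * P i - ampR u v * P k"
    unfolding ampL_q[OF uv'] ampR_q[OF uv'] ampM_q[OF uv'] by (simp add: diff_divide_distrib)
  also have "\<dots> = lin {1..m} (contrast i j k) (\<lambda>l. X l \<omega> - \<mu>)"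
    unfolding lin_contrast[OF assms] by (simp add: P_def u_def v_def)
  finally show ?thesis .
qed

section \<open>Separation of the contrasts\<close>

definition spread :: "real \<Rightarrow> nat \<Rightarrow> nat \<Rightarrow> nat \<Rightarrow> nat \<Rightarrow> bool" where
  "spread L m i j k \<longleftrightarrow> real j - real i \<ge> L \<and> real k - real j \<ge> L \<and> k \<le> m"

text \<open>When all segments have lengths between \<open>L = \<epsilon> b\<^sup>2\<close> and \<open>M = C b\<^sup>2\<close>, all jumps are at least of
  order \<open>1 / b\<close>.\<close>

lemma amplitude_lower:
  assumes "0 < L" "u \<ge> L" "v \<ge> L" "u + v \<le> M"
  shows "ampL u v \<ge> sqrt L / M" "ampR u v \<ge> sqrt L / M" "ampM u v \<ge> sqrt L / M"
proof -
  have *: "sqrt L / M \<le> sqrt (v / (u * (u + v)))" if "u \<ge> L" "v \<ge> L" "u + v \<le> M" for u v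
  proof -
    have "L / (M * M) \<le> v / (u * (u + v))"
      using that assms(1) by (intro frac_le mult_mono mult_pos_pos) auto
    then have "sqrt (L / (M * M)) \<le> sqrt (v / (u * (u + v)))" by (rule real_sqrt_le_mono)
    moreover have "sqrt (L / (M * M)) = sqrt L / M" using that assms(1) by (simp add: real_sqrt_divide)
    ultimately show ?thesis by simp
  qed
  show 1: "ampL u v \<ge> sqrt L / M" unfolding ampL_def using assms by (intro *)
  show 2: "ampR u v \<ge> sqrt L / M"
    unfolding ampR_def using *[of v u] assms by (simp add: add.commute mult.commute)
  have "ampM u v = ampL u v + ampR u v" "ampR u v > 0" using assms by (auto intro!: ampM_eq ampR_pos)
  with 1 show "ampM u v \<ge> sqrt L / M" by simp
qed

lemma sum_sq_ge_interval:
  assumes "p \<le> q" "q \<le> m" "\<And>l. p < l \<Longrightarrow> l \<le> q \<Longrightarrow> \<bar>f l\<bar> \<ge> a" "a \<ge> 0"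
  shows "(real q - real p) * a\<^sup>2 \<le> (\<Sum>l=1..m. (f l)\<^sup>2)"
proof -
  have "(real q - real p) * a\<^sup>2 = (\<Sum>l\<in>{p<..q}. a\<^sup>2)" using assms by (simp add: of_nat_diff)
  also have "\<dots> \<le> (\<Sum>l\<in>{p<..q}. (f l)\<^sup>2)"
    using assms by (intro sum_mono) (auto simp: abs_le_square_iff[symmetric])
  also have "\<dots> \<le> (\<Sum>l=1..m. (f l)\<^sup>2)" using assms by (intro sum_mono2) auto
  finally show ?thesis .
qed

lemma sum_sq_diff_commute: "(\<Sum>l\<in>A. (f l - g l)\<^sup>2) = (\<Sum>l\<in>A. (g l - f l :: real)\<^sup>2)"
  by (simp add: power2_commute)

definition min_jump :: "real \<Rightarrow> real \<Rightarrow> real" where "min_jump L M = sqrt L / M"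

context
  fixes L M :: real and m :: nat
  assumes L: "0 < L" and M: "real m \<le> M"
begin

lemma contrast_regions:
  assumes "spread L m i j k"
  shows "i < j" "j < k" "k \<le> m"
    "l \<le> i \<Longrightarrow> contrast i j k l = 0" "i < l \<Longrightarrow> l \<le> j \<Longrightarrow> contrast i j k l \<ge> min_jump L M"
    "j < l \<Longrightarrow> l \<le> k \<Longrightarrow> contrast i j k l \<le> - min_jump L M" "k < l \<Longrightarrow> contrast i j k l = 0"
    "L \<le> M" "min_jump L M > 0"
proof -
  show ij: "i < j" and jk: "j < k" and km: "k \<le> m" using assms L by (auto simp: spread_def)
  have uv: "real j - real i \<ge> L" "real k - real j \<ge> L" "(real j - real i) + (real k - real j) \<le> M"
    using assms M km by (auto simp: spread_def)
  note amp = amplitude_lower[OF L uv, folded min_jump_def]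
  show "l \<le> i \<Longrightarrow> contrast i j k l = 0" "k < l \<Longrightarrow> contrast i j k l = 0" using ij jk by (auto simp: contrast_step)
  show "i < l \<Longrightarrow> l \<le> j \<Longrightarrow> contrast i j k l \<ge> min_jump L M" "j < l \<Longrightarrow> l \<le> k \<Longrightarrow> contrast i j k l \<le> - min_jump L M"
    using ij jk amp by (auto simp: contrast_step)
  show "L \<le> M" using uv L by linarith
  then show "min_jump L M > 0" using L by (simp add: min_jump_def)
qed

lemma scaled_le:
  assumes "L \<le> M" "0 \<le> d" "d \<le> M"
  shows "L / M * d \<le> L" "L / M * d \<le> d"
proof -
  have "L * d \<le> L * M" using assms L by (intro mult_left_mono) auto
  then show "L / M * d \<le> L" using assms L by (simp add: divide_le_eq mult.commute)
  show "L / M * d \<le> d" using assms L mult_right_mono[of "L / M" 1 d] by simp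
qed

text \<open>Between the two left end points one contrast vanishes and the other one is at least \<open>min_jump\<close>.  The
  factor \<open>L / M\<close> allows for a displacement that is longer than the segment.\<close>

lemma sep_i:
  assumes t: "spread L m i j k" and s: "spread L m i' j' k'" and lt: "i < i'"
  shows "(min_jump L M)\<^sup>2 * (L / M) * (real i' - real i) \<le> (\<Sum>l=1..m. (contrast i j k l - contrast i' j' k' l)\<^sup>2)"
proof -
  note T = contrast_regions[OF t] and R = contrast_regions[OF s]
  have "L / M * (real i' - real i) \<le> real (min i' j) - real i"
    using scaled_le[of "real i' - real i"] T(8) R(1-3) M lt t by (auto simp: min_def spread_def)
  then have "(min_jump L M)\<^sup>2 * (L / M * (real i' - real i)) \<le> (min_jump L M)\<^sup>2 * (real (min i' j) - real i)"
    by (intro mult_left_mono) auto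
  also have "\<dots> = (real (min i' j) - real i) * (min_jump L M)\<^sup>2" by simp
  also have "\<dots> \<le> (\<Sum>l=1..m. (contrast i j k l - contrast i' j' k' l)\<^sup>2)"
  proof (rule sum_sq_ge_interval)
    fix l assume "i < l" "l \<le> min i' j"
    then show "min_jump L M \<le> \<bar>contrast i j k l - contrast i' j' k' l\<bar>" using T(5)[of l] R(4)[of l] by auto
  qed (use T R lt in auto)
  finally show ?thesis by simp
qed

lemma sep_k:
  assumes t: "spread L m i j k" and s: "spread L m i' j' k'" and lt: "k < k'"
  shows "(min_jump L M)\<^sup>2 * (L / M) * (real k' - real k) \<le> (\<Sum>l=1..m. (contrast i j k l - contrast i' j' k' l)\<^sup>2)"
proof -
  note T = contrast_regions[OF t] and R = contrast_regions[OF s]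
  have "L / M * (real k' - real k) \<le> real k' - real (max k j')"
    using scaled_le[of "real k' - real k"] T(8) R(1-3) M lt s by (auto simp: max_def spread_def)
  then have "(min_jump L M)\<^sup>2 * (L / M * (real k' - real k)) \<le> (min_jump L M)\<^sup>2 * (real k' - real (max k j'))"
    by (intro mult_left_mono) auto
  also have "\<dots> = (real k' - real (max k j')) * (min_jump L M)\<^sup>2" by simp
  also have "\<dots> \<le> (\<Sum>l=1..m. (contrast i j k l - contrast i' j' k' l)\<^sup>2)"
  proof (rule sum_sq_ge_interval)
    fix l assume "max k j' < l" "l \<le> k'"
    then show "min_jump L M \<le> \<bar>contrast i j k l - contrast i' j' k' l\<bar>" using T(7)[of l] R(6)[of l] by auto
  qed (use T R lt in auto)
  finally show ?thesis by simp
qed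

text \<open>Between the two middle change points the contrasts have opposite signs, provided that the left end
  points are close; if they are not, \<open>sep_i\<close> already gives the bound.\<close>

lemma sep_j:
  assumes t: "spread L m i j k" and s: "spread L m i' j' k'" and lt: "j < j'"
  shows "(min_jump L M)\<^sup>2 * (L / M)\<^sup>2 * (real j' - real j) \<le> (\<Sum>l=1..m. (contrast i j k l - contrast i' j' k' l)\<^sup>2)"
proof -
  note T = contrast_regions[OF t] and R = contrast_regions[OF s]
  have LM: "0 < L / M" "L / M \<le> 1" using T(8) L by auto
  have d: "0 \<le> real j' - real j" "real j' - real j \<le> M" using lt R(1-3) M by auto
  note sc = scaled_le[OF T(8) d]
  show ?thesis
  proof (cases "real i' \<le> real i + L")
    case True
    have le: "max j i' \<le> min j' k" using True T R lt t s by (auto simp: spread_def)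
    have "L / M * (real j' - real j) \<le> real (min j' k) - real (max j i')"
      using sc True t s lt T R by (auto simp: spread_def min_def max_def)
    then have "(min_jump L M)\<^sup>2 * (L / M * (real j' - real j)) \<le> (min_jump L M)\<^sup>2 * (real (min j' k) - real (max j i'))"
      by (intro mult_left_mono) auto
    also have "\<dots> = (real (min j' k) - real (max j i')) * (min_jump L M)\<^sup>2" by simp
    also have "\<dots> \<le> (\<Sum>l=1..m. (contrast i j k l - contrast i' j' k' l)\<^sup>2)"
    proof (rule sum_sq_ge_interval[OF le])
      fix l assume "max j i' < l" "l \<le> min j' k"
      then show "min_jump L M \<le> \<bar>contrast i j k l - contrast i' j' k' l\<bar>" using T(6)[of l] R(5)[of l] T(9) by auto
    qed (use T R in auto)
    finally have 1: "(min_jump L M)\<^sup>2 * (L / M) * (real j' - real j) \<le> (\<Sum>l=1..m. (contrast i j k l - contrast i' j' k' l)\<^sup>2)" by simp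
    have "(L / M)\<^sup>2 \<le> L / M" unfolding power2_eq_square using LM by (intro mult_left_le) auto
    then have "(min_jump L M)\<^sup>2 * (L / M)\<^sup>2 * (real j' - real j) \<le> (min_jump L M)\<^sup>2 * (L / M) * (real j' - real j)"
      using d by (intro mult_right_mono mult_left_mono) auto
    with 1 show ?thesis by linarith
  next
    case False
    then have lt': "i < i'" using L by linarith
    have "L / M * (real j' - real j) \<le> real i' - real i" using sc False by linarith
    then have "(min_jump L M)\<^sup>2 * (L / M) * (L / M * (real j' - real j)) \<le> (min_jump L M)\<^sup>2 * (L / M) * (real i' - real i)"
      using LM by (intro mult_left_mono mult_nonneg_nonneg) auto
    also have "\<dots> \<le> (\<Sum>l=1..m. (contrast i j k l - contrast i' j' k' l)\<^sup>2)" by (rule sep_i[OF t s lt'])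
    finally show ?thesis by (simp add: power2_eq_square mult_ac)
  qed
qed

text \<open>Multiplied by \<open>b\<^sup>2\<close>, with \<open>L\<close> and \<open>M\<close> of order \<open>b\<^sup>2\<close>, the factor on the left is a positive constant: the distance of two
  contrasts controls the distance of the triples.\<close>

lemma separation:
  assumes t: "spread L m i j k" and s: "spread L m i' j' k'"
  shows "(min_jump L M)\<^sup>2 * (L / M)\<^sup>2 / 3 * (\<bar>real i - real i'\<bar> + \<bar>real j - real j'\<bar> + \<bar>real k - real k'\<bar>)
    \<le> (\<Sum>l=1..m. (contrast i j k l - contrast i' j' k' l)\<^sup>2)"
proof -
  note T = contrast_regions[OF t] and R = contrast_regions[OF s]
  let ?N = "\<Sum>l=1..m. (contrast i j k l - contrast i' j' k' l)\<^sup>2"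
  have N: "?N \<ge> 0" by (intro sum_nonneg) auto
  have LM: "0 < L / M" "L / M \<le> 1" using T(8) L by auto
  have "(L / M)\<^sup>2 \<le> L / M" unfolding power2_eq_square using LM by (intro mult_left_le) auto
  then have w: "(min_jump L M)\<^sup>2 * (L / M)\<^sup>2 * d \<le> (min_jump L M)\<^sup>2 * (L / M) * d" if "d \<ge> 0" for d
    using that by (intro mult_right_mono mult_left_mono) auto
  have "(min_jump L M)\<^sup>2 * (L / M)\<^sup>2 * \<bar>real i - real i'\<bar> \<le> ?N"
    using sep_i[OF t s] sep_i[OF s t, unfolded sum_sq_diff_commute[of "contrast i' j' k'"]] w[of "real i' - real i"] w[of "real i - real i'"] N
    by (cases i i' rule: linorder_cases) auto
  moreover have "(min_jump L M)\<^sup>2 * (L / M)\<^sup>2 * \<bar>real k - real k'\<bar> \<le> ?N"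
    using sep_k[OF t s] sep_k[OF s t, unfolded sum_sq_diff_commute[of "contrast i' j' k'"]] w[of "real k' - real k"] w[of "real k - real k'"] N
    by (cases k k' rule: linorder_cases) auto
  moreover have "(min_jump L M)\<^sup>2 * (L / M)\<^sup>2 * \<bar>real j - real j'\<bar> \<le> ?N"
    using sep_j[OF t s] sep_j[OF s t, unfolded sum_sq_diff_commute[of "contrast i' j' k'"]] N
    by (cases j j' rule: linorder_cases) auto
  moreover have "q / 3 * (x + y + z) = (q * x + q * y + q * z) / 3" for q x y z :: real
    by (simp add: field_simps)
  ultimately show ?thesis by simp
qed

lemma separation_neg_aux:
  assumes t: "spread L m i j k" and s: "spread L m i' j' k'" and le: "i \<le> i'"
  shows "(min_jump L M)\<^sup>2 * L / 2 \<le> (\<Sum>l=1..m. (contrast i j k l + contrast i' j' k' l)\<^sup>2)"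
proof -
  note T = contrast_regions[OF t] and R = contrast_regions[OF s]
  show ?thesis
  proof (cases "real i' - real i \<ge> L / 2")
    case True
    have "L / 2 \<le> real (min i' j) - real i" using True t L by (auto simp: min_def spread_def)
    then have "L / 2 * (min_jump L M)\<^sup>2 \<le> (real (min i' j) - real i) * (min_jump L M)\<^sup>2" by (intro mult_right_mono) auto
    also have "\<dots> \<le> (\<Sum>l=1..m. (contrast i j k l + contrast i' j' k' l)\<^sup>2)"
    proof (rule sum_sq_ge_interval)
      fix l assume "i < l" "l \<le> min i' j"
      then show "min_jump L M \<le> \<bar>contrast i j k l + contrast i' j' k' l\<bar>" using T(5)[of l] R(4)[of l] by auto
    qed (use T R le in auto)
    finally show ?thesis by (simp add: mult.commute)
  next
    case False
    have *: "L / 2 \<le> real (min j j') - real i'" using False t s L by (auto simp: min_def spread_def)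
    then have "L / 2 * (min_jump L M)\<^sup>2 \<le> (real (min j j') - real i') * (min_jump L M)\<^sup>2" by (intro mult_right_mono) auto
    also have "\<dots> \<le> (\<Sum>l=1..m. (contrast i j k l + contrast i' j' k' l)\<^sup>2)"
    proof (rule sum_sq_ge_interval)
      fix l assume "i' < l" "l \<le> min j j'"
      then show "min_jump L M \<le> \<bar>contrast i j k l + contrast i' j' k' l\<bar>" using T(5)[of l] R(5)[of l] T(9) le by auto
    qed (use T R le * L in auto)
    finally show ?thesis by (simp add: mult.commute)
  qed
qed

text \<open>Two contrasts cannot nearly cancel: just after the earlier of the two starting points one of them is positive
  while the other still vanishes, or, if the starting points are close, both are positive on a long common stretch.
  This excludes simultaneous exceedances of opposite signs.\<close>

lemma separation_neg:
  assumes t: "spread L m i j k" and s: "spread L m i' j' k'"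
  shows "(min_jump L M)\<^sup>2 * L / 2 \<le> (\<Sum>l=1..m. (contrast i j k l + contrast i' j' k' l)\<^sup>2)"
  using separation_neg_aux[OF t s] separation_neg_aux[OF s t] by (cases "i \<le> i'") (auto simp: add.commute)

end

section \<open>Local linearisation of the contrasts\<close>

text \<open>The change of \<open>b\<close> times the contrast when the change points move and the three jump sizes are
  kept fixed.\<close>

definition local_part :: "real \<Rightarrow> nat \<Rightarrow> nat \<Rightarrow> nat \<Rightarrow> nat \<times> nat \<times> nat \<Rightarrow> nat \<Rightarrow> real" where
  "local_part b i j k = (\<lambda>(i', j', k') l. let u = real j - real i; v = real k - real j in
     b * (ampL u v * (beyond i' l - beyond i l) - ampM u v * (beyond j' l - beyond j l) + ampR u v * (beyond k' l - beyond k l)))"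

text \<open>Moving the change points by at most \<open>D\<close> changes the squared heights by \<open>O(D / L\<^sup>2)\<close>, because
  they are sums of reciprocals of segment lengths.\<close>

lemma amplitude_diff:
  assumes L: "0 < L" and "u \<ge> L" "v \<ge> L" "u' \<ge> L" "v' \<ge> L" and "\<bar>u - u'\<bar> \<le> 2 * D" "\<bar>v - v'\<bar> \<le> 2 * D" "\<bar>u + v - (u' + v')\<bar> \<le> 2 * D"
    and "u + v \<le> M"
  shows "\<bar>ampL u' v' - ampL u v\<bar> \<le> 4 * D * M / (L\<^sup>2 * sqrt L)" "\<bar>ampR u' v' - ampR u v\<bar> \<le> 4 * D * M / (L\<^sup>2 * sqrt L)"
proof -
  have D: "D \<ge> 0" using assms(6) by linarith
  have inv: "\<bar>1 / x' - 1 / x\<bar> \<le> 2 * D / L\<^sup>2" if "x \<ge> L" "x' \<ge> L" "\<bar>x - x'\<bar> \<le> 2 * D" for x x' :: real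
  proof -
    have "\<bar>1 / x' - 1 / x\<bar> = \<bar>x - x'\<bar> / (x * x')"
      using that L by (simp add: field_simps abs_divide abs_mult)
    also have "\<dots> \<le> 2 * D / (L * L)" using that L D by (intro frac_le mult_mono mult_pos_pos) auto
    finally show ?thesis by (simp add: power2_eq_square)
  qed
  have *: "\<bar>a' - a\<bar> \<le> 4 * D * M / (L\<^sup>2 * sqrt L)"
    if a: "a \<ge> sqrt L / M" "a' > 0" "\<bar>a'\<^sup>2 - a\<^sup>2\<bar> \<le> 4 * D / L\<^sup>2" for a a'
  proof -
    have M: "M > 0" using assms by linarith
    have ap: "sqrt L / M > 0" using L M by simp
    have "\<bar>a' - a\<bar> * (sqrt L / M) \<le> \<bar>a' - a\<bar> * (a' + a)" using a ap by (intro mult_left_mono) auto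
    also have "\<dots> = \<bar>a'\<^sup>2 - a\<^sup>2\<bar>" using a ap by (simp add: power2_eq_square square_diff_square_factored abs_mult)
    also have "\<dots> \<le> 4 * D / L\<^sup>2" by fact
    finally have "\<bar>a' - a\<bar> \<le> 4 * D / L\<^sup>2 / (sqrt L / M)" by (subst pos_le_divide_eq[OF ap])
    moreover have "4 * D / L\<^sup>2 / (sqrt L / M) = 4 * D * M / (L\<^sup>2 * sqrt L)" by simp
    ultimately show ?thesis by (simp only:)
  qed
  have pos: "u > 0" "v > 0" "u' > 0" "v' > 0" using assms by linarith+
  note amp = amplitude_lower[OF L assms(2,3,9)]
  have s: "\<bar>1 / (u' + v') - 1 / (u + v)\<bar> \<le> 2 * D / L\<^sup>2" using assms by (intro inv) linarith+
  have "\<bar>(ampL u' v')\<^sup>2 - (ampL u v)\<^sup>2\<bar> \<le> 4 * D / L\<^sup>2"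
    unfolding ampL_sq[OF pos(1,2)] ampL_sq[OF pos(3,4)] using inv[of u u'] s assms by linarith
  then show "\<bar>ampL u' v' - ampL u v\<bar> \<le> 4 * D * M / (L\<^sup>2 * sqrt L)"
    by (intro * amp ampL_pos pos)
  have "\<bar>(ampR u' v')\<^sup>2 - (ampR u v)\<^sup>2\<bar> \<le> 4 * D / L\<^sup>2"
    unfolding ampR_sq[OF pos(1,2)] ampR_sq[OF pos(3,4)] using inv[of v v'] s assms by linarith
  then show "\<bar>ampR u' v' - ampR u v\<bar> \<le> 4 * D * M / (L\<^sup>2 * sqrt L)"
    by (intro * amp ampR_pos pos)
qed

lemma sum_sq_beyond_diff:
  assumes "p \<le> m" "q \<le> m"
  shows "(\<Sum>l=1..m. (beyond q l - beyond p l)\<^sup>2) = \<bar>real q - real p\<bar>"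
proof -
  have *: "(\<Sum>l=1..m. (beyond q l - beyond p l)\<^sup>2) = \<bar>real q - real p\<bar>" if "p \<le> q" "q \<le> m" for p q
  proof -
    have "(\<Sum>l=1..m. (beyond q l - beyond p l)\<^sup>2) = (\<Sum>l=1..m. if p < l \<and> l \<le> q then 1 else 0)"
      using that by (intro sum.cong) (auto simp: beyond_def)
    then show ?thesis using that by (simp add: sum_indicator_interval of_nat_diff del: One_nat_def)
  qed
  show ?thesis
    using *[of p q] *[of q p] assms by (cases "p \<le> q") (auto simp: power2_commute[of "beyond q _"] abs_minus_commute)
qed

lemma local_part_norm:
  assumes "i < j" "j < k" "i' \<le> m" "j' \<le> m" "k' \<le> m" "k \<le> m"
    and "max i i' \<le> min j j'" "max j j' \<le> min k k'"
  shows "(\<Sum>l=1..m. (local_part b i j k (i', j', k') l)\<^sup>2)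
    = b\<^sup>2 * ((ampL (real j - real i) (real k - real j))\<^sup>2 * \<bar>real i' - real i\<bar>
      + (ampM (real j - real i) (real k - real j))\<^sup>2 * \<bar>real j' - real j\<bar>
      + (ampR (real j - real i) (real k - real j))\<^sup>2 * \<bar>real k' - real k\<bar>)"
proof -
  let ?a = "ampL (real j - real i) (real k - real j)" and ?g = "ampM (real j - real i) (real k - real j)" and ?c = "ampR (real j - real i) (real k - real j)"
  have disj: "(beyond i' l - beyond i l) * (beyond j' l - beyond j l) = 0" "(beyond i' l - beyond i l) * (beyond k' l - beyond k l) = 0"
     "(beyond j' l - beyond j l) * (beyond k' l - beyond k l) = 0" for l
    using assms by (auto simp: beyond_def)
  have sq: "(a * x - g * y + c * z)\<^sup>2 = a\<^sup>2 * x\<^sup>2 + g\<^sup>2 * y\<^sup>2 + c\<^sup>2 * z\<^sup>2"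
    if "x * y = 0" "x * z = 0" "y * z = 0" for a g c x y z :: real
    using that by (auto simp: power_mult_distrib)
  have "(\<Sum>l=1..m. (local_part b i j k (i', j', k') l)\<^sup>2)
     = (\<Sum>l=1..m. b\<^sup>2 * (?a\<^sup>2 * (beyond i' l - beyond i l)\<^sup>2 + ?g\<^sup>2 * (beyond j' l - beyond j l)\<^sup>2 + ?c\<^sup>2 * (beyond k' l - beyond k l)\<^sup>2))"
    by (intro sum.cong refl) (simp add: local_part_def Let_def power_mult_distrib sq[OF disj])
  also have "\<dots> = b\<^sup>2 * (?a\<^sup>2 * (\<Sum>l=1..m. (beyond i' l - beyond i l)\<^sup>2) + ?g\<^sup>2 * (\<Sum>l=1..m. (beyond j' l - beyond j l)\<^sup>2) + ?c\<^sup>2 * (\<Sum>l=1..m. (beyond k' l - beyond k l)\<^sup>2))"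
    by (simp add: sum_distrib_left sum.distrib distrib_left)
  also have "(\<Sum>l=1..m. (beyond i' l - beyond i l)\<^sup>2) = \<bar>real i' - real i\<bar>" using assms by (intro sum_sq_beyond_diff) auto
  also have "(\<Sum>l=1..m. (beyond j' l - beyond j l)\<^sup>2) = \<bar>real j' - real j\<bar>" using assms by (intro sum_sq_beyond_diff) auto
  also have "(\<Sum>l=1..m. (beyond k' l - beyond k l)\<^sup>2) = \<bar>real k' - real k\<bar>" using assms by (intro sum_sq_beyond_diff) auto
  finally show ?thesis .
qed

text \<open>Only the heights contribute to the error of the linearisation, so it is a step function on the
  new segments.\<close>

lemma contrast_minus_local_part:
  assumes t: "i < j" "j < k" and s: "i' < j'" "j' < k'" "k' \<le> m"
  shows "(\<Sum>l=1..m. (b * (contrast i' j' k' l - contrast i j k l) - local_part b i j k (i', j', k') l)\<^sup>2)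
   = b\<^sup>2 * ((real j' - real i') * (ampL (real j' - real i') (real k' - real j') - ampL (real j - real i) (real k - real j))\<^sup>2
      + (real k' - real j') * (ampR (real j' - real i') (real k' - real j') - ampR (real j - real i) (real k - real j))\<^sup>2)"
proof -
  let ?u = "real j - real i" and ?v = "real k - real j" and ?u' = "real j' - real i'" and ?v' = "real k' - real j'"
  define da dc where "da = ampL ?u' ?v' - ampL ?u ?v" and "dc = ampR ?u' ?v' - ampR ?u ?v"
  have g: "ampM ?u ?v = ampL ?u ?v + ampR ?u ?v" "ampM ?u' ?v' = ampL ?u' ?v' + ampR ?u' ?v'"
    using t s by (auto intro!: ampM_eq)
  have "b * (contrast i' j' k' l - contrast i j k l) - local_part b i j k (i', j', k') l
     = b * (if l \<le> i' then 0 else if l \<le> j' then da else if l \<le> k' then - dc else 0)" for l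
    using s unfolding contrast_def local_part_def Let_def g by (auto simp: beyond_def algebra_simps da_def dc_def)
  then have "(\<Sum>l=1..m. (b * (contrast i' j' k' l - contrast i j k l) - local_part b i j k (i', j', k') l)\<^sup>2)
    = (\<Sum>l=1..m. (if l \<le> i' then 0 else if l \<le> j' then b\<^sup>2 * da\<^sup>2 else if l \<le> k' then b\<^sup>2 * dc\<^sup>2 else 0))"
    by (intro sum.cong refl) (auto simp: power_mult_distrib)
  also have "\<dots> = ?u' * (b\<^sup>2 * da\<^sup>2) + ?v' * (b\<^sup>2 * dc\<^sup>2)"
    using s by (intro sum_step) auto
  finally show ?thesis by (simp add: algebra_simps flip: da_def dc_def)
qed

definition contrast_of :: "nat \<times> nat \<times> nat \<Rightarrow> nat \<Rightarrow> real" where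
  "contrast_of = (\<lambda>(i, j, k). contrast i j k)"

definition cube :: "nat \<Rightarrow> nat \<Rightarrow> nat \<Rightarrow> nat \<Rightarrow> (nat \<times> nat \<times> nat) set" where
  "cube D i j k = {i-D..i+D} \<times> {j-D..j+D} \<times> {k-D..k+D} - {(i, j, k)}"

lemma finite_cube [simp]: "finite (cube D i j k)"
  by (simp add: cube_def)

lemma card_cube_le: "card (cube D i j k) \<le> (2 * D + 1) ^ 3"
proof -
  have "card (cube D i j k) \<le> card ({i-D..i+D} \<times> {j-D..j+D} \<times> {k-D..k+D})"
    unfolding cube_def by (intro card_mono) auto
  also have "\<dots> = card {i-D..i+D} * (card {j-D..j+D} * card {k-D..k+D})"
    by (simp add: card_cartesian_product)
  also have "\<dots> \<le> (2 * D + 1) * ((2 * D + 1) * (2 * D + 1))"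
    by (intro mult_le_mono) auto
  finally show ?thesis unfolding power3_eq_cube by (simp only: mult.assoc)
qed

text \<open>The weighted inequality \<open>2 |x e| \<le> z x\<^sup>2 + e\<^sup>2 / z\<close>, summed.\<close>

lemma sum_sq_perturb:
  fixes x e :: "nat \<Rightarrow> real"
  assumes "z > 0"
  shows "\<bar>(\<Sum>l\<in>A. (x l + e l)\<^sup>2) - (\<Sum>l\<in>A. (x l)\<^sup>2)\<bar> \<le> z * (\<Sum>l\<in>A. (x l)\<^sup>2) + (1 / z + 1) * (\<Sum>l\<in>A. (e l)\<^sup>2)"
proof -
  have *: "\<bar>(x l + e l)\<^sup>2 - (x l)\<^sup>2\<bar> \<le> z * (x l)\<^sup>2 + (1 / z + 1) * (e l)\<^sup>2" for l
  proof -
    have "0 \<le> (z * \<bar>x l\<bar> - \<bar>e l\<bar>)\<^sup>2 / z" using assms by simp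
    also have "\<dots> = z * (x l)\<^sup>2 + (e l)\<^sup>2 / z - 2 * (\<bar>x l\<bar> * \<bar>e l\<bar>)"
      using assms by (simp add: power2_eq_square field_simps)
    finally have "2 * \<bar>x l * e l\<bar> \<le> z * (x l)\<^sup>2 + (e l)\<^sup>2 / z" by (simp add: abs_mult)
    moreover have "(x l + e l)\<^sup>2 - (x l)\<^sup>2 = 2 * (x l * e l) + (e l)\<^sup>2"
      by (simp add: power2_eq_square algebra_simps)
    moreover have "(1 / z + 1) * (e l)\<^sup>2 = (e l)\<^sup>2 / z + (e l)\<^sup>2" by (simp add: algebra_simps)
    moreover have "(e l)\<^sup>2 \<ge> 0" by simp
    ultimately show ?thesis by linarith
  qed
  have "\<bar>(\<Sum>l\<in>A. (x l + e l)\<^sup>2) - (\<Sum>l\<in>A. (x l)\<^sup>2)\<bar> \<le> (\<Sum>l\<in>A. \<bar>(x l + e l)\<^sup>2 - (x l)\<^sup>2\<bar>)"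
    unfolding sum_subtractf[symmetric] by (rule sum_abs)
  also have "\<dots> \<le> (\<Sum>l\<in>A. z * (x l)\<^sup>2 + (1 / z + 1) * (e l)\<^sup>2)" by (intro sum_mono *)
  finally show ?thesis by (simp add: sum.distrib sum_distrib_left)
qed

text \<open>All error terms are \<open>O(1 / b)\<close> or \<open>O(1 / b\<^sup>2)\<close> with constants that depend only on \<open>\<epsilon>\<close>, \<open>C\<close> and \<open>D\<close>,
  and the drift \<open>b\<^sup>2 (1 - \<rho>)\<close> is half the squared norm of the local part, up to \<open>O(1 / b)\<close>.\<close>

lemma local_bounds:
  assumes b: "b \<ge> 1" and eps: "\<epsilon> > 0" and C: "C > 0" and D4: "4 * real D \<le> \<epsilon> * b\<^sup>2" and m: "real m \<le> C * b\<^sup>2"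
    and t: "spread (\<epsilon> * b\<^sup>2) m i j k" and Di: "D \<le> i" "k + D \<le> m" and s: "(i', j', k') \<in> cube D i j k"
    and K: "K1 = 512 * (real D)\<^sup>2 * C ^ 3 / \<epsilon> ^ 5" "K2 = 8 * real D / \<epsilon>"
  defines "\<rho> \<equiv> (\<Sum>l=1..m. contrast i' j' k' l * contrast i j k l)"
    and "c \<equiv> (\<Sum>l=1..m. (local_part b i j k (i', j', k') l)\<^sup>2) / 2"
  shows "\<rho> \<le> 1" "\<bar>b\<^sup>2 * (1 - \<rho>) - c\<bar> \<le> (K1 + K2) / b" "b * (1 - \<rho>) \<le> (K1 + K2) / b"
    "(\<Sum>l=1..m. (b * (contrast i' j' k' l - contrast i j k l) - local_part b i j k (i', j', k') l + b * (1 - \<rho>) * contrast i j k l)\<^sup>2)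
       \<le> (2 * K1 + 2 * (K1 + K2)\<^sup>2) / b\<^sup>2"
    "c = b\<^sup>2 * ((ampL (real j - real i) (real k - real j))\<^sup>2 * \<bar>real i' - real i\<bar>
      + (ampM (real j - real i) (real k - real j))\<^sup>2 * \<bar>real j' - real j\<bar>
      + (ampR (real j - real i) (real k - real j))\<^sup>2 * \<bar>real k' - real k\<bar>) / 2"
    "i' < j'" "j' < k'" "k' \<le> m"
proof -
  let ?u = "real j - real i" and ?v = "real k - real j" and ?u' = "real j' - real i'" and ?v' = "real k' - real j'"
  let ?d = "\<lambda>l. b * (contrast i' j' k' l - contrast i j k l)" and ?e = "\<lambda>l. b * (contrast i' j' k' l - contrast i j k l) - local_part b i j k (i', j', k') l"
  (* Half of the segment length leaves room for moving the change points by D. *)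
  define L where "L = \<epsilon> * b\<^sup>2 / 2"
  define M where "M = C * b\<^sup>2"
  have b2: "b\<^sup>2 > 0" using b by simp
  have L: "L > 0" using eps b2 by (simp add: L_def)
  have D2: "2 * real D \<le> L" using D4 by (simp add: L_def)
  have near: "\<bar>real i' - real i\<bar> \<le> D" "\<bar>real j' - real j\<bar> \<le> D" "\<bar>real k' - real k\<bar> \<le> D" "k' \<le> k + D"
    and nl: "real i' \<le> real i + D" "real i \<le> real i' + D" "real j' \<le> real j + D" "real j \<le> real j' + D"
      "real k' \<le> real k + D" "real k \<le> real k' + D"
  proof -
    have n: "i' \<le> i + D" "i \<le> i' + D" "j' \<le> j + D" "j \<le> j' + D" "k' \<le> k + D" "k \<le> k' + D"
      using s by (auto simp: cube_def)
    then show nl: "real i' \<le> real i + D" "real i \<le> real i' + D" "real j' \<le> real j + D" "real j \<le> real j' + D"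
      "real k' \<le> real k + D" "real k \<le> real k' + D" unfolding of_nat_add[symmetric] of_nat_le_iff .
    show "k' \<le> k + D" by (rule n)
    show "\<bar>real i' - real i\<bar> \<le> D" "\<bar>real j' - real j\<bar> \<le> D" "\<bar>real k' - real k\<bar> \<le> D"
      using nl by (simp_all add: abs_le_iff)
  qed
  have uv: "?u \<ge> 2 * L" "?v \<ge> 2 * L" "k \<le> m" using t by (auto simp: spread_def L_def)
  show km': "k' \<le> m" using near(4) Di by simp
  have uv': "?u' \<ge> L" "?v' \<ge> L" using nl uv D2 by linarith+
  show ij': "i' < j'" "j' < k'" using uv' L by linarith+
  have ij: "i < j" "j < k" using uv L by linarith+
  have sumM: "?u + ?v \<le> M" "?u' + ?v' \<le> M" using m uv(3) km' unfolding M_def by linarith+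
  have pos: "?u > 0" "?v > 0" using ij by auto
  have e_norm: "(\<Sum>l=1..m. (?e l)\<^sup>2) \<le> K1 / b\<^sup>2"
  proof -
    define q where "q = 4 * real D * M / (L\<^sup>2 * sqrt L)"
    have ad: "\<bar>ampL ?u' ?v' - ampL ?u ?v\<bar> \<le> q" "\<bar>ampR ?u' ?v' - ampR ?u ?v\<bar> \<le> q"
    proof -
      have d: "\<bar>?u - ?u'\<bar> \<le> 2 * real D" "\<bar>?v - ?v'\<bar> \<le> 2 * real D" "\<bar>?u + ?v - (?u' + ?v')\<bar> \<le> 2 * real D"
        using nl by (auto simp: abs_le_iff)
      have uL: "?u \<ge> L" "?v \<ge> L" using uv L by linarith+
      show "\<bar>ampL ?u' ?v' - ampL ?u ?v\<bar> \<le> q" "\<bar>ampR ?u' ?v' - ampR ?u ?v\<bar> \<le> q"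
        unfolding q_def using amplitude_diff[OF L uL uv' d sumM(1)] by blast+
    qed
    have sq: "(ampL ?u' ?v' - ampL ?u ?v)\<^sup>2 \<le> q\<^sup>2" "(ampR ?u' ?v' - ampR ?u ?v)\<^sup>2 \<le> q\<^sup>2"
      using power_mono[OF ad(1) abs_ge_zero, of 2] power_mono[OF ad(2) abs_ge_zero, of 2] by simp_all
    have "(\<Sum>l=1..m. (?e l)\<^sup>2) = b\<^sup>2 * (?u' * (ampL ?u' ?v' - ampL ?u ?v)\<^sup>2 + ?v' * (ampR ?u' ?v' - ampR ?u ?v)\<^sup>2)"
      by (rule contrast_minus_local_part[OF ij ij' km'])
    also have "\<dots> \<le> b\<^sup>2 * (?u' * q\<^sup>2 + ?v' * q\<^sup>2)"
      using sq ij' by (intro mult_left_mono add_mono) auto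
    also have "\<dots> = b\<^sup>2 * ((?u' + ?v') * q\<^sup>2)" by (simp add: algebra_simps)
    also have "\<dots> \<le> b\<^sup>2 * (M * q\<^sup>2)" using sumM by (intro mult_left_mono mult_right_mono) auto
    also have "q\<^sup>2 = 16 * (real D)\<^sup>2 * M\<^sup>2 / L ^ 5"
    proof -
      have "(L\<^sup>2)\<^sup>2 * L = L ^ 5" by (simp add: eval_nat_numeral)
      then have "(L\<^sup>2 * sqrt L)\<^sup>2 = L ^ 5" using L by (simp add: power_mult_distrib)
      then show ?thesis by (simp add: q_def power_divide power_mult_distrib)
    qed
    also have "b\<^sup>2 * (M * (16 * (real D)\<^sup>2 * M\<^sup>2 / L ^ 5)) = K1 / b\<^sup>2"
    proof -
      have M3: "M ^ 3 = C ^ 3 * b ^ 6" and L5: "L ^ 5 = \<epsilon> ^ 5 * b ^ 10 / 32"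
        unfolding M_def L_def by (simp_all add: power_mult_distrib power_divide flip: power_mult)
      have "b\<^sup>2 * (M * (16 * (real D)\<^sup>2 * M\<^sup>2 / L ^ 5)) = b\<^sup>2 * (16 * (real D)\<^sup>2) * M ^ 3 / L ^ 5"
        by (simp add: power2_eq_square power3_eq_cube mult_ac)
      also have "\<dots> = 512 * (real D)\<^sup>2 * C ^ 3 * (b\<^sup>2 * b ^ 6) / (\<epsilon> ^ 5 * b ^ 10)"
        unfolding M3 L5 by (simp add: mult_ac)
      also have "\<dots> = 512 * (real D)\<^sup>2 * C ^ 3 / (\<epsilon> ^ 5 * b\<^sup>2)"
      proof -
        have nz: "b\<^sup>2 * b ^ 6 \<noteq> 0" using b by simp
        have "b ^ 10 = b\<^sup>2 * (b\<^sup>2 * b ^ 6)" by (simp flip: power_add)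
        then have eq: "\<epsilon> ^ 5 * b ^ 10 = \<epsilon> ^ 5 * b\<^sup>2 * (b\<^sup>2 * b ^ 6)" by (simp only: mult.assoc)
        show ?thesis unfolding eq by (rule nonzero_mult_divide_mult_cancel_right[OF nz])
      qed
      finally show ?thesis by (simp add: K)
    qed
    finally show ?thesis .
  qed
  have "real D < ?u" "real D < ?v" using uv D2 L by linarith+
  have disj: "max i i' \<le> min j j'" "max j j' \<le> min k k'"
  proof -
    have "real i \<le> real j" "real i \<le> real j'" "real i' \<le> real j" "real i' \<le> real j'"
      "real j \<le> real k" "real j \<le> real k'" "real j' \<le> real k" "real j' \<le> real k'"
      using uv D2 L nl ij ij' by linarith+
    then show "max i i' \<le> min j j'" "max j j' \<le> min k k'" by simp_all
  qed
  have c_eq: "2 * c = b\<^sup>2 * ((ampL ?u ?v)\<^sup>2 * \<bar>real i' - real i\<bar> + (ampM ?u ?v)\<^sup>2 * \<bar>real j' - real j\<bar> + (ampR ?u ?v)\<^sup>2 * \<bar>real k' - real k\<bar>)"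
    unfolding c_def using local_part_norm[OF ij _ _ km' uv(3) disj, of b] ij' km' by simp
  then show "c = b\<^sup>2 * ((ampL ?u ?v)\<^sup>2 * \<bar>real i' - real i\<bar> + (ampM ?u ?v)\<^sup>2 * \<bar>real j' - real j\<bar> + (ampR ?u ?v)\<^sup>2 * \<bar>real k' - real k\<bar>) / 2"
    by simp
  have c_le: "2 * c \<le> K2"
  proof -
    have iu: "1 / ?u \<le> 1 / L" "1 / ?v \<le> 1 / L" using uv L pos by (intro divide_left_mono mult_pos_pos; linarith)+
    have nn: "1 / (?u + ?v) \<ge> 0" using pos by simp
    have "(ampL ?u ?v)\<^sup>2 \<le> 1 / L" "(ampR ?u ?v)\<^sup>2 \<le> 1 / L" "(ampM ?u ?v)\<^sup>2 \<le> 2 / L"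
      unfolding ampL_sq[OF pos] ampR_sq[OF pos] ampM_sq[OF pos] using iu nn by (linarith, linarith, simp)
    then have "2 * c \<le> b\<^sup>2 * (1 / L * D + 2 / L * D + 1 / L * D)"
      unfolding c_eq using near L by (intro mult_left_mono add_mono mult_mono) auto
    also have "\<dots> = K2" using b2 eps by (simp add: K L_def field_simps)
    finally show ?thesis .
  qed
  have nA: "(\<Sum>l=1..m. (?d l)\<^sup>2) = 2 * (b\<^sup>2 * (1 - \<rho>))"
  proof -
    have "(\<Sum>l=1..m. (?d l)\<^sup>2) = b\<^sup>2 * ((\<Sum>l=1..m. (contrast i' j' k' l)\<^sup>2) + (\<Sum>l=1..m. (contrast i j k l)\<^sup>2) - 2 * \<rho>)"
    proof -
      have "(?d l)\<^sup>2 = b\<^sup>2 * (contrast i' j' k' l)\<^sup>2 + b\<^sup>2 * (contrast i j k l)\<^sup>2 - b\<^sup>2 * 2 * (contrast i' j' k' l * contrast i j k l)" for l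
        by (simp add: power2_eq_square algebra_simps)
      then have "(\<Sum>l=1..m. (?d l)\<^sup>2) = b\<^sup>2 * (\<Sum>l=1..m. (contrast i' j' k' l)\<^sup>2) + b\<^sup>2 * (\<Sum>l=1..m. (contrast i j k l)\<^sup>2) - b\<^sup>2 * 2 * \<rho>"
        unfolding \<rho>_def by (simp only: sum_subtractf sum.distrib sum_distrib_left[symmetric])
      then show ?thesis by (simp add: algebra_simps)
    qed
    then show ?thesis using contrast_unit[OF ij uv(3)] contrast_unit[OF ij' km'] by simp
  qed
  have "(\<Sum>l=1..m. (?d l)\<^sup>2) \<ge> 0" by (intro sum_nonneg) auto
  then have "b\<^sup>2 * (1 - \<rho>) \<ge> 0" using nA by linarith
  then show rho: "\<rho> \<le> 1" using b2 by (simp add: zero_le_mult_iff)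
  have K_nn: "K1 \<ge> 0" "K2 \<ge> 0" using eps C by (auto simp: K)
  have pert: "\<bar>2 * (b\<^sup>2 * (1 - \<rho>)) - 2 * c\<bar> \<le> 2 * ((K1 + K2) / b)"
  proof -
    have "(\<lambda>l. local_part b i j k (i', j', k') l + ?e l) = ?d" by auto
    then have "\<bar>2 * (b\<^sup>2 * (1 - \<rho>)) - 2 * c\<bar> \<le> 1 / b * (2 * c) + (1 / (1 / b) + 1) * (\<Sum>l=1..m. (?e l)\<^sup>2)"
      using sum_sq_perturb[of "1 / b" "\<lambda>l. local_part b i j k (i', j', k') l" ?e "{1..m}"] b nA by (simp add: c_def)
    also have "\<dots> \<le> 1 / b * K2 + (2 * b) * (K1 / b\<^sup>2)"
    proof -
      have "c \<ge> 0" unfolding c_def by (intro divide_nonneg_pos sum_nonneg) auto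
      then show ?thesis using b c_le e_norm K_nn by (intro add_mono mult_mono) (auto intro!: sum_nonneg)
    qed
    also have "\<dots> = (2 * K1 + K2) / b" using b by (simp add: power2_eq_square field_simps)
    also have "\<dots> \<le> 2 * ((K1 + K2) / b)" using b K_nn by (simp add: divide_right_mono)
    finally show ?thesis .
  qed
  show main: "\<bar>b\<^sup>2 * (1 - \<rho>) - c\<bar> \<le> (K1 + K2) / b" using pert by linarith
  have b2rho: "b\<^sup>2 * (1 - \<rho>) \<le> K1 + K2"
  proof -
    have local_part_e: "(\<lambda>l. local_part b i j k (i', j', k') l + ?e l) = ?d" by auto
    have "\<bar>2 * (b\<^sup>2 * (1 - \<rho>)) - 2 * c\<bar> \<le> 2 * c + 2 * (\<Sum>l=1..m. (?e l)\<^sup>2)"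
      using sum_sq_perturb[of "1" "\<lambda>l. local_part b i j k (i', j', k') l" ?e "{1..m}"] nA by (simp add: c_def)
    moreover have "K1 / b\<^sup>2 \<le> K1 / 1" using b K_nn by (intro divide_left_mono) auto
    then have "K1 / b\<^sup>2 \<le> K1" by simp
    ultimately show ?thesis using c_le e_norm by linarith
  qed
  have "b * (1 - \<rho>) = b\<^sup>2 * (1 - \<rho>) / b" using b by (simp add: power2_eq_square)
  then show br: "b * (1 - \<rho>) \<le> (K1 + K2) / b" using b2rho b by (simp add: divide_right_mono)
  have "(\<Sum>l=1..m. (?e l + b * (1 - \<rho>) * contrast i j k l)\<^sup>2) \<le> (\<Sum>l=1..m. 2 * (?e l)\<^sup>2 + 2 * ((b * (1 - \<rho>))\<^sup>2 * (contrast i j k l)\<^sup>2))"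
  proof (rule sum_mono)
    fix l
    have "(x + y)\<^sup>2 \<le> 2 * x\<^sup>2 + 2 * y\<^sup>2" for x y :: real
      using zero_le_power2[of "x - y"] by (simp add: power2_eq_square algebra_simps)
    then show "(?e l + b * (1 - \<rho>) * contrast i j k l)\<^sup>2 \<le> 2 * (?e l)\<^sup>2 + 2 * ((b * (1 - \<rho>))\<^sup>2 * (contrast i j k l)\<^sup>2)"
      unfolding power_mult_distrib[symmetric] .
  qed
  also have "\<dots> = 2 * (\<Sum>l=1..m. (?e l)\<^sup>2) + 2 * (b * (1 - \<rho>))\<^sup>2"
    using contrast_unit[OF ij uv(3)] by (simp add: sum.distrib sum_distrib_left[symmetric])
  also have "\<dots> \<le> 2 * (K1 / b\<^sup>2) + 2 * ((K1 + K2) / b)\<^sup>2"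
    using e_norm br b rho by (intro add_mono mult_left_mono power_mono) auto
  also have "\<dots> = (2 * K1 + 2 * (K1 + K2)\<^sup>2) / b\<^sup>2" unfolding power_divide by (simp only: add_divide_distrib times_divide_eq_right)
  finally show "(\<Sum>l=1..m. (?e l + b * (1 - \<rho>) * contrast i j k l)\<^sup>2) \<le> (2 * K1 + 2 * (K1 + K2)\<^sup>2) / b\<^sup>2" .
qed

section \<open>The six walks around a triple\<close>

text \<open>The \<open>r\<close>-th coordinate met when walking away from the change point \<open>p\<close>, to the right if \<open>d\<close>.\<close>

definition window :: "nat \<Rightarrow> bool \<Rightarrow> nat \<Rightarrow> nat" where
  "window p d r = (if d then p + 1 + r else p - r)"

definition window_sign :: "real \<Rightarrow> bool \<Rightarrow> real" where
  "window_sign J d = (if d then - sgn J else sgn J)"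

lemma lin_zero [simp]: "lin I (\<lambda>l. 0) \<omega> = 0"
  by (simp add: lin_def)

lemma lin_beyond_right: "p + n \<le> m \<Longrightarrow> lin {1..m} (\<lambda>l. beyond (p + n) l - beyond p l) \<omega> = - (\<Sum>r<n. \<omega> (p + 1 + r))"
  by (induction n) (simp_all add: lin_diff_fun lin_beyond del: One_nat_def, simp)

lemma lin_beyond_left: "n \<le> p \<Longrightarrow> p \<le> m \<Longrightarrow> lin {1..m} (\<lambda>l. beyond (p - n) l - beyond p l) \<omega> = (\<Sum>r<n. \<omega> (p - r))"
proof (induction n)
  case (Suc n)
  then have "lin {1..m} (beyond (p - Suc n)) \<omega> = lin {1..m} (beyond (p - n)) \<omega> + \<omega> (p - n)"
  proof -
    obtain q where q: "p - n = Suc q" using Suc.prems by (cases "p - n") auto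
    then have "p - Suc n = q" "Suc q \<le> m" using Suc.prems by auto
    then show ?thesis by (simp add: q lin_beyond del: One_nat_def)
  qed
  with Suc show ?case by (simp add: lin_diff_fun)
qed (simp add: lin_diff_fun)

text \<open>The contribution of one change point, moved from \<open>p\<close> to \<open>p'\<close>, to the local field minus its drift.\<close>

definition drift_term :: "nat \<Rightarrow> real \<Rightarrow> nat \<Rightarrow> nat \<Rightarrow> (nat \<Rightarrow> real) \<Rightarrow> real" where
  "drift_term m J p p' \<omega> = J * lin {1..m} (\<lambda>l. beyond p' l - beyond p l) \<omega> - J\<^sup>2 * \<bar>real p' - real p\<bar> / 2"

lemma drift_term_window:
  assumes "D \<le> p" "p + D \<le> m"
  shows "(\<forall>d. \<forall>n\<in>{1..D}. \<bar>J\<bar> * (\<Sum>r<n. window_sign J d * \<omega> (window p d r)) - \<bar>J\<bar>\<^sup>2 * real n / 2 \<le> \<eta>)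
    \<longleftrightarrow> (\<forall>p'\<in>{p-D..p+D}. p' \<noteq> p \<longrightarrow> drift_term m J p p' \<omega> \<le> \<eta>)"
proof -
  have js: "\<bar>J\<bar> * (\<Sum>r<n. window_sign J d * f r) = (if d then - J else J) * (\<Sum>r<n. f r)" for d n and f :: "nat \<Rightarrow> real"
    by (simp add: window_sign_def sum_distrib_left[symmetric] abs_mult_sgn mult.assoc[symmetric])
  have right: "drift_term m J p (p + n) \<omega> = \<bar>J\<bar> * (\<Sum>r<n. window_sign J True * \<omega> (window p True r)) - \<bar>J\<bar>\<^sup>2 * real n / 2" if "n \<in> {1..D}" for n
    using that assms unfolding js drift_term_def by (subst lin_beyond_right) (auto simp: window_def)
  have left: "drift_term m J p (p - n) \<omega> = \<bar>J\<bar> * (\<Sum>r<n. window_sign J False * \<omega> (window p False r)) - \<bar>J\<bar>\<^sup>2 * real n / 2" if "n \<in> {1..D}" for n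
    using that assms unfolding js drift_term_def by (subst lin_beyond_left) (auto simp: window_def)
  show ?thesis
  proof
    assume W: "\<forall>d. \<forall>n\<in>{1..D}. \<bar>J\<bar> * (\<Sum>r<n. window_sign J d * \<omega> (window p d r)) - \<bar>J\<bar>\<^sup>2 * real n / 2 \<le> \<eta>"
    show "\<forall>p'\<in>{p-D..p+D}. p' \<noteq> p \<longrightarrow> drift_term m J p p' \<omega> \<le> \<eta>"
    proof (intro ballI impI)
      fix p' assume p': "p' \<in> {p-D..p+D}" "p' \<noteq> p"
      show "drift_term m J p p' \<omega> \<le> \<eta>"
      proof (cases "p < p'")
        case True
        then have "p' = p + (p' - p)" "p' - p \<in> {1..D}" using p' by auto
        then show ?thesis using right[of "p' - p"] W by metis
      next
        case False
        then have "p' = p - (p - p')" "p - p' \<in> {1..D}" using p' by auto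
        then show ?thesis using left[of "p - p'"] W by metis
      qed
    qed
  next
    assume W: "\<forall>p'\<in>{p-D..p+D}. p' \<noteq> p \<longrightarrow> drift_term m J p p' \<omega> \<le> \<eta>"
    have "\<bar>J\<bar> * (\<Sum>r<n. window_sign J d * \<omega> (window p d r)) - \<bar>J\<bar>\<^sup>2 * real n / 2 \<le> \<eta>" if n: "n \<in> {1..D}" for d n
    proof (cases d)
      case True
      have "drift_term m J p (p + n) \<omega> \<le> \<eta>" using W n by auto
      then show ?thesis using right[OF n] True by simp
    next
      case False
      have "p - n \<in> {p-D..p+D}" "p - n \<noteq> p" using n assms by auto
      then have "drift_term m J p (p - n) \<omega> \<le> \<eta>" using W by blast
      then show ?thesis using left[OF n] False by simp
    qed
    then show "\<forall>d. \<forall>n\<in>{1..D}. \<bar>J\<bar> * (\<Sum>r<n. window_sign J d * \<omega> (window p d r)) - \<bar>J\<bar>\<^sup>2 * real n / 2 \<le> \<eta>" by blast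
  qed
qed

definition axis_ok :: "nat \<Rightarrow> nat \<Rightarrow> real \<Rightarrow> real \<Rightarrow> nat \<Rightarrow> (nat \<Rightarrow> real) \<Rightarrow> bool" where
  "axis_ok m D \<eta> J p \<omega> \<longleftrightarrow> (\<forall>p'\<in>{p-D..p+D}. p' \<noteq> p \<longrightarrow> drift_term m J p p' \<omega> \<le> \<eta>)"

text \<open>The six windows are disjoint, so the six walks are independent.\<close>

lemma prob_axes_ok:
  assumes "D \<le> i" "i + 2 * D \<le> j" "j + 2 * D \<le> k" "k + D \<le> m" and J: "J1 \<noteq> 0" "J2 \<noteq> 0" "J3 \<noteq> 0"
  shows "\<P>(\<omega> in gauss. axis_ok m D \<eta> J1 i \<omega> \<and> axis_ok m D \<eta> J2 j \<omega> \<and> axis_ok m D \<eta> J3 k \<omega>)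
    = (stay D \<bar>J1\<bar> \<eta>)\<^sup>2 * (stay D \<bar>J2\<bar> \<eta>)\<^sup>2 * (stay D \<bar>J3\<bar> \<eta>)\<^sup>2"
proof -
  define Q where "Q = {0, 1, 2::nat} \<times> (UNIV :: bool set)"
  define J where "J p = (if p = 0 then J1 else if p = 1 then J2 else J3)" for p :: nat
  define c where "c p = (if p = 0 then i else if p = 1 then j else k)" for p :: nat
  define ev where "ev p d \<omega> \<longleftrightarrow> (\<forall>n\<in>{1..D}. \<bar>J p\<bar> * (\<Sum>r<n. window_sign (J p) d * \<omega> (window (c p) d r)) - \<bar>J p\<bar>\<^sup>2 * real n / 2 \<le> \<eta>)" for p d \<omega>
  have ev: "(\<forall>d. ev p d \<omega>) \<longleftrightarrow> axis_ok m D \<eta> (J p) (c p) \<omega>" for p \<omega>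
    unfolding axis_ok_def ev_def using assms by (intro drift_term_window) (auto simp: c_def)
  have "(\<forall>q\<in>Q. ev (fst q) (snd q) \<omega>) \<longleftrightarrow> (\<forall>p\<in>{0, 1, 2}. \<forall>d. ev p d \<omega>)" for \<omega>
    unfolding Q_def by auto
  then have "(\<forall>q\<in>Q. ev (fst q) (snd q) \<omega>) \<longleftrightarrow> axis_ok m D \<eta> J1 i \<omega> \<and> axis_ok m D \<eta> J2 j \<omega> \<and> axis_ok m D \<eta> J3 k \<omega>" for \<omega>
    unfolding ev by (simp add: J_def c_def)
  then have "\<P>(\<omega> in gauss. axis_ok m D \<eta> J1 i \<omega> \<and> axis_ok m D \<eta> J2 j \<omega> \<and> axis_ok m D \<eta> J3 k \<omega>)
     = \<P>(\<omega> in gauss. \<forall>q\<in>Q. ev (fst q) (snd q) \<omega>)"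
    by simp
  also have "\<dots> = (\<Prod>q\<in>Q. stay D \<bar>J (fst q)\<bar> \<eta>)"
    unfolding ev_def
  proof (rule stay_windows[where w="\<lambda>q. window (c (fst q)) (snd q)" and x="\<lambda>q. \<bar>J (fst q)\<bar>" and sg="\<lambda>q. window_sign (J (fst q)) (snd q)"])
    show "finite Q" "Q \<noteq> {}" by (auto simp: Q_def)
    show "window_sign (J (fst q)) (snd q) \<in> {1, -1}" if "q \<in> Q" for q
      using J by (auto simp: window_sign_def J_def sgn_if)
    have sep: "c p + 2 * D \<le> c p'" if "p < p'" "p' \<le> 2" for p p'
      using that assms by (auto simp: c_def)
    have cD: "D \<le> c p" for p using assms by (auto simp: c_def)
    have eq: "p = p'" if eq: "window (c p) d r = window (c p') d' r'" and r: "r < D" "r' < D" and p: "p \<le> 2" "p' \<le> 2" for p d r p' d' r'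
    proof (rule ccontr)
      assume "p \<noteq> p'"
      then have "c p + 2 * D \<le> c p' \<or> c p' + 2 * D \<le> c p" using sep p by (metis nat_neq_iff)
      then show False using eq r cD[of p] cD[of p'] by (auto simp: window_def split: if_splits)
    qed
    show "inj_on (\<lambda>(q, r). window (c (fst q)) (snd q) r) (Q \<times> {..<D})"
    proof (rule inj_onI)
      fix x y
      assume xy: "x \<in> Q \<times> {..<D}" "y \<in> Q \<times> {..<D}"
        and e: "(\<lambda>(q, r). window (c (fst q)) (snd q) r) x = (\<lambda>(q, r). window (c (fst q)) (snd q) r) y"
      obtain p d r p' d' r' where x: "x = ((p, d), r)" and y: "y = ((p', d'), r')"
        by (metis surj_pair)
      have q: "r < D" "r' < D" "p \<le> 2" "p' \<le> 2" using xy by (auto simp: Q_def x y)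
      have e': "window (c p) d r = window (c p') d' r'" using e by (simp add: x y)
      have pp: "p = p'" by (rule eq[OF e' q])
      show "x = y"
        using e' q cD[of p] unfolding pp x y by (auto simp: window_def split: if_splits)
    qed
  qed
  also have "\<dots> = (\<Prod>p\<in>{0, 1, 2}. \<Prod>d\<in>(UNIV :: bool set). stay D \<bar>J p\<bar> \<eta>)"
    unfolding Q_def by (subst prod.cartesian_product) (simp add: case_prod_beta)
  also have "\<dots> = (stay D \<bar>J1\<bar> \<eta>)\<^sup>2 * (stay D \<bar>J2\<bar> \<eta>)\<^sup>2 * (stay D \<bar>J3\<bar> \<eta>)\<^sup>2"
    by (simp add: J_def mult.assoc)
  finally show ?thesis .
qed

lemma sq_prod3_diff:
  fixes a b c a' b' c' :: real
  assumes "0 \<le> a" "a \<le> 1" "0 \<le> b" "b \<le> 1" "0 \<le> c" "c \<le> 1" "0 \<le> a'" "a' \<le> 1" "0 \<le> b'" "b' \<le> 1" "0 \<le> c'" "c' \<le> 1"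
    and "\<bar>a - a'\<bar> \<le> d" "\<bar>b - b'\<bar> \<le> d" "\<bar>c - c'\<bar> \<le> d"
  shows "\<bar>a\<^sup>2 * b\<^sup>2 * c\<^sup>2 - a'\<^sup>2 * b'\<^sup>2 * c'\<^sup>2\<bar> \<le> 6 * d"
proof -
  have m: "\<bar>x * y - x' * y'\<bar> \<le> d1 + d2" if "0 \<le> x" "x \<le> 1" "0 \<le> y'" "y' \<le> 1" "\<bar>x - x'\<bar> \<le> d1" "\<bar>y - y'\<bar> \<le> d2" for x y x' y' d1 d2 :: real
  proof -
    have "x * y - x' * y' = x * (y - y') + (x - x') * y'" by (simp add: algebra_simps)
    then have "\<bar>x * y - x' * y'\<bar> \<le> x * \<bar>y - y'\<bar> + \<bar>x - x'\<bar> * y'"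
      using that abs_triangle_ineq[of "x * (y - y')" "(x - x') * y'"] by (simp add: abs_mult)
    also have "\<dots> \<le> 1 * d2 + d1 * 1" using that by (intro add_mono mult_mono) auto
    finally show ?thesis by simp
  qed
  have sq: "\<bar>x\<^sup>2 - y\<^sup>2\<bar> \<le> d + d" if "0 \<le> x" "x \<le> 1" "0 \<le> y" "y \<le> 1" "\<bar>x - y\<bar> \<le> d" for x y
    unfolding power2_eq_square using that by (intro m) auto
  have "\<bar>a\<^sup>2 * b\<^sup>2 * c\<^sup>2 - a'\<^sup>2 * b'\<^sup>2 * c'\<^sup>2\<bar> \<le> ((d + d) + (d + d)) + (d + d)"
    using assms by (intro m sq) (auto intro: mult_le_one power_le_one)
  then show ?thesis by simp
qed

definition window_limit :: "nat \<Rightarrow> real \<Rightarrow> real \<Rightarrow> real \<Rightarrow> real \<Rightarrow> real" where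
  "window_limit D b u v \<eta> = (stay D (b * ampL u v) \<eta>)\<^sup>2 * (stay D (b * ampM u v) \<eta>)\<^sup>2 * (stay D (b * ampR u v) \<eta>)\<^sup>2"

definition peak_prob :: "nat \<Rightarrow> real \<Rightarrow> nat \<Rightarrow> nat \<Rightarrow> nat \<Rightarrow> nat \<Rightarrow> real" where
  "peak_prob m b D i j k = \<P>(\<omega> in gauss. lin {1..m} (contrast i j k) \<omega> \<ge> b \<and>
      (\<forall>s\<in>cube D i j k. lin {1..m} (contrast_of s) \<omega> < lin {1..m} (contrast i j k) \<omega>))"

definition weak_peak_prob :: "nat \<Rightarrow> real \<Rightarrow> nat \<Rightarrow> nat \<Rightarrow> nat \<Rightarrow> nat \<Rightarrow> real" where
  "weak_peak_prob m b D i j k = \<P>(\<omega> in gauss. lin {1..m} (contrast i j k) \<omega> \<ge> b \<and>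
      (\<forall>s\<in>cube D i j k. lin {1..m} (contrast_of s) \<omega> \<le> lin {1..m} (contrast i j k) \<omega>))"

lemma lin_local_part:
  "lin {1..m} (local_part b i j k (i', j', k')) \<omega> - b\<^sup>2 * ((ampL u v)\<^sup>2 * \<bar>real i' - real i\<bar> + (ampM u v)\<^sup>2 * \<bar>real j' - real j\<bar> + (ampR u v)\<^sup>2 * \<bar>real k' - real k\<bar>) / 2
   = drift_term m (b * ampL u v) i i' \<omega> + drift_term m (- (b * ampM u v)) j j' \<omega> + drift_term m (b * ampR u v) k k' \<omega>"
  if "u = real j - real i" "v = real k - real j"
proof -
  have "local_part b i j k (i', j', k') = (\<lambda>l. b * ((ampL u v * (beyond i' l - beyond i l) - ampM u v * (beyond j' l - beyond j l)) + ampR u v * (beyond k' l - beyond k l)))"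
    by (simp add: local_part_def Let_def that fun_eq_iff)
  then show ?thesis
    by (simp only: lin_scale lin_add_fun lin_diff_fun drift_term_def power_mult_distrib power2_minus)
       (simp add: algebra_simps)
qed

lemma drift_term_self [simp]: "drift_term m J p p \<omega> = 0"
  by (simp add: drift_term_def lin_def)

text \<open>A sum of three terms that depend on separate coordinates and vanish at the peak is negative away from the peak as soon as
  it is negative along the axes.  Conversely the axes are part of the cube.  Thus only the
  walks along the axes matter.\<close>

lemma peak_bounds:
  assumes b: "b \<ge> 1" and eps: "\<epsilon> > 0" and C: "C > 0" and D4: "4 * real D \<le> \<epsilon> * b\<^sup>2" and m: "real m \<le> C * b\<^sup>2"
    and t: "spread (\<epsilon> * b\<^sup>2) m i j k" and Di: "D \<le> i" "k + D \<le> m"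
    and K: "K1 = 512 * (real D)\<^sup>2 * C ^ 3 / \<epsilon> ^ 5" "K2 = 8 * real D / \<epsilon>"
    and \<eta>: "\<eta> > 0" and \<kappa>: "\<kappa> > 0" and bK: "2 * (K1 + K2) / b \<le> \<eta>" "(2 * K1 + 2 * (K1 + K2)\<^sup>2) / b\<^sup>2 \<le> (\<eta> / \<kappa>)\<^sup>2"
    and uv: "u = real j - real i" "v = real k - real j"
  shows "Phi (- b) * (window_limit D b u v (- (2 * \<eta>)) - real ((2 * D + 1) ^ 3) * (2 * Phi (- \<kappa>))) \<le> peak_prob m b D i j k"
    "weak_peak_prob m b D i j k \<le> Phi (- b) * (window_limit D b u v (2 * \<eta>) + real ((2 * D + 1) ^ 3) * (2 * Phi (- \<kappa>))) + Phi (- (b + 1))"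
proof -
  define \<rho> where "\<rho> s = (\<Sum>l=1..m. contrast_of s l * contrast i j k l)" for s
  define c where "c s = (\<Sum>l=1..m. (local_part b i j k s l)\<^sup>2) / 2" for s
  have uvpos: "u > 0" "v > 0" "i < j" "j < k" "k \<le> m"
  proof -
    have "\<epsilon> * b\<^sup>2 > 0" using eps b by simp
    then have "real j - real i > 0" "real k - real j > 0" using t unfolding spread_def by linarith+
    then show "u > 0" "v > 0" "i < j" "j < k" by (simp_all add: uv)
    show "k \<le> m" using t by (simp add: spread_def)
  qed
  have *: "\<rho> s \<le> 1" "\<bar>b\<^sup>2 * (1 - \<rho> s) - c s\<bar> \<le> (K1 + K2) / b" "b * (1 - \<rho> s) \<le> (K1 + K2) / b"
    "(\<Sum>l=1..m. (b * (contrast_of s l - contrast i j k l) - local_part b i j k s l + b * (1 - \<rho> s) * contrast i j k l)\<^sup>2)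
       \<le> (2 * K1 + 2 * (K1 + K2)\<^sup>2) / b\<^sup>2"
    "case s of (i', j', k') \<Rightarrow> c s = b\<^sup>2 * ((ampL u v)\<^sup>2 * \<bar>real i' - real i\<bar>
      + (ampM u v)\<^sup>2 * \<bar>real j' - real j\<bar> + (ampR u v)\<^sup>2 * \<bar>real k' - real k\<bar>) / 2"
    if "s \<in> cube D i j k" for s
  proof -
    obtain i' j' k' where s: "s = (i', j', k')" by (cases s)
    note lb = local_bounds[OF b eps C D4 m t Di that[unfolded s] K]
    show "\<rho> s \<le> 1" "\<bar>b\<^sup>2 * (1 - \<rho> s) - c s\<bar> \<le> (K1 + K2) / b" "b * (1 - \<rho> s) \<le> (K1 + K2) / b"
      "(\<Sum>l=1..m. (b * (contrast_of s l - contrast i j k l) - local_part b i j k s l + b * (1 - \<rho> s) * contrast i j k l)\<^sup>2)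
       \<le> (2 * K1 + 2 * (K1 + K2)\<^sup>2) / b\<^sup>2"
      "case s of (i', j', k') \<Rightarrow> c s = b\<^sup>2 * ((ampL u v)\<^sup>2 * \<bar>real i' - real i\<bar>
      + (ampM u v)\<^sup>2 * \<bar>real j' - real j\<bar> + (ampR u v)\<^sup>2 * \<bar>real k' - real k\<bar>) / 2"
      using lb unfolding s \<rho>_def c_def contrast_of_def uv by simp_all
  qed
  have KK: "(K1 + K2) / b \<le> \<eta> / 2"
  proof -
    have "2 * (K1 + K2) / b = 2 * ((K1 + K2) / b)" by simp
    then show ?thesis using bK by linarith
  qed
  interpret local_max "{1..m}" "contrast i j k" "cube D i j k" contrast_of "local_part b i j k" \<rho> c b \<eta> \<kappa>
  proof
    show "(\<Sum>l=1..m. (contrast i j k l)\<^sup>2) = 1" by (rule contrast_unit) (use uvpos in auto)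
    show "\<rho> s \<le> 1" if "s \<in> cube D i j k" for s using *[OF that] by simp
    show "(\<Sum>l = 1..m. (b * (contrast_of s l - contrast i j k l) - local_part b i j k s l + b * (1 - \<rho> s) * contrast i j k l)\<^sup>2) \<le> (\<eta> / \<kappa>)\<^sup>2" if "s \<in> cube D i j k" for s
      using *(4)[OF that] bK(2) by linarith
  qed (use b \<eta> \<kappa> in \<open>auto simp: \<rho>_def\<close>)
  have J: "b * ampL u v > 0" "b * ampM u v > 0" "b * ampR u v > 0"
    using b uvpos ampL_pos[of u v] ampR_pos[of u v] ampM_pos[of u v] by auto
  have sep: "i + 2 * D \<le> j" "j + 2 * D \<le> k"
  proof -
    have "real (i + 2 * D) \<le> real j" "real (j + 2 * D) \<le> real k" using D4 t by (auto simp: spread_def)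
    then show "i + 2 * D \<le> j" "j + 2 * D \<le> k" unfolding of_nat_le_iff by auto
  qed
  define W where "W e \<omega> \<longleftrightarrow> axis_ok m D e (b * ampL u v) i \<omega> \<and> axis_ok m D e (- (b * ampM u v)) j \<omega> \<and> axis_ok m D e (b * ampR u v) k \<omega>" for e \<omega>
  have PW: "\<P>(\<omega> in gauss. W e \<omega>) = window_limit D b u v e" for e
    unfolding W_def window_limit_def using J by (subst prob_axes_ok) (use Di sep in auto)
  have Wm: "Measurable.pred gauss (W e)" for e
    unfolding W_def axis_ok_def drift_term_def by measurable
  have lc: "lin {1..m} (local_part b i j k s) \<omega> - c s = (case s of (i', j', k') \<Rightarrow> drift_term m (b * ampL u v) i i' \<omega> + drift_term m (- (b * ampM u v)) j j' \<omega> + drift_term m (b * ampR u v) k k' \<omega>)"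
    if "s \<in> cube D i j k" for s \<omega>
  proof -
    obtain i' j' k' where s: "s = (i', j', k')" by (cases s)
    show ?thesis
      using *(5)[OF that] lin_local_part[OF uv, where m=m and b=b and i'=i' and j'=j' and k'=k' and \<omega>=\<omega>] unfolding s prod.case by simp
  qed
  have cardS: "real (card (cube D i j k)) * (2 * Phi (- \<kappa>)) \<le> real ((2 * D + 1) ^ 3) * (2 * Phi (- \<kappa>))"
    using card_cube_le[of D i j k] by (intro mult_right_mono) (auto simp del: of_nat_power)
  have locm: "Measurable.pred gauss (\<lambda>\<omega>. \<forall>s\<in>cube D i j k. lin {1..m} (local_part b i j k s) \<omega> \<le> c s + e)" for e
    by (intro gauss_pred_ball finite_cube) measurable
  have "window_limit D b u v (- (2 * \<eta>)) \<le> \<P>(\<omega> in gauss. \<forall>s\<in>cube D i j k. lin {1..m} (local_part b i j k s) \<omega> \<le> c s - 2 * \<eta>)"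
    unfolding PW[symmetric]
  proof (rule gs.P.finite_measure_mono)
    show "{\<omega> \<in> space gauss. W (- (2 * \<eta>)) \<omega>} \<subseteq> {\<omega> \<in> space gauss. \<forall>s\<in>cube D i j k. lin {1..m} (local_part b i j k s) \<omega> \<le> c s - 2 * \<eta>}"
    proof safe
      fix \<omega> i' j' k' assume W: "W (- (2 * \<eta>)) \<omega>" and s: "(i', j', k') \<in> cube D i j k"
      let ?x = "drift_term m (b * ampL u v) i i' \<omega>" and ?y = "drift_term m (- (b * ampM u v)) j j' \<omega>" and ?z = "drift_term m (b * ampR u v) k k' \<omega>"
      have "?x \<le> - (2 * \<eta>) \<or> i' = i" "?y \<le> - (2 * \<eta>) \<or> j' = j" "?z \<le> - (2 * \<eta>) \<or> k' = k"
        using W s by (auto simp: W_def axis_ok_def cube_def)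
      moreover have "\<not> (i' = i \<and> j' = j \<and> k' = k)" using s by (auto simp: cube_def)
      ultimately have "?x + ?y + ?z \<le> - (2 * \<eta>)" using \<eta> by auto
      then show "lin {1..m} (local_part b i j k (i', j', k')) \<omega> \<le> c (i', j', k') - 2 * \<eta>"
        using lc[OF s, of \<omega>] by simp
    qed
    show "{\<omega> \<in> space gauss. \<forall>s\<in>cube D i j k. lin {1..m} (local_part b i j k s) \<omega> \<le> c s - 2 * \<eta>} \<in> gs.P.events"
      using locm[of "- 2 * \<eta>"] by (simp add: pred_def)
  qed
  moreover have "Phi (- b) * (\<P>(\<omega> in gauss. \<forall>s\<in>cube D i j k. lin {1..m} (local_part b i j k s) \<omega> \<le> c s - 2 * \<eta>) - real (card (cube D i j k)) * (2 * Phi (- \<kappa>)))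
    \<le> peak_prob m b D i j k"
    unfolding peak_prob_def
  proof (rule prob_peak_ge)
    fix s assume "s \<in> cube D i j k"
    then show "c s - \<eta> \<le> b\<^sup>2 * (1 - \<rho> s)" using *(2)[of s] KK \<eta> by linarith
  qed
  moreover have "Phi (- b) * (window_limit D b u v (- (2 * \<eta>)) - real ((2 * D + 1) ^ 3) * (2 * Phi (- \<kappa>)))
     \<le> Phi (- b) * (\<P>(\<omega> in gauss. \<forall>s\<in>cube D i j k. lin {1..m} (local_part b i j k s) \<omega> \<le> c s - 2 * \<eta>) - real (card (cube D i j k)) * (2 * Phi (- \<kappa>)))"
    if "window_limit D b u v (- (2 * \<eta>)) \<le> \<P>(\<omega> in gauss. \<forall>s\<in>cube D i j k. lin {1..m} (local_part b i j k s) \<omega> \<le> c s - 2 * \<eta>)"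
    using that cardS by (intro mult_left_mono diff_mono) auto
  ultimately show "Phi (- b) * (window_limit D b u v (- (2 * \<eta>)) - real ((2 * D + 1) ^ 3) * (2 * Phi (- \<kappa>))) \<le> peak_prob m b D i j k"
    by linarith
  have U: "\<P>(\<omega> in gauss. \<forall>s\<in>cube D i j k. lin {1..m} (local_part b i j k s) \<omega> \<le> c s + 2 * \<eta>) \<le> window_limit D b u v (2 * \<eta>)"
    unfolding PW[symmetric]
  proof (rule gs.P.finite_measure_mono)
    show "{\<omega> \<in> space gauss. \<forall>s\<in>cube D i j k. lin {1..m} (local_part b i j k s) \<omega> \<le> c s + 2 * \<eta>} \<subseteq> {\<omega> \<in> space gauss. W (2 * \<eta>) \<omega>}"
    proof safe
      fix \<omega> assume A: "\<forall>s\<in>cube D i j k. lin {1..m} (local_part b i j k s) \<omega> \<le> c s + 2 * \<eta>"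
      have B: "(case s of (i', j', k') \<Rightarrow> drift_term m (b * ampL u v) i i' \<omega> + drift_term m (- (b * ampM u v)) j j' \<omega> + drift_term m (b * ampR u v) k k' \<omega>) \<le> 2 * \<eta>"
        if "s \<in> cube D i j k" for s
        using A that lc[OF that, of \<omega>] by force
      have "drift_term m (b * ampL u v) i i' \<omega> \<le> 2 * \<eta>" if "i' \<in> {i-D..i+D}" "i' \<noteq> i" for i'
        using B[of "(i', j, k)"] that by (auto simp: cube_def)
      moreover have "drift_term m (- (b * ampM u v)) j j' \<omega> \<le> 2 * \<eta>" if "j' \<in> {j-D..j+D}" "j' \<noteq> j" for j'
        using B[of "(i, j', k)"] that by (auto simp: cube_def)
      moreover have "drift_term m (b * ampR u v) k k' \<omega> \<le> 2 * \<eta>" if "k' \<in> {k-D..k+D}" "k' \<noteq> k" for k'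
        using B[of "(i, j, k')"] that by (auto simp: cube_def)
      ultimately show "W (2 * \<eta>) \<omega>" by (auto simp: W_def axis_ok_def)
    qed
    show "{\<omega> \<in> space gauss. W (2 * \<eta>) \<omega>} \<in> gs.P.events" using Wm by (simp add: pred_def)
  qed
  have "weak_peak_prob m b D i j k \<le> Phi (- b) * (\<P>(\<omega> in gauss. \<forall>s\<in>cube D i j k. lin {1..m} (local_part b i j k s) \<omega> \<le> c s + 2 * \<eta>) + real (card (cube D i j k)) * (2 * Phi (- \<kappa>))) + Phi (- (b + 1))"
    unfolding weak_peak_prob_def
  proof (rule prob_weak_peak_le)
    fix s assume s: "s \<in> cube D i j k"
    have "(1 - \<rho> s) * b * (b + 1) = b\<^sup>2 * (1 - \<rho> s) + b * (1 - \<rho> s)" by (simp add: power2_eq_square algebra_simps)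
    then show "(1 - \<rho> s) * b * (b + 1) \<le> c s + \<eta>" using *(2,3)[OF s] KK by linarith
  qed
  also have "\<dots> \<le> Phi (- b) * (window_limit D b u v (2 * \<eta>) + real ((2 * D + 1) ^ 3) * (2 * Phi (- \<kappa>))) + Phi (- (b + 1))"
    using U cardS by (intro add_mono mult_left_mono) auto
  finally show "weak_peak_prob m b D i j k \<le> Phi (- b) * (window_limit D b u v (2 * \<eta>) + real ((2 * D + 1) ^ 3) * (2 * Phi (- \<kappa>))) + Phi (- (b + 1))" .
qed

section \<open>Uniform asymptotics of local maxima\<close>

definition peak_limit :: "real \<Rightarrow> real \<Rightarrow> real \<Rightarrow> real" where
  "peak_limit b u v = (never_up (b * ampL u v))\<^sup>2 * (never_up (b * ampM u v))\<^sup>2 * (never_up (b * ampR u v))\<^sup>2"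

lemma div_le_eventually:
  fixes X y b :: real
  assumes "X \<ge> 0" "y > 0" "b \<ge> 1" "b \<ge> X / y"
  shows "X / b \<le> y" "X / b\<^sup>2 \<le> y"
proof -
  show 1: "X / b \<le> y" using assms by (simp add: field_simps)
  have "b \<le> b\<^sup>2" using assms by (simp add: power2_eq_square)
  then have "X / b\<^sup>2 \<le> X / b" using assms by (intro divide_left_mono mult_pos_pos) auto
  with 1 show "X / b\<^sup>2 \<le> y" by linarith
qed

lemma exp_minus_le_inverse: "y > 0 \<Longrightarrow> exp (- y) \<le> 1 / (y :: real)"
proof -
  assume y: "y > 0"
  have "y \<le> exp y" using exp_ge_add_one_self[of y] by linarith
  then show ?thesis using y by (simp add: exp_minus field_simps)
qed

lemma b_amplitude_lower:
  assumes b: "b \<ge> 1" and eps: "\<epsilon> > 0" and C: "C > 0" and m: "real m \<le> C * b\<^sup>2"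
    and t: "spread (\<epsilon> * b\<^sup>2) m i j k" and uv: "u = real j - real i" "v = real k - real j"
  shows "b * ampL u v \<ge> sqrt \<epsilon> / C" "b * ampR u v \<ge> sqrt \<epsilon> / C" "b * ampM u v \<ge> sqrt \<epsilon> / C"
proof -
  have "\<epsilon> * b\<^sup>2 > 0" using b eps by simp
  moreover have "u + v \<le> C * b\<^sup>2" using t m by (simp add: spread_def uv)
  ultimately have a: "ampL u v \<ge> sqrt (\<epsilon> * b\<^sup>2) / (C * b\<^sup>2)" "ampR u v \<ge> sqrt (\<epsilon> * b\<^sup>2) / (C * b\<^sup>2)" "ampM u v \<ge> sqrt (\<epsilon> * b\<^sup>2) / (C * b\<^sup>2)"
    using t by (intro amplitude_lower; simp add: spread_def uv)+
  have e: "b * (sqrt (\<epsilon> * b\<^sup>2) / (C * b\<^sup>2)) = sqrt \<epsilon> / C"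
    using b by (simp add: real_sqrt_mult power2_eq_square)
  show "b * ampL u v \<ge> sqrt \<epsilon> / C" "b * ampR u v \<ge> sqrt \<epsilon> / C" "b * ampM u v \<ge> sqrt \<epsilon> / C"
    unfolding e[symmetric] using a b by (intro mult_left_mono; simp)+
qed

lemma peak_asymptotics:
  assumes eps: "\<epsilon> > 0" and C: "C > 0" and \<delta>: "\<delta> > 0"
  shows "\<exists>D0. \<forall>D\<ge>D0. \<exists>B\<ge>1. \<forall>b\<ge>B. \<forall>m i j k. real m \<le> C * b\<^sup>2 \<longrightarrow> spread (\<epsilon> * b\<^sup>2) m i j k \<longrightarrow> D \<le> i \<longrightarrow> k + D \<le> m \<longrightarrow>
     Phi (- b) * (peak_limit b (real j - real i) (real k - real j) - \<delta>) \<le> peak_prob m b D i j k \<and>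
     weak_peak_prob m b D i j k \<le> Phi (- b) * (peak_limit b (real j - real i) (real k - real j) + \<delta>)"
proof -
  define x0 where "x0 = sqrt \<epsilon> / C"
  have x0: "x0 > 0" using eps C by (simp add: x0_def)
  obtain D0 where D0: "\<And>D x. D \<ge> D0 \<Longrightarrow> x \<ge> x0 \<Longrightarrow> \<bar>stay D x 0 - never_up x\<bar> \<le> \<delta> / 24"
    using stay_unif_never_up[OF x0, of "\<delta> / 24"] \<delta> by auto
  have "\<exists>B\<ge>1. \<forall>b\<ge>B. \<forall>m i j k. real m \<le> C * b\<^sup>2 \<longrightarrow> spread (\<epsilon> * b\<^sup>2) m i j k \<longrightarrow> D \<le> i \<longrightarrow> k + D \<le> m \<longrightarrow>
     Phi (- b) * (peak_limit b (real j - real i) (real k - real j) - \<delta>) \<le> peak_prob m b D i j k \<and>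
     weak_peak_prob m b D i j k \<le> Phi (- b) * (peak_limit b (real j - real i) (real k - real j) + \<delta>)"
    if D: "D \<ge> D0" for D
  proof -
    define N where "N = real ((2 * D + 1) ^ 3)"
    define \<eta> where "\<eta> = \<delta> * x0 / (48 * (real D + 1))"
    define \<kappa> where "\<kappa> = sqrt (16 * N / \<delta>)"
    define K1 where "K1 = 512 * (real D)\<^sup>2 * C ^ 3 / \<epsilon> ^ 5"
    define K2 where "K2 = 8 * real D / \<epsilon>"
    have N: "N > 0" by (simp add: N_def)
    have \<eta>: "\<eta> > 0" using \<delta> x0 by (simp add: \<eta>_def)
    have \<kappa>: "\<kappa> > 0" "\<kappa>\<^sup>2 = 16 * N / \<delta>" using N \<delta> by (simp_all add: \<kappa>_def)
    have K: "K1 \<ge> 0" "K2 \<ge> 0" using eps C by (simp_all add: K1_def K2_def)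
    have tail: "N * (2 * Phi (- \<kappa>)) \<le> \<delta> / 4"
    proof -
      have "Phi (- \<kappa>) \<le> exp (- \<kappa>\<^sup>2 / 2)" using \<kappa> by (intro Phi_minus_le_exp) simp
      also have "\<dots> = exp (- (8 * N / \<delta>))" by (simp add: \<kappa>(2))
      also have "\<dots> \<le> 1 / (8 * N / \<delta>)" using N \<delta> by (intro exp_minus_le_inverse) simp
      finally have "2 * N * Phi (- \<kappa>) \<le> 2 * N * (1 / (8 * N / \<delta>))" using N by (intro mult_left_mono) auto
      also have "\<dots> = \<delta> / 4" using N by simp
      finally show ?thesis by (simp add: mult_ac)
    qed
    define B where "B = Max {1, 4 * real D / \<epsilon>, 2 * (K1 + K2) / \<eta>, (2 * K1 + 2 * (K1 + K2)\<^sup>2) / (\<eta> / \<kappa>)\<^sup>2, 4 / \<delta>}"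
    show ?thesis
    proof (intro exI[of _ B] conjI allI impI)
      show "B \<ge> 1" unfolding B_def by (intro Max_ge) auto
      fix b m i j k
      assume bB: "B \<le> b" and m: "real m \<le> C * b\<^sup>2" and t: "spread (\<epsilon> * b\<^sup>2) m i j k" and Di: "D \<le> i" "k + D \<le> m"
      have "x \<le> b" if "x \<in> {1, 4 * real D / \<epsilon>, 2 * (K1 + K2) / \<eta>, (2 * K1 + 2 * (K1 + K2)\<^sup>2) / (\<eta> / \<kappa>)\<^sup>2, 4 / \<delta>}" for x
      proof -
        have "x \<le> B" unfolding B_def by (rule Max_ge[OF _ that]) simp
        with bB show ?thesis by linarith
      qed
      then have b: "b \<ge> 1" "4 * real D / \<epsilon> \<le> b" "2 * (K1 + K2) / \<eta> \<le> b" "(2 * K1 + 2 * (K1 + K2)\<^sup>2) / (\<eta> / \<kappa>)\<^sup>2 \<le> b" "4 / \<delta> \<le> b"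
        by simp_all
      have D4: "4 * real D \<le> \<epsilon> * b\<^sup>2"
      proof -
        have "4 * real D \<le> \<epsilon> * b" using b(2) eps by (simp add: divide_le_eq mult.commute)
        also have "\<dots> \<le> \<epsilon> * b\<^sup>2" using b(1) eps by (simp add: power2_eq_square)
        finally show ?thesis .
      qed
      have bK: "2 * (K1 + K2) / b \<le> \<eta>" "(2 * K1 + 2 * (K1 + K2)\<^sup>2) / b\<^sup>2 \<le> (\<eta> / \<kappa>)\<^sup>2"
        using div_le_eventually(1)[OF _ \<eta> b(1,3)] div_le_eventually(2)[OF _ _ b(1,4)] K \<eta> \<kappa> by simp_all
      define u v where "u = real j - real i" and "v = real k - real j"
      note pb = peak_bounds[OF b(1) eps C D4 m t Di K1_def K2_def \<eta> \<kappa>(1) bK u_def v_def, folded N_def]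
      note amp = b_amplitude_lower[OF b(1) eps C m t u_def v_def, folded x0_def]
      have near: "\<bar>stay D x e - never_up x\<bar> \<le> \<delta> / 12" if "x \<ge> x0" "\<bar>e\<bar> = 2 * \<eta>" for x e
      proof -
        have x: "x > 0" using that x0 by simp
        have "\<bar>stay D x e - stay D x 0\<bar> \<le> real D * (2 * \<eta>) / x" using stay_slack[OF x, of D e] that by simp
        also have "\<dots> \<le> real D * (2 * \<eta>) / x0" using that x0 x \<eta> by (intro divide_left_mono) auto
        also have "\<dots> = \<delta> / 24 * (real D / (real D + 1))"
        proof -
          have *: "y * (2 * (\<delta> * x0 / (48 * z))) / x0 = \<delta> / 24 * (y / z)" if "z > 0" for y z
            using x0 that by (simp add: field_simps)
          show ?thesis unfolding \<eta>_def by (rule *) simp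
        qed
        also have "\<dots> \<le> \<delta> / 24 * 1" using \<delta> by (intro mult_left_mono) auto
        finally show ?thesis using D0[OF D that(1)] by linarith
      qed
      have st3: "\<bar>window_limit D b u v e - peak_limit b u v\<bar> \<le> \<delta> / 2" if "\<bar>e\<bar> = 2 * \<eta>" for e
      proof -
        have "\<bar>window_limit D b u v e - peak_limit b u v\<bar> \<le> 6 * (\<delta> / 12)"
          unfolding window_limit_def peak_limit_def using amp x0
          by (intro sq_prod3_diff near that stay_nonneg stay_le_1 less_imp_le[OF never_up_pos] never_up_le_1) auto
        then show ?thesis by simp
      qed
      have bp: "Phi (- (b + 1)) \<le> \<delta> / 4 * Phi (- b)"
      proof -
        have "Phi (- (b + 1)) \<le> exp (- ((b + 1)\<^sup>2 - b\<^sup>2) / 2) * Phi (- b)" using b by (intro Phi_minus_le) auto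
        also have "\<dots> \<le> exp (- b) * Phi (- b)" by (intro mult_right_mono) (auto simp: power2_eq_square algebra_simps)
        also have "\<dots> \<le> 1 / b * Phi (- b)" using b by (intro mult_right_mono exp_minus_le_inverse) auto
        also have "\<dots> \<le> \<delta> / 4 * Phi (- b)" using b \<delta> by (intro mult_right_mono) (auto simp: field_simps)
        finally show ?thesis .
      qed
      have s3: "\<bar>window_limit D b u v (- (2 * \<eta>)) - peak_limit b u v\<bar> \<le> \<delta> / 2" "\<bar>window_limit D b u v (2 * \<eta>) - peak_limit b u v\<bar> \<le> \<delta> / 2"
        using \<eta> by (intro st3; simp)+
      have "peak_limit b u v - \<delta> \<le> window_limit D b u v (- (2 * \<eta>)) - N * (2 * Phi (- \<kappa>))"
        using s3(1) tail \<delta> by linarith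
      then have "Phi (- b) * (peak_limit b u v - \<delta>) \<le> Phi (- b) * (window_limit D b u v (- (2 * \<eta>)) - N * (2 * Phi (- \<kappa>)))"
        by (intro mult_left_mono) auto
      with pb(1) show "Phi (- b) * (peak_limit b (real j - real i) (real k - real j) - \<delta>) \<le> peak_prob m b D i j k"
        unfolding u_def v_def by linarith
      have "window_limit D b u v (2 * \<eta>) + N * (2 * Phi (- \<kappa>)) \<le> peak_limit b u v + 3 * \<delta> / 4"
        using s3(2) tail by linarith
      then have "Phi (- b) * (window_limit D b u v (2 * \<eta>) + N * (2 * Phi (- \<kappa>))) \<le> Phi (- b) * (peak_limit b u v + 3 * \<delta> / 4)"
        by (intro mult_left_mono) auto
      then have "weak_peak_prob m b D i j k \<le> Phi (- b) * (peak_limit b u v + 3 * \<delta> / 4) + \<delta> / 4 * Phi (- b)"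
        using pb(2) bp by linarith
      also have "\<dots> = Phi (- b) * (peak_limit b u v + \<delta>)" by (simp add: algebra_simps)
      finally show "weak_peak_prob m b D i j k \<le> Phi (- b) * (peak_limit b (real j - real i) (real k - real j) + \<delta>)"
        unfolding u_def v_def .
    qed
  qed
  then show ?thesis by blast
qed

section \<open>Distant pairs and exceptional triples\<close>

definition typical :: "real \<Rightarrow> real \<Rightarrow> nat \<Rightarrow> nat \<Rightarrow> (nat \<times> nat \<times> nat) set" where
  "typical \<epsilon> b D m = {(i, j, k). spread (\<epsilon> * b\<^sup>2) m i j k \<and> D \<le> i \<and> k + D \<le> m}"

definition triples :: "nat \<Rightarrow> (nat \<times> nat \<times> nat) set" where
  "triples m = {(i, j, k). i < j \<and> j < k \<and> k \<le> m}"

lemma triples_subset: "triples m \<subseteq> {..m} \<times> {..m} \<times> {..m}"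
  by (auto simp: triples_def)

lemma finite_triples [simp]: "finite (triples m)"
  by (rule finite_subset[OF triples_subset]) auto

lemma typical_subset_triples: "\<epsilon> > 0 \<Longrightarrow> b > 0 \<Longrightarrow> typical \<epsilon> b D m \<subseteq> triples m"
proof
  fix t assume e: "\<epsilon> > 0" "b > 0" and t: "t \<in> typical \<epsilon> b D m"
  then have p: "\<epsilon> * b\<^sup>2 > 0" by simp
  obtain i j k where ijk: "t = (i, j, k)" by (cases t)
  have "real j - real i > 0" "real k - real j > 0" using t p unfolding ijk typical_def spread_def by auto
  then show "t \<in> triples m" using t unfolding ijk typical_def triples_def spread_def by auto
qed

lemma sum_sq_contrast_of:
  assumes "t \<in> triples m"
  shows "(\<Sum>l=1..m. (contrast_of t l)\<^sup>2) = 1"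
proof -
  obtain i j k where t: "t = (i, j, k)" by (cases t)
  have "i < j" "j < k" "k \<le> m" using assms by (auto simp: t triples_def)
  then show ?thesis unfolding t contrast_of_def prod.case by (rule contrast_unit)
qed

lemma card_triples_le: "card (triples m) \<le> (m + 1) ^ 3"
proof -
  have "card (triples m) \<le> card ({..m} \<times> {..m} \<times> {..m})"
    by (intro card_mono triples_subset) auto
  also have "\<dots> = (m + 1) ^ 3" by (simp add: card_cartesian_product power3_eq_cube)
  finally show ?thesis .
qed

lemma sum_exp_dist_le:
  assumes a: "a > 0"
  shows "(\<Sum>i'\<le>m. exp (- (a * \<bar>real i - real i'\<bar>))) \<le> 2 / (1 - exp (- a))"
proof -
  define q where "q = exp (- a)"
  have q: "0 < q" "q < 1" using a by (auto simp: q_def)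
  have geo: "(\<Sum>n\<in>A. q ^ n) \<le> 1 / (1 - q)" if "finite A" for A
    using sum_le_suminf[of "\<lambda>n. q ^ n" A] q that suminf_geometric[of q] by (simp add: summable_geometric)
  have e: "exp (- (a * real n)) = q ^ n" for n by (simp add: q_def exp_of_nat_mult[symmetric] mult.commute)
  have "(\<Sum>i'\<le>m. exp (- (a * \<bar>real i - real i'\<bar>))) \<le> (\<Sum>i'\<in>{..i} \<union> {i..i+m}. exp (- (a * \<bar>real i - real i'\<bar>)))"
    by (intro sum_mono2) auto
  also have "\<dots> \<le> (\<Sum>i'\<in>{..i}. exp (- (a * \<bar>real i - real i'\<bar>))) + (\<Sum>i'\<in>{i..i+m}. exp (- (a * \<bar>real i - real i'\<bar>)))"
    by (subst sum_Un) (auto intro!: sum_nonneg)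
  also have "(\<Sum>i'\<in>{..i}. exp (- (a * \<bar>real i - real i'\<bar>))) = (\<Sum>n\<in>{..i}. q ^ n)"
    by (rule sum.reindex_bij_witness[of _ "\<lambda>n. i - n" "\<lambda>n. i - n"]) (auto simp: e[symmetric] of_nat_diff)
  also have "(\<Sum>i'\<in>{i..i+m}. exp (- (a * \<bar>real i - real i'\<bar>))) = (\<Sum>n\<in>{..m}. q ^ n)"
    by (rule sum.reindex_bij_witness[of _ "\<lambda>n. i + n" "\<lambda>n. n - i"]) (auto simp: e[symmetric] of_nat_diff)
  finally have "(\<Sum>i'\<le>m. exp (- (a * \<bar>real i - real i'\<bar>))) \<le> 1 / (1 - q) + 1 / (1 - q)"
    using geo[OF finite_atMost, of i] geo[OF finite_atMost, of m] by linarith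
  then show ?thesis by (simp add: q_def)
qed

definition far_prob :: "real \<Rightarrow> real \<Rightarrow> nat \<Rightarrow> nat \<Rightarrow> nat \<times> nat \<times> nat \<Rightarrow> real" where
  "far_prob \<epsilon> b D m t = (\<Sum>s\<in>typical \<epsilon> b D m - cube D (fst t) (fst (snd t)) (snd (snd t)) - {t}.
       \<P>(\<omega> in gauss. lin {1..m} (contrast_of t) \<omega> \<ge> b \<and> lin {1..m} (contrast_of s) \<omega> \<ge> b))
     + (\<Sum>s\<in>typical \<epsilon> b D m. \<P>(\<omega> in gauss. lin {1..m} (contrast_of t) \<omega> \<ge> b \<and> - lin {1..m} (contrast_of s) \<omega> \<ge> b))"

text \<open>Outside the cube the distance to \<open>t\<close> is at least \<open>D\<close>; half of the exponent pays for the factor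
  \<open>exp (- \<gamma> D / 2)\<close> and the other half makes the sum over all triples converge.\<close>

lemma far_prob_le:
  assumes eps: "\<epsilon> > 0" and C: "C > 0" and b: "b \<ge> 1" and m: "real m \<le> C * b\<^sup>2"
    and t: "t \<in> typical \<epsilon> b D m" and \<gamma>: "\<gamma> = \<epsilon> ^ 3 / (24 * C ^ 4)"
  shows "far_prob \<epsilon> b D m t \<le> Phi (- b) * (exp (- (\<gamma> / 2 * real D)) * (2 / (1 - exp (- (\<gamma> / 2)))) ^ 3
     + (C * b\<^sup>2 + 1) ^ 3 * exp (- (\<epsilon>\<^sup>2 / (16 * C\<^sup>2) * b\<^sup>2)))"
proof -
  have b0: "b > 0" using b by simp
  obtain i j k where ijk: "t = (i, j, k)" by (cases t)
  have tl: "spread (\<epsilon> * b\<^sup>2) m i j k" using t by (simp add: typical_def ijk)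
  have L: "\<epsilon> * b\<^sup>2 > 0" using eps b by simp
  have min_jump: "(min_jump (\<epsilon> * b\<^sup>2) (C * b\<^sup>2))\<^sup>2 = \<epsilon> / (C\<^sup>2 * b\<^sup>2)"
  proof -
    have M2: "(C * b\<^sup>2)\<^sup>2 = C\<^sup>2 * b\<^sup>2 * b\<^sup>2" by (simp only: power2_eq_square mult_ac)
    have "(min_jump (\<epsilon> * b\<^sup>2) (C * b\<^sup>2))\<^sup>2 = \<epsilon> * b\<^sup>2 / (C\<^sup>2 * b\<^sup>2 * b\<^sup>2)"
      using L unfolding min_jump_def power_divide M2 by simp
    also have "\<dots> = \<epsilon> / (C\<^sup>2 * b\<^sup>2)" using b by (intro nonzero_mult_divide_mult_cancel_right) simp
    finally show ?thesis .
  qed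
  have \<gamma>0: "\<gamma> > 0" using eps C by (simp add: \<gamma>)
  have fin: "finite (typical \<epsilon> b D m)" using finite_subset[OF typical_subset_triples[OF eps b0]] by simp
  let ?d = "\<lambda>(i', j', k'). \<bar>real i - real i'\<bar> + \<bar>real j - real j'\<bar> + \<bar>real k - real k'\<bar>"
  have unit: "(\<Sum>l=1..m. (contrast_of s l)\<^sup>2) = 1" if "s \<in> typical \<epsilon> b D m" for s
    using that typical_subset_triples[OF eps b0, of D m] by (intro sum_sq_contrast_of) auto
  have near: "\<P>(\<omega> in gauss. lin {1..m} (contrast_of t) \<omega> \<ge> b \<and> lin {1..m} (contrast_of s) \<omega> \<ge> b) \<le> Phi (- b) * exp (- (\<gamma> * ?d s))"
    if s: "s \<in> typical \<epsilon> b D m" for s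
  proof -
    obtain i' j' k' where s': "s = (i', j', k')" by (cases s)
    have sl: "spread (\<epsilon> * b\<^sup>2) m i' j' k'" using s by (simp add: typical_def s')
    have "(min_jump (\<epsilon> * b\<^sup>2) (C * b\<^sup>2))\<^sup>2 * (\<epsilon> * b\<^sup>2 / (C * b\<^sup>2))\<^sup>2 / 3 * ?d s \<le> (\<Sum>l=1..m. (contrast i j k l - contrast i' j' k' l)\<^sup>2)"
      using separation[OF L m tl sl] by (simp add: s')
    moreover have "(min_jump (\<epsilon> * b\<^sup>2) (C * b\<^sup>2))\<^sup>2 * (\<epsilon> * b\<^sup>2 / (C * b\<^sup>2))\<^sup>2 / 3 = 8 * \<gamma> / b\<^sup>2"
      unfolding min_jump \<gamma> using b C by (simp add: power_divide power_mult_distrib) (simp add: eval_nat_numeral)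
    ultimately have "8 * \<gamma> / b\<^sup>2 * ?d s \<le> (\<Sum>l=1..m. (contrast_of t l - contrast_of s l)\<^sup>2)"
      by (simp only: contrast_of_def ijk s' prod.case)
    then have "b\<^sup>2 * (8 * \<gamma> / b\<^sup>2 * ?d s) \<le> b\<^sup>2 * (\<Sum>l=1..m. (contrast_of t l - contrast_of s l)\<^sup>2)"
      by (intro mult_left_mono) auto
    moreover have "b\<^sup>2 * (8 * \<gamma> / b\<^sup>2 * ?d s) = 8 * (\<gamma> * ?d s)" using b by simp
    ultimately have le: "\<gamma> * ?d s \<le> b\<^sup>2 * (\<Sum>l=1..m. (contrast_of t l - contrast_of s l)\<^sup>2) / 8" by linarith
    have "\<P>(\<omega> in gauss. lin {1..m} (contrast_of t) \<omega> \<ge> b \<and> lin {1..m} (contrast_of s) \<omega> \<ge> b)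
      \<le> Phi (- b) * exp (- b\<^sup>2 * (\<Sum>l=1..m. (contrast_of t l - contrast_of s l)\<^sup>2) / 8)"
      using b by (intro prob_both_ge unit s t) auto
    also have "\<dots> \<le> Phi (- b) * exp (- (\<gamma> * ?d s))"
      using le by (intro mult_left_mono) auto
    finally show ?thesis .
  qed
  have opp: "\<P>(\<omega> in gauss. lin {1..m} (contrast_of t) \<omega> \<ge> b \<and> - lin {1..m} (contrast_of s) \<omega> \<ge> b) \<le> Phi (- b) * exp (- (\<epsilon>\<^sup>2 / (16 * C\<^sup>2) * b\<^sup>2))"
    if s: "s \<in> typical \<epsilon> b D m" for s
  proof -
    obtain i' j' k' where s': "s = (i', j', k')" by (cases s)
    have sl: "spread (\<epsilon> * b\<^sup>2) m i' j' k'" using s by (simp add: typical_def s')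
    have "(min_jump (\<epsilon> * b\<^sup>2) (C * b\<^sup>2))\<^sup>2 * (\<epsilon> * b\<^sup>2) / 2 \<le> (\<Sum>l=1..m. (contrast i j k l + contrast i' j' k' l)\<^sup>2)"
      using separation_neg[OF L m tl sl] .
    moreover have "(min_jump (\<epsilon> * b\<^sup>2) (C * b\<^sup>2))\<^sup>2 * (\<epsilon> * b\<^sup>2) / 2 = 8 * (\<epsilon>\<^sup>2 / (16 * C\<^sup>2))"
      unfolding min_jump using b by (simp add: power2_eq_square)
    ultimately have "b\<^sup>2 * (8 * (\<epsilon>\<^sup>2 / (16 * C\<^sup>2))) \<le> b\<^sup>2 * (\<Sum>l=1..m. (contrast_of t l - - contrast_of s l)\<^sup>2)"
      by (intro mult_left_mono) (simp_all add: contrast_of_def ijk s')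
    then have le: "\<epsilon>\<^sup>2 / (16 * C\<^sup>2) * b\<^sup>2 \<le> b\<^sup>2 * (\<Sum>l=1..m. (contrast_of t l - - contrast_of s l)\<^sup>2) / 8" by (simp only: mult_ac)
    have neg: "lin {1..m} (\<lambda>l. - contrast_of s l) \<omega> = - lin {1..m} (contrast_of s) \<omega>" for \<omega>
      by (simp add: lin_def sum_negf)
    have "\<P>(\<omega> in gauss. lin {1..m} (contrast_of t) \<omega> \<ge> b \<and> lin {1..m} (\<lambda>l. - contrast_of s l) \<omega> \<ge> b)
      \<le> Phi (- b) * exp (- b\<^sup>2 * (\<Sum>l=1..m. (contrast_of t l - - contrast_of s l)\<^sup>2) / 8)"
      using b unit[OF s] by (intro prob_both_ge unit t) auto
    also have "\<dots> \<le> Phi (- b) * exp (- (\<epsilon>\<^sup>2 / (16 * C\<^sup>2) * b\<^sup>2))"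
      using le by (intro mult_left_mono) auto
    finally show ?thesis unfolding neg .
  qed
  have "(\<Sum>s\<in>typical \<epsilon> b D m - cube D (fst t) (fst (snd t)) (snd (snd t)) - {t}. \<P>(\<omega> in gauss. lin {1..m} (contrast_of t) \<omega> \<ge> b \<and> lin {1..m} (contrast_of s) \<omega> \<ge> b))
     \<le> (\<Sum>s\<in>typical \<epsilon> b D m - cube D i j k - {t}. Phi (- b) * (exp (- (\<gamma> / 2 * real D)) * exp (- (\<gamma> / 2 * ?d s))))"
    unfolding ijk fst_conv snd_conv unfolding ijk[symmetric]
  proof (rule sum_mono)
    fix s assume s: "s \<in> typical \<epsilon> b D m - cube D i j k - {t}"
    obtain i' j' k' where s': "s = (i', j', k')" by (cases s)
    have "\<not> (i' \<in> {i-D..i+D} \<and> j' \<in> {j-D..j+D} \<and> k' \<in> {k-D..k+D})"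
      using s by (auto simp: cube_def s' ijk)
    then have "i + D < i' \<or> i' + D < i \<or> j + D < j' \<or> j' + D < j \<or> k + D < k' \<or> k' + D < k" by auto
    then have D: "real D \<le> ?d s" unfolding s' prod.case by linarith
    have "\<gamma> / 2 * real D + \<gamma> / 2 * ?d s \<le> \<gamma> / 2 * ?d s + \<gamma> / 2 * ?d s"
      using D \<gamma>0 by (intro add_mono mult_left_mono) auto
    then have "exp (- (\<gamma> * ?d s)) \<le> exp (- (\<gamma> / 2 * real D)) * exp (- (\<gamma> / 2 * ?d s))"
      unfolding exp_add[symmetric] by simp
    then have "Phi (- b) * exp (- (\<gamma> * ?d s)) \<le> Phi (- b) * (exp (- (\<gamma> / 2 * real D)) * exp (- (\<gamma> / 2 * ?d s)))"
      by (intro mult_left_mono) auto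
    with near[of s] s show "\<P>(\<omega> in gauss. lin {1..m} (contrast_of t) \<omega> \<ge> b \<and> lin {1..m} (contrast_of s) \<omega> \<ge> b)
        \<le> Phi (- b) * (exp (- (\<gamma> / 2 * real D)) * exp (- (\<gamma> / 2 * ?d s)))" by (meson DiffD1 order_trans)
  qed
  also have "\<dots> \<le> (\<Sum>s\<in>{..m} \<times> {..m} \<times> {..m}. Phi (- b) * (exp (- (\<gamma> / 2 * real D)) * exp (- (\<gamma> / 2 * ?d s))))"
    using typical_subset_triples[OF eps b0, of D m] triples_subset[of m] by (intro sum_mono2) auto
  also have "\<dots> = Phi (- b) * (exp (- (\<gamma> / 2 * real D)) * (\<Sum>s\<in>{..m} \<times> {..m} \<times> {..m}. exp (- (\<gamma> / 2 * ?d s))))"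
    by (simp only: sum_distrib_left)
  also have "(\<Sum>s\<in>{..m} \<times> {..m} \<times> {..m}. exp (- (\<gamma> / 2 * ?d s)))
     = (\<Sum>i'\<le>m. exp (- (\<gamma> / 2 * \<bar>real i - real i'\<bar>))) * ((\<Sum>j'\<le>m. exp (- (\<gamma> / 2 * \<bar>real j - real j'\<bar>))) * (\<Sum>k'\<le>m. exp (- (\<gamma> / 2 * \<bar>real k - real k'\<bar>))))"
  proof -
    have "exp (- (\<gamma> / 2 * ?d s)) = (case s of (i', j', k') \<Rightarrow> exp (- (\<gamma> / 2 * \<bar>real i - real i'\<bar>)) * (exp (- (\<gamma> / 2 * \<bar>real j - real j'\<bar>)) * exp (- (\<gamma> / 2 * \<bar>real k - real k'\<bar>))))" for s
      by (cases s) (simp only: prod.case distrib_left minus_add_distrib exp_add mult.assoc)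
    then show ?thesis
      by (simp only: sum.cartesian_product[symmetric] sum_distrib_left[symmetric] sum_distrib_right[symmetric])
  qed
  also have "Phi (- b) * (exp (- (\<gamma> / 2 * real D)) * \<dots>) \<le> Phi (- b) * (exp (- (\<gamma> / 2 * real D)) * (2 / (1 - exp (- (\<gamma> / 2)))) ^ 3)"
    unfolding power3_eq_cube mult.assoc using \<gamma>0
    by (intro mult_left_mono mult_mono sum_exp_dist_le mult_nonneg_nonneg sum_nonneg) auto
  finally have 1: "(\<Sum>s\<in>typical \<epsilon> b D m - cube D (fst t) (fst (snd t)) (snd (snd t)) - {t}. \<P>(\<omega> in gauss. lin {1..m} (contrast_of t) \<omega> \<ge> b \<and> lin {1..m} (contrast_of s) \<omega> \<ge> b))
     \<le> Phi (- b) * (exp (- (\<gamma> / 2 * real D)) * (2 / (1 - exp (- (\<gamma> / 2)))) ^ 3)" .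
  have cardG: "real (card (typical \<epsilon> b D m)) \<le> (C * b\<^sup>2 + 1) ^ 3"
  proof -
    have "card (typical \<epsilon> b D m) \<le> card (triples m)" by (intro card_mono typical_subset_triples eps b0) auto
    then have "real (card (typical \<epsilon> b D m)) \<le> real ((m + 1) ^ 3)" using card_triples_le[of m] by linarith
    also have "\<dots> = (real m + 1) ^ 3" by (simp add: add.commute)
    also have "\<dots> \<le> (C * b\<^sup>2 + 1) ^ 3" using m by (intro power_mono) auto
    finally show ?thesis .
  qed
  have "(\<Sum>s\<in>typical \<epsilon> b D m. \<P>(\<omega> in gauss. lin {1..m} (contrast_of t) \<omega> \<ge> b \<and> - lin {1..m} (contrast_of s) \<omega> \<ge> b))
    \<le> (\<Sum>s\<in>typical \<epsilon> b D m. Phi (- b) * exp (- (\<epsilon>\<^sup>2 / (16 * C\<^sup>2) * b\<^sup>2)))"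
    by (intro sum_mono opp)
  also have "\<dots> = real (card (typical \<epsilon> b D m)) * (Phi (- b) * exp (- (\<epsilon>\<^sup>2 / (16 * C\<^sup>2) * b\<^sup>2)))" by simp
  also have "\<dots> \<le> (C * b\<^sup>2 + 1) ^ 3 * (Phi (- b) * exp (- (\<epsilon>\<^sup>2 / (16 * C\<^sup>2) * b\<^sup>2)))"
    by (intro mult_right_mono cardG) auto
  finally show ?thesis using 1 unfolding far_prob_def by (simp only: distrib_left mult_ac)
qed

lemma far_prob_small:
  assumes eps: "\<epsilon> > 0" and C: "C > 0" and \<delta>: "\<delta> > 0"
  shows "\<exists>D0. \<forall>D\<ge>D0. \<exists>B\<ge>1. \<forall>b\<ge>B. \<forall>m t. real m \<le> C * b\<^sup>2 \<longrightarrow> t \<in> typical \<epsilon> b D m \<longrightarrow>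
     far_prob \<epsilon> b D m t \<le> Phi (- b) * \<delta>"
proof -
  define \<gamma> where "\<gamma> = \<epsilon> ^ 3 / (24 * C ^ 4)"
  define a where "a = \<epsilon>\<^sup>2 / (16 * C\<^sup>2)"
  have pos: "\<gamma> > 0" "a > 0" using eps C by (auto simp: \<gamma>_def a_def)
  define F where "F = (2 / (1 - exp (- (\<gamma> / 2)))) ^ 3"
  have "(\<lambda>D. exp (- (\<gamma> / 2)) ^ D * F) \<longlonglongrightarrow> 0 * F"
    using pos by (intro tendsto_mult tendsto_const LIMSEQ_power_zero) simp
  then have "eventually (\<lambda>D. exp (- (\<gamma> / 2)) ^ D * F < \<delta> / 2) sequentially"
    using \<delta> by (intro order_tendstoD(2)) auto
  then obtain D0 where D0: "exp (- (\<gamma> / 2)) ^ D * F < \<delta> / 2" if "D \<ge> D0" for D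
    by (auto simp: eventually_sequentially)
  have "((\<lambda>b. (C * b\<^sup>2 + 1) ^ 3 * exp (- (a * b\<^sup>2))) \<longlongrightarrow> 0) at_top"
    using pos C by real_asymp
  then have "eventually (\<lambda>b. (C * b\<^sup>2 + 1) ^ 3 * exp (- (a * b\<^sup>2)) < \<delta> / 2) at_top"
    using \<delta> by (intro order_tendstoD(2)) auto
  then obtain B where B: "(C * b\<^sup>2 + 1) ^ 3 * exp (- (a * b\<^sup>2)) < \<delta> / 2" if "b \<ge> B" for b
    by (auto simp: eventually_at_top_linorder)
  have "far_prob \<epsilon> b D m t \<le> Phi (- b) * \<delta>"
    if "D \<ge> D0" "b \<ge> max 1 B" "real m \<le> C * b\<^sup>2" "t \<in> typical \<epsilon> b D m" for D b m t
  proof -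
    have "exp (- (\<gamma> / 2 * real D)) = exp (- (\<gamma> / 2)) ^ D" by (simp add: exp_of_nat_mult[symmetric] mult.commute)
    then have "far_prob \<epsilon> b D m t \<le> Phi (- b) * (exp (- (\<gamma> / 2)) ^ D * F + (C * b\<^sup>2 + 1) ^ 3 * exp (- (a * b\<^sup>2)))"
      using far_prob_le[OF eps C _ that(3,4) \<gamma>_def] that(2) unfolding F_def a_def by simp
    also have "\<dots> \<le> Phi (- b) * \<delta>"
      using D0[OF that(1)] B[of b] that(2) by (intro mult_left_mono) auto
    finally show ?thesis .
  qed
  then show ?thesis by (meson max.cobounded1)
qed

lemma card_less_real: "x \<ge> 0 \<Longrightarrow> real (card {d::nat. real d < x}) \<le> x + 1" "finite {d::nat. real d < x}"
proof -
  have *: "{d::nat. real d < x} \<subseteq> {..<nat \<lceil>x\<rceil>}"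
  proof
    fix d assume "d \<in> {d::nat. real d < x}"
    then have "int d < \<lceil>x\<rceil>" by (simp add: less_ceiling_iff)
    then show "d \<in> {..<nat \<lceil>x\<rceil>}" by simp
  qed
  show "finite {d::nat. real d < x}" by (rule finite_subset[OF *]) simp
  assume x: "x \<ge> 0"
  have "card {d::nat. real d < x} \<le> nat \<lceil>x\<rceil>" using card_mono[OF _ *] by simp
  moreover have "real (nat \<lceil>x\<rceil>) \<le> x + 1" using x ceiling_correct[of x] by simp
  ultimately show "real (card {d::nat. real d < x}) \<le> x + 1" by linarith
qed

lemma card_not_typical_le:
  assumes "\<epsilon> > 0" "b > 0"
  shows "real (card (triples m - typical \<epsilon> b D m)) \<le> (real m + 1)\<^sup>2 * (2 * (\<epsilon> * b\<^sup>2 + 1) + 2 * real D)"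
proof -
  let ?S = "{d::nat. real d < \<epsilon> * b\<^sup>2}"
  have x: "\<epsilon> * b\<^sup>2 \<ge> 0" using assms by simp
  note cS = card_less_real(1)[OF x] and fS = card_less_real(2)[of "\<epsilon> * b\<^sup>2"]
  define A1 where "A1 = (\<lambda>(i, k, d). (i, i + d, k)) ` ({..m} \<times> {..m} \<times> ?S)"
  define A2 where "A2 = (\<lambda>(i, k, d). (i, k - d, k)) ` ({..m} \<times> {..m} \<times> ?S)"
  define A3 where "A3 = {..<D} \<times> {..m} \<times> {..m}"
  define A4 where "A4 = {..m} \<times> {..m} \<times> {m + 1 - D..m}"
  have sub: "triples m - typical \<epsilon> b D m \<subseteq> A1 \<union> A2 \<union> A3 \<union> A4"
  proof
    fix t assume t: "t \<in> triples m - typical \<epsilon> b D m"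
    obtain i j k where ijk: "t = (i, j, k)" by (cases t)
    have T: "i < j" "j < k" "k \<le> m" using t by (auto simp: ijk triples_def)
    consider "real j - real i < \<epsilon> * b\<^sup>2" | "real k - real j < \<epsilon> * b\<^sup>2" | "i < D" | "m < k + D"
      using t T by (force simp: ijk typical_def spread_def)
    then show "t \<in> A1 \<union> A2 \<union> A3 \<union> A4"
    proof cases
      case 1
      then have "(i, k, j - i) \<in> {..m} \<times> {..m} \<times> ?S" using T by (auto simp: of_nat_diff)
      then have "(\<lambda>(i, k, d). (i, i + d, k)) (i, k, j - i) \<in> A1" unfolding A1_def by (rule imageI)
      then show ?thesis using T by (simp add: ijk)
    next
      case 2
      then have "(i, k, k - j) \<in> {..m} \<times> {..m} \<times> ?S" using T by (auto simp: of_nat_diff)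
      then have "(\<lambda>(i, k, d). (i, k - d, k)) (i, k, k - j) \<in> A2" unfolding A2_def by (rule imageI)
      then show ?thesis using T by (simp add: ijk)
    next
      case 3
      then show ?thesis using T by (auto simp: ijk A3_def)
    next
      case 4
      then show ?thesis using T by (auto simp: ijk A4_def)
    qed
  qed
  have fin: "finite A1" "finite A2" "finite A3" "finite A4"
    using fS by (auto simp: A1_def A2_def A3_def A4_def)
  have c12: "real (card A1) \<le> (real m + 1)\<^sup>2 * (\<epsilon> * b\<^sup>2 + 1)" "real (card A2) \<le> (real m + 1)\<^sup>2 * (\<epsilon> * b\<^sup>2 + 1)"
  proof -
    have *: "real (card (f ` ({..m} \<times> {..m} \<times> ?S))) \<le> (real m + 1)\<^sup>2 * (\<epsilon> * b\<^sup>2 + 1)" for f :: "nat \<times> nat \<times> nat \<Rightarrow> nat \<times> nat \<times> nat"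
    proof -
      have "card (f ` ({..m} \<times> {..m} \<times> ?S)) \<le> card ({..m} \<times> {..m} \<times> ?S)"
        using fS by (intro card_image_le) auto
      then have "real (card (f ` ({..m} \<times> {..m} \<times> ?S))) \<le> real (card ({..m} \<times> {..m} \<times> ?S))" by simp
      also have "\<dots> = (real m + 1)\<^sup>2 * real (card ?S)"
        by (simp add: card_cartesian_product power2_eq_square algebra_simps)
      also have "\<dots> \<le> (real m + 1)\<^sup>2 * (\<epsilon> * b\<^sup>2 + 1)" by (intro mult_left_mono cS) auto
      finally show ?thesis .
    qed
    show "real (card A1) \<le> (real m + 1)\<^sup>2 * (\<epsilon> * b\<^sup>2 + 1)" "real (card A2) \<le> (real m + 1)\<^sup>2 * (\<epsilon> * b\<^sup>2 + 1)"
      unfolding A1_def A2_def by (rule *)+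
  qed
  have c3: "real (card A3) = (real m + 1)\<^sup>2 * real D"
    by (simp add: A3_def card_cartesian_product power2_eq_square algebra_simps)
  have c4: "real (card A4) \<le> (real m + 1)\<^sup>2 * real D"
  proof -
    have "real (card A4) = (real m + 1)\<^sup>2 * real (card {m + 1 - D..m})"
      by (simp add: A4_def card_cartesian_product power2_eq_square algebra_simps del: card_atLeastAtMost)
    also have "\<dots> \<le> (real m + 1)\<^sup>2 * real D" by (intro mult_left_mono) auto
    finally show ?thesis .
  qed
  have "card (triples m - typical \<epsilon> b D m) \<le> card (A1 \<union> A2 \<union> A3 \<union> A4)"
    using fin by (intro card_mono sub) auto
  also have "\<dots> \<le> card A1 + card A2 + card A3 + card A4"
    by (meson add_mono card_Un_le le_refl order_trans)
  finally have "real (card (triples m - typical \<epsilon> b D m)) \<le> real (card A1) + real (card A2) + real (card A3) + real (card A4)"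
    by linarith
  also have "\<dots> \<le> (real m + 1)\<^sup>2 * (\<epsilon> * b\<^sup>2 + 1) + (real m + 1)\<^sup>2 * (\<epsilon> * b\<^sup>2 + 1) + (real m + 1)\<^sup>2 * real D + (real m + 1)\<^sup>2 * real D"
    using c12 c3 c4 by linarith
  also have "\<dots> = (real m + 1)\<^sup>2 * (2 * (\<epsilon> * b\<^sup>2 + 1) + 2 * real D)" by (simp add: algebra_simps)
  finally show ?thesis .
qed

lemma pred_lin_le: "Measurable.pred gauss (\<lambda>\<omega>. lin I g \<omega> \<le> lin J h \<omega>)"
  unfolding pred_def by (intro borel_measurable_le lin_measurable)

lemma pred_lin_less: "Measurable.pred gauss (\<lambda>\<omega>. lin I g \<omega> < lin J h \<omega>)"
  unfolding pred_def by (intro borel_measurable_less lin_measurable)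

section \<open>The probability of an exceedance\<close>

definition exceed :: "nat \<Rightarrow> real \<Rightarrow> real" where
  "exceed m b = \<P>(\<omega> in gauss. \<exists>t\<in>triples m. \<bar>lin {1..m} (contrast_of t) \<omega>\<bar> \<ge> b)"

lemma lin_minus: "lin I g (\<lambda>i. - 1 * \<omega> i) = - lin I g \<omega>"
  by (simp add: lin_def sum_negf)

lemma cube_sym: "(i', j', k') \<in> cube D i j k \<longleftrightarrow> (i, j, k) \<in> cube D i' j' k'"
  unfolding cube_def by auto

abbreviation cube_of :: "nat \<Rightarrow> nat \<times> nat \<times> nat \<Rightarrow> (nat \<times> nat \<times> nat) set" where
  "cube_of D t \<equiv> cube D (fst t) (fst (snd t)) (snd (snd t))"

lemma cube_subset_triples:
  assumes "t \<in> typical \<epsilon> b D m" "2 * real D < \<epsilon> * b\<^sup>2"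
  shows "cube_of D t \<subseteq> triples m"
proof
  fix s assume s: "s \<in> cube_of D t"
  obtain i j k where t: "t = (i, j, k)" by (cases t)
  obtain i' j' k' where s': "s = (i', j', k')" by (cases s)
  have d: "i' \<le> i + D" "j \<le> j' + D" "j' \<le> j + D" "k \<le> k' + D" "k' \<le> k + D" using s by (auto simp: cube_def t s')
  have l: "real j - real i \<ge> \<epsilon> * b\<^sup>2" "real k - real j \<ge> \<epsilon> * b\<^sup>2" "k + D \<le> m"
    using assms(1) by (auto simp: typical_def spread_def t)
  have "real i' < real j'" "real j' < real k'" using d l assms(2) by linarith+
  then show "s \<in> triples m" using d l by (simp add: s' triples_def)
qed

text \<open>At a maximiser of \<open>|Z|\<close>, either the triple is exceptional, which the union bound covers, or \<open>Z\<close> or \<open>- Z\<close>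
  has a local maximum there.\<close>

lemma exceed_upper:
  assumes eps: "\<epsilon> > 0" and b: "b > 0" and D: "2 * real D < \<epsilon> * b\<^sup>2"
  shows "exceed m b \<le> real (card (triples m - typical \<epsilon> b D m)) * (2 * Phi (- b))
    + 2 * (\<Sum>(i, j, k)\<in>typical \<epsilon> b D m. weak_peak_prob m b D i j k)"
proof -
  let ?T = "triples m" and ?G = "typical \<epsilon> b D m"
  let ?Z = "\<lambda>t \<omega>. lin {1..m} (contrast_of t) \<omega>"
  have GT: "?G \<subseteq> ?T" by (rule typical_subset_triples[OF eps b])
  have finG: "finite ?G" by (rule finite_subset[OF GT]) simp
  define P where "P t \<omega> \<longleftrightarrow> ?Z t \<omega> \<ge> b \<and> (\<forall>s\<in>cube_of D t. ?Z s \<omega> \<le> ?Z t \<omega>)" for t \<omega>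
  have Pm: "Measurable.pred gauss (P t)" for t
    unfolding P_def by (intro pred_intros_logic gauss_pred_ball pred_lin_le pred_lin_less finite_cube) measurable
  have neg_meas: "(\<lambda>\<omega> i. - 1 * \<omega> i) \<in> gauss \<rightarrow>\<^sub>M gauss" by (rule measurable_into_gauss) measurable
  have Pm': "Measurable.pred gauss (\<lambda>\<omega>. P t (\<lambda>i. - 1 * \<omega> i))" for t
    using measurable_compose[OF neg_meas Pm] by simp
  define U where "U t = {\<omega> \<in> space gauss. \<bar>?Z t \<omega>\<bar> \<ge> b}" for t
  define V where "V t = {\<omega> \<in> space gauss. P t \<omega>} \<union> {\<omega> \<in> space gauss. P t (\<lambda>i. - 1 * \<omega> i)}" for t
  have Us: "U t \<in> sets gauss" for t unfolding U_def by measurable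
  have Vs: "V t \<in> sets gauss" for t
    unfolding V_def using Pm[of t] Pm'[of t] by (intro sets.Un) (simp_all add: pred_def)
  have U: "measure gauss (U t) \<le> 2 * Phi (- b)" if "t \<in> ?T" for t
    unfolding U_def using sum_sq_contrast_of[OF that] b by (intro prob_abs_lin_ge) auto
  have V: "measure gauss (V (i, j, k)) \<le> 2 * weak_peak_prob m b D i j k" for i j k
  proof -
    have "measure gauss (V (i, j, k)) \<le> \<P>(\<omega> in gauss. P (i, j, k) \<omega>) + \<P>(\<omega> in gauss. P (i, j, k) (\<lambda>i. - 1 * \<omega> i))"
      unfolding V_def using Pm Pm' by (intro measure_Un_le) (simp_all add: pred_def)
    also have "\<P>(\<omega> in gauss. P (i, j, k) (\<lambda>i. - 1 * \<omega> i)) = \<P>(\<omega> in gauss. P (i, j, k) \<omega>)"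
      by (rule prob_gauss_sign[OF _ Pm]) simp
    also have "\<P>(\<omega> in gauss. P (i, j, k) \<omega>) = weak_peak_prob m b D i j k"
      by (simp add: P_def weak_peak_prob_def contrast_of_def)
    finally show ?thesis by simp
  qed
  have "{\<omega> \<in> space gauss. \<exists>t\<in>?T. \<bar>?Z t \<omega>\<bar> \<ge> b} \<subseteq> (\<Union>t\<in>?T - ?G. U t) \<union> (\<Union>t\<in>?G. V t)"
  proof
    fix \<omega> assume "\<omega> \<in> {\<omega> \<in> space gauss. \<exists>t\<in>?T. \<bar>?Z t \<omega>\<bar> \<ge> b}"
    then obtain t0 where t0: "t0 \<in> ?T" "\<bar>?Z t0 \<omega>\<bar> \<ge> b" by auto
    let ?A = "(\<lambda>t. \<bar>?Z t \<omega>\<bar>) ` ?T"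
    have A: "finite ?A" "?A \<noteq> {}" using t0 by auto
    from Max_in[OF A] obtain t where t: "t \<in> ?T" "\<bar>?Z t \<omega>\<bar> = Max ?A" by auto
    have mx: "\<bar>?Z s \<omega>\<bar> \<le> \<bar>?Z t \<omega>\<bar>" if "s \<in> ?T" for s
      unfolding t(2) using that by (intro Max_ge A) auto
    have tb: "\<bar>?Z t \<omega>\<bar> \<ge> b" using mx[OF t0(1)] t0(2) by linarith
    show "\<omega> \<in> (\<Union>t\<in>?T - ?G. U t) \<union> (\<Union>t\<in>?G. V t)"
    proof (cases "t \<in> ?G")
      case False
      moreover have "\<omega> \<in> U t" using tb by (simp add: U_def)
      ultimately show ?thesis using t by blast
    next
      case True
      note sub = cube_subset_triples[OF True D]
      have "P t \<omega> \<or> P t (\<lambda>i. - 1 * \<omega> i)"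
      proof (cases "?Z t \<omega> \<ge> 0")
        case True
        have "?Z s \<omega> \<le> ?Z t \<omega>" if "s \<in> cube_of D t" for s
          using mx[of s] sub that True by (auto simp: abs_le_iff)
        then show ?thesis using tb True by (simp add: P_def)
      next
        case False
        have "- ?Z s \<omega> \<le> - ?Z t \<omega>" if "s \<in> cube_of D t" for s
          using mx[of s] sub that False by (auto simp: abs_le_iff)
        then show ?thesis using tb False unfolding P_def lin_minus by simp
      qed
      then show ?thesis using True by (auto simp: V_def)
    qed
  qed
  then have "exceed m b \<le> measure gauss (\<Union>t\<in>?T - ?G. U t) + measure gauss (\<Union>t\<in>?G. V t)"
    unfolding exceed_def using Us Vs finG by (intro gauss_prob_le_Un) auto
  also have "measure gauss (\<Union>t\<in>?T - ?G. U t) \<le> (\<Sum>t\<in>?T - ?G. 2 * Phi (- b))"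
    using Us U by (intro order_trans[OF measure_UNION_le] sum_mono) auto
  also have "measure gauss (\<Union>t\<in>?G. V t) \<le> (\<Sum>t\<in>?G. 2 * (case t of (i, j, k) \<Rightarrow> weak_peak_prob m b D i j k))"
    using Vs V finG by (intro order_trans[OF measure_UNION_le] sum_mono) (auto split: prod.split)
  finally show ?thesis by (simp add: sum_distrib_left)
qed

text \<open>Local maxima above \<open>b\<close> that are not accompanied by another exceedance outside the cube, nor by an
  exceedance of the opposite sign, are disjoint events for different triples and signs.\<close>

lemma exceed_lower:
  assumes eps: "\<epsilon> > 0" and b: "b > 0"
  shows "2 * (\<Sum>(i, j, k)\<in>typical \<epsilon> b D m. peak_prob m b D i j k - far_prob \<epsilon> b D m (i, j, k)) \<le> exceed m b"
proof -
  let ?T = "triples m" and ?G = "typical \<epsilon> b D m"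
  let ?Z = "\<lambda>t \<omega>. lin {1..m} (contrast_of t) \<omega>"
  have GT: "?G \<subseteq> ?T" by (rule typical_subset_triples[OF eps b])
  have finG: "finite ?G" by (rule finite_subset[OF GT]) simp
  define R where "R t = ?G - cube_of D t - {t}" for t
  have finR: "finite (R t)" for t using finG by (simp add: R_def)
  define P where "P t \<omega> \<longleftrightarrow> ?Z t \<omega> \<ge> b \<and> (\<forall>s\<in>cube_of D t. ?Z s \<omega> < ?Z t \<omega>)" for t \<omega>
  define F where "F t \<omega> \<longleftrightarrow> P t \<omega> \<and> (\<forall>s\<in>R t. ?Z s \<omega> < b) \<and> (\<forall>s\<in>?G. - ?Z s \<omega> < b)" for t \<omega>
  have Pm: "Measurable.pred gauss (P t)" for t
    unfolding P_def by (intro pred_intros_logic gauss_pred_ball pred_lin_le pred_lin_less finite_cube) measurable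
  have Fm: "Measurable.pred gauss (F t)" for t
    unfolding F_def by (intro pred_intros_logic gauss_pred_ball Pm finG finR) measurable
  have neg_meas: "(\<lambda>\<omega> i. - 1 * \<omega> i) \<in> gauss \<rightarrow>\<^sub>M gauss" by (rule measurable_into_gauss) measurable
  have Fm': "Measurable.pred gauss (\<lambda>\<omega>. F t (\<lambda>i. - 1 * \<omega> i))" for t
    using measurable_compose[OF neg_meas Fm] by simp
  have PF: "peak_prob m b D i j k - far_prob \<epsilon> b D m (i, j, k) \<le> \<P>(\<omega> in gauss. F (i, j, k) \<omega>)" for i j k
  proof -
    let ?t = "(i, j, k)"
    let ?A = "\<lambda>s. {\<omega> \<in> space gauss. ?Z ?t \<omega> \<ge> b \<and> ?Z s \<omega> \<ge> b}" and ?B = "\<lambda>s. {\<omega> \<in> space gauss. ?Z ?t \<omega> \<ge> b \<and> - ?Z s \<omega> \<ge> b}"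
    have AB: "?A s \<in> sets gauss" "?B s \<in> sets gauss" for s by (auto intro!: gauss_sets_Collect)
    have "{\<omega> \<in> space gauss. P ?t \<omega>} \<subseteq> {\<omega> \<in> space gauss. F ?t \<omega>} \<union> ((\<Union>s\<in>R ?t. ?A s) \<union> (\<Union>s\<in>?G. ?B s))"
      by (auto simp: F_def P_def not_less)
    then have "\<P>(\<omega> in gauss. P ?t \<omega>) \<le> \<P>(\<omega> in gauss. F ?t \<omega>) + measure gauss ((\<Union>s\<in>R ?t. ?A s) \<union> (\<Union>s\<in>?G. ?B s))"
      using finG finR AB Fm by (intro gauss_prob_le_Un) (auto simp: pred_def)
    also have "measure gauss ((\<Union>s\<in>R ?t. ?A s) \<union> (\<Union>s\<in>?G. ?B s)) \<le> measure gauss (\<Union>s\<in>R ?t. ?A s) + measure gauss (\<Union>s\<in>?G. ?B s)"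
      using finG finR AB by (intro measure_Un_le) auto
    also have "measure gauss (\<Union>s\<in>R ?t. ?A s) \<le> (\<Sum>s\<in>R ?t. measure gauss (?A s))"
      using finR AB by (intro measure_UNION_le) auto
    also have "measure gauss (\<Union>s\<in>?G. ?B s) \<le> (\<Sum>s\<in>?G. measure gauss (?B s))"
      using finG AB by (intro measure_UNION_le) auto
    finally have "\<P>(\<omega> in gauss. P ?t \<omega>) \<le> \<P>(\<omega> in gauss. F ?t \<omega>) + far_prob \<epsilon> b D m ?t"
      by (simp add: far_prob_def R_def)
    moreover have "\<P>(\<omega> in gauss. P ?t \<omega>) = peak_prob m b D i j k"
      by (simp add: P_def peak_prob_def contrast_of_def)
    ultimately show ?thesis by linarith
  qed
  define E where "E p = {\<omega> \<in> space gauss. F (fst p) (\<lambda>i. (if snd p then 1 else - 1) * \<omega> i)}" for p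
  have Es: "E p \<in> sets gauss" for p
    using Fm[of "fst p"] Fm'[of "fst p"] by (cases "snd p") (simp_all add: E_def pred_def)
  have EP: "measure gauss (E (t, d)) = \<P>(\<omega> in gauss. F t \<omega>)" for t d
    unfolding E_def fst_conv snd_conv by (rule prob_gauss_sign[OF _ Fm]) simp
  have lin_sign: "?Z s (\<lambda>i. (if d then 1 else - 1) * \<omega> i) = (if d then ?Z s \<omega> else - ?Z s \<omega>)" for s d \<omega>
    by (simp add: lin_def sum_negf)
  have disj: "disjoint_family_on E (?G \<times> UNIV)"
  proof (unfold disjoint_family_on_def, intro ballI impI)
    fix p q assume p: "p \<in> ?G \<times> (UNIV :: bool set)" and q: "q \<in> ?G \<times> (UNIV :: bool set)" and ne: "p \<noteq> q"
    obtain t d where pt: "p = (t, d)" by (cases p)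
    obtain s e where qs: "q = (s, e)" by (cases q)
    have tG: "t \<in> ?G" and sG: "s \<in> ?G" using p q by (auto simp: pt qs)
    have "False" if w: "\<omega> \<in> E p" "\<omega> \<in> E q" for \<omega>
    proof -
      let ?w = "\<lambda>i. (if d then 1 else - 1) * \<omega> i" and ?w' = "\<lambda>i. (if e then 1 else - 1) * \<omega> i"
      have F1: "F t ?w" and F2: "F s ?w'" using w by (auto simp: E_def pt qs)
      show False
      proof (cases "d = e")
        case True
        then have ts: "t \<noteq> s" using ne by (simp add: pt qs)
        have F2': "F s ?w" using F2 True by simp
        show False
        proof (cases "s \<in> cube_of D t")
          case True
          obtain i j k where t': "t = (i, j, k)" by (cases t)
          obtain i' j' k' where s': "s = (i', j', k')" by (cases s)
          have "t \<in> cube_of D s" using True cube_sym[of i' j' k' D i j k] by (simp add: t' s')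
          then have "?Z t ?w < ?Z s ?w" using F2' unfolding F_def P_def by blast
          moreover have "?Z s ?w < ?Z t ?w" using F1 True unfolding F_def P_def by blast
          ultimately show False by simp
        next
          case False
          then have "s \<in> R t" using sG ts by (simp add: R_def)
          then have "?Z s ?w < b" using F1 unfolding F_def by blast
          moreover have "?Z s ?w \<ge> b" using F2' unfolding F_def P_def by blast
          ultimately show False by simp
        qed
      next
        case False
        have "- ?Z s ?w < b" using F1 sG unfolding F_def by blast
        moreover have "?Z s ?w' \<ge> b" using F2 unfolding F_def P_def by blast
        ultimately show False using False unfolding lin_sign by (cases d; cases e) auto
      qed
    qed
    then show "E p \<inter> E q = {}" by blast
  qed
  have "(\<Sum>p\<in>?G \<times> UNIV. measure gauss (E p)) = measure gauss (\<Union>p\<in>?G \<times> UNIV. E p)"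
    using finG Es disj by (intro gs.P.finite_measure_finite_Union[symmetric]) auto
  also have "\<dots> \<le> exceed m b"
    unfolding exceed_def
  proof (rule gs.P.finite_measure_mono)
    show "(\<Union>p\<in>?G \<times> UNIV. E p) \<subseteq> {\<omega> \<in> space gauss. \<exists>t\<in>?T. b \<le> \<bar>?Z t \<omega>\<bar>}"
    proof
      fix \<omega> assume "\<omega> \<in> (\<Union>p\<in>?G \<times> UNIV. E p)"
      then obtain t d where t: "t \<in> ?G" "F t (\<lambda>i. (if d then 1 else - 1) * \<omega> i)" by (auto simp: E_def)
      then have "b \<le> (if d then ?Z t \<omega> else - ?Z t \<omega>)" unfolding F_def P_def lin_sign by blast
      then have "b \<le> \<bar>?Z t \<omega>\<bar>" by (auto split: if_splits)
      then show "\<omega> \<in> {\<omega> \<in> space gauss. \<exists>t\<in>?T. b \<le> \<bar>?Z t \<omega>\<bar>}" using t GT by auto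
    qed
    show "{\<omega> \<in> space gauss. \<exists>t\<in>?T. b \<le> \<bar>?Z t \<omega>\<bar>} \<in> gs.P.events"
      by (intro sets.sets_Collect_finite_Ex finite_triples) measurable
  qed
  also have "(\<Sum>p\<in>?G \<times> UNIV. measure gauss (E p)) = (\<Sum>t\<in>?G. \<Sum>d\<in>(UNIV :: bool set). measure gauss (E (t, d)))"
    by (subst sum.cartesian_product) (simp add: case_prod_beta)
  also have "\<dots> = (\<Sum>t\<in>?G. 2 * \<P>(\<omega> in gauss. F t \<omega>))" by (simp add: EP UNIV_bool)
  finally have "(\<Sum>t\<in>?G. 2 * \<P>(\<omega> in gauss. F t \<omega>)) \<le> exceed m b" .
  moreover have "2 * (\<Sum>(i, j, k)\<in>?G. peak_prob m b D i j k - far_prob \<epsilon> b D m (i, j, k)) \<le> (\<Sum>t\<in>?G. 2 * \<P>(\<omega> in gauss. F t \<omega>))"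
    unfolding sum_distrib_left using PF by (intro sum_mono) (auto split: prod.split)
  ultimately show ?thesis by linarith
qed

section \<open>The main sum\<close>

text \<open>With \<open>k < m\<close> instead of \<open>k \<le> m\<close>, segments of lengths \<open>u\<close> and \<open>v\<close> have exactly \<open>m - u - v\<close> positions, the factor
  in the asymptotic formula.\<close>

definition inner_triples :: "nat \<Rightarrow> (nat \<times> nat \<times> nat) set" where
  "inner_triples m = {(i, j, k). i < j \<and> j < k \<and> k < m}"

definition main_sum :: "nat \<Rightarrow> real \<Rightarrow> real" where
  "main_sum m b = (\<Sum>(i, j, k)\<in>inner_triples m. peak_limit b (real j - real i) (real k - real j))"

lemma inner_subset: "inner_triples m \<subseteq> triples m"
  by (auto simp: inner_triples_def triples_def)

lemma finite_inner [simp]: "finite (inner_triples m)"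
  by (rule finite_subset[OF inner_subset]) simp

lemma peak_limit_nonneg: "peak_limit b u v \<ge> 0"
  by (simp add: peak_limit_def)

lemma peak_limit_le_1: "b > 0 \<Longrightarrow> u > 0 \<Longrightarrow> v > 0 \<Longrightarrow> peak_limit b u v \<le> 1"
  unfolding peak_limit_def
  by (intro mult_le_one power_le_one never_up_le_1 less_imp_le[OF never_up_pos] mult_nonneg_nonneg zero_le_power2 mult_pos_pos ampL_pos ampR_pos ampM_pos)

lemma exceed_main_sum:
  assumes C: "C \<ge> 1" and \<delta>: "\<delta> > 0"
  shows "\<exists>B\<ge>1. \<forall>b\<ge>B. \<forall>m. real m \<le> C * b\<^sup>2 \<longrightarrow> \<bar>exceed m b - 2 * Phi (- b) * main_sum m b\<bar> \<le> \<delta> * (b ^ 6 * Phi (- b))"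
proof -
  (* The exceptional triples cost 24 C^2 epsilon and the local errors 32 C^3 delta',
     both relative to b^6 Phi(-b); each is half of delta. *)
  define \<epsilon> where "\<epsilon> = \<delta> / (48 * C\<^sup>2)"
  define \<delta>' where "\<delta>' = \<delta> / (64 * C ^ 3)"
  have eps: "\<epsilon> > 0" and \<delta>': "\<delta>' > 0" and C0: "C > 0" using C \<delta> by (auto simp: \<epsilon>_def \<delta>'_def)
  obtain D1 where D1: "\<And>D. D \<ge> D1 \<Longrightarrow> \<exists>B\<ge>1. \<forall>b\<ge>B. \<forall>m i j k. real m \<le> C * b\<^sup>2 \<longrightarrow> spread (\<epsilon> * b\<^sup>2) m i j k \<longrightarrow> D \<le> i \<longrightarrow> k + D \<le> m \<longrightarrow>
     Phi (- b) * (peak_limit b (real j - real i) (real k - real j) - \<delta>') \<le> peak_prob m b D i j k \<and>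
     weak_peak_prob m b D i j k \<le> Phi (- b) * (peak_limit b (real j - real i) (real k - real j) + \<delta>')"
    using peak_asymptotics[OF eps C0 \<delta>'] by blast
  obtain D2 where D2: "\<And>D. D \<ge> D2 \<Longrightarrow> \<exists>B\<ge>1. \<forall>b\<ge>B. \<forall>m t. real m \<le> C * b\<^sup>2 \<longrightarrow> t \<in> typical \<epsilon> b D m \<longrightarrow> far_prob \<epsilon> b D m t \<le> Phi (- b) * \<delta>'"
    using far_prob_small[OF eps C0 \<delta>'] by blast
  define D where "D = max 1 (max D1 D2)"
  have D: "D \<ge> 1" "D \<ge> D1" "D \<ge> D2" by (auto simp: D_def)
  obtain B1 where B1: "B1 \<ge> 1" "\<And>b m i j k. b \<ge> B1 \<Longrightarrow> real m \<le> C * b\<^sup>2 \<Longrightarrow> spread (\<epsilon> * b\<^sup>2) m i j k \<Longrightarrow> D \<le> i \<Longrightarrow> k + D \<le> m \<Longrightarrow>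
     Phi (- b) * (peak_limit b (real j - real i) (real k - real j) - \<delta>') \<le> peak_prob m b D i j k \<and>
     weak_peak_prob m b D i j k \<le> Phi (- b) * (peak_limit b (real j - real i) (real k - real j) + \<delta>')"
    using D1[OF D(2)] by blast
  obtain B2 where B2: "B2 \<ge> 1" "\<And>b m t. b \<ge> B2 \<Longrightarrow> real m \<le> C * b\<^sup>2 \<Longrightarrow> t \<in> typical \<epsilon> b D m \<Longrightarrow> far_prob \<epsilon> b D m t \<le> Phi (- b) * \<delta>'"
    using D2[OF D(3)] by blast
  define B where "B = max (max B1 B2) ((2 + 2 * real D) / \<epsilon>)"
  have "\<bar>exceed m b - 2 * Phi (- b) * main_sum m b\<bar> \<le> \<delta> * (b ^ 6 * Phi (- b))" if bB: "b \<ge> B" and m: "real m \<le> C * b\<^sup>2" for b m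
  proof -
    have b: "b \<ge> B1" "b \<ge> B2" "b \<ge> (2 + 2 * real D) / \<epsilon>" "b \<ge> 1" using bB B1(1) by (auto simp: B_def)
    have b0: "b > 0" using b by simp
    have Deps: "2 + 2 * real D \<le> \<epsilon> * b\<^sup>2"
    proof -
      have "2 + 2 * real D \<le> \<epsilon> * b" using b(3) eps by (simp add: divide_le_eq mult.commute)
      also have "\<dots> \<le> \<epsilon> * b\<^sup>2" using b(4) eps by (simp add: power2_eq_square)
      finally show ?thesis .
    qed
    let ?T = "triples m" and ?G = "typical \<epsilon> b D m" and ?\<phi> = "Phi (- b)"
    let ?g = "\<lambda>(i, j, k). peak_limit b (real j - real i) (real k - real j)"
    have GT: "?G \<subseteq> ?T" by (rule typical_subset_triples[OF eps b0])
    have finG: "finite ?G" by (rule finite_subset[OF GT]) simp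
    have GI: "?G \<subseteq> inner_triples m"
    proof
      fix t assume t: "t \<in> ?G"
      then have "t \<in> ?T" using GT by blast
      then show "t \<in> inner_triples m" using t D(1) by (auto simp: typical_def inner_triples_def triples_def)
    qed
    have m1: "real m + 1 \<le> 2 * C * b\<^sup>2"
    proof -
      have "1 * 1 \<le> C * b\<^sup>2" using C b by (intro mult_mono) (auto simp: one_le_power)
      then show ?thesis using m by linarith
    qed
    have b6: "b ^ 6 = b\<^sup>2 * (b\<^sup>2 * b\<^sup>2)" by (simp flip: power_add)
    have rest: "real (card (?T - ?G)) \<le> 12 * C\<^sup>2 * \<epsilon> * b ^ 6"
    proof -
      have "real (card (?T - ?G)) \<le> (real m + 1)\<^sup>2 * (2 * (\<epsilon> * b\<^sup>2 + 1) + 2 * real D)"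
        by (rule card_not_typical_le[OF eps b0])
      also have "\<dots> \<le> (2 * C * b\<^sup>2)\<^sup>2 * (3 * (\<epsilon> * b\<^sup>2))"
        using m1 Deps eps by (intro mult_mono power_mono) auto
      also have "\<dots> = 12 * C\<^sup>2 * \<epsilon> * b ^ 6" unfolding b6 by (simp add: power2_eq_square)
      finally show ?thesis .
    qed
    have cardG: "real (card ?G) \<le> 8 * C ^ 3 * b ^ 6"
    proof -
      have "card ?G \<le> card ?T" by (intro card_mono GT) simp
      then have "real (card ?G) \<le> real ((m + 1) ^ 3)" using card_triples_le[of m] by linarith
      also have "\<dots> = (real m + 1) ^ 3" by (simp add: add.commute)
      also have "\<dots> \<le> (2 * C * b\<^sup>2) ^ 3" using m1 by (intro power_mono) auto
      also have "\<dots> = 8 * C ^ 3 * b ^ 6" unfolding b6 by (simp add: power3_eq_cube power2_eq_square)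
      finally show ?thesis .
    qed
    have main1: "(\<Sum>t\<in>?G. ?g t) \<le> main_sum m b"
      unfolding main_sum_def using GI by (intro sum_mono2) (auto simp: peak_limit_nonneg)
    have main2: "main_sum m b \<le> (\<Sum>t\<in>?G. ?g t) + real (card (?T - ?G))"
    proof -
      have "main_sum m b \<le> (\<Sum>t\<in>?T. ?g t)"
        unfolding main_sum_def using inner_subset by (intro sum_mono2) (auto simp: peak_limit_nonneg)
      also have "\<dots> = (\<Sum>t\<in>?T - ?G. ?g t) + (\<Sum>t\<in>?G. ?g t)"
        by (rule sum.subset_diff[OF GT]) simp
      also have "(\<Sum>t\<in>?T - ?G. ?g t) \<le> (\<Sum>t\<in>?T - ?G. 1)"
        using b0 by (intro sum_mono) (auto simp: triples_def intro!: peak_limit_le_1)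
      finally show ?thesis by simp
    qed
    have up: "exceed m b \<le> real (card (?T - ?G)) * (2 * ?\<phi>) + 2 * (\<Sum>t\<in>?G. ?\<phi> * (?g t + \<delta>'))"
    proof -
      have "2 * real D < \<epsilon> * b\<^sup>2" using Deps by linarith
      from exceed_upper[OF eps b0 this, of m]
      have "exceed m b \<le> real (card (?T - ?G)) * (2 * ?\<phi>) + 2 * (\<Sum>(i, j, k)\<in>?G. weak_peak_prob m b D i j k)" .
      also have "(\<Sum>(i, j, k)\<in>?G. weak_peak_prob m b D i j k) \<le> (\<Sum>t\<in>?G. ?\<phi> * (?g t + \<delta>'))"
        using B1(2)[OF b(1) m] by (intro sum_mono) (auto simp: typical_def)
      finally show ?thesis by simp
    qed
    have lo: "2 * (\<Sum>t\<in>?G. ?\<phi> * (?g t - 2 * \<delta>')) \<le> exceed m b"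
    proof -
      have "(\<Sum>t\<in>?G. ?\<phi> * (?g t - 2 * \<delta>')) \<le> (\<Sum>(i, j, k)\<in>?G. peak_prob m b D i j k - far_prob \<epsilon> b D m (i, j, k))"
      proof (rule sum_mono)
        fix t assume t: "t \<in> ?G"
        obtain i j k where t': "t = (i, j, k)" by (cases t)
        have "?\<phi> * (peak_limit b (real j - real i) (real k - real j) - \<delta>') \<le> peak_prob m b D i j k"
          using B1(2)[OF b(1) m, of i j k] t by (auto simp: typical_def t')
        moreover have "far_prob \<epsilon> b D m (i, j, k) \<le> ?\<phi> * \<delta>'" using B2(2)[OF b(2) m t] by (simp add: t')
        moreover have "?\<phi> * (peak_limit b (real j - real i) (real k - real j) - 2 * \<delta>')
            = ?\<phi> * (peak_limit b (real j - real i) (real k - real j) - \<delta>') - ?\<phi> * \<delta>'" by (simp add: algebra_simps)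
        ultimately show "?\<phi> * (?g t - 2 * \<delta>') \<le> (case t of (i, j, k) \<Rightarrow> peak_prob m b D i j k - far_prob \<epsilon> b D m (i, j, k))"
          unfolding t' prod.case by linarith
      qed
      then show ?thesis using exceed_lower[OF eps b0, of m D] by linarith
    qed
    have sumG: "(\<Sum>t\<in>?G. ?\<phi> * (?g t + x)) = ?\<phi> * ((\<Sum>t\<in>?G. ?g t) + real (card ?G) * x)" for x
      by (simp add: sum.distrib sum_distrib_left[symmetric])
    have up': "exceed m b \<le> 2 * ?\<phi> * ((\<Sum>t\<in>?G. ?g t) + (real (card (?T - ?G)) + real (card ?G) * \<delta>'))"
      using up unfolding sumG by (simp add: algebra_simps)
    have lo': "2 * ?\<phi> * ((\<Sum>t\<in>?G. ?g t) - 2 * (real (card ?G) * \<delta>')) \<le> exceed m b"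
      using lo sumG[of "- (2 * \<delta>')"] by (simp add: algebra_simps)
    let ?err = "12 * C\<^sup>2 * \<epsilon> * b ^ 6 + 2 * (8 * C ^ 3 * b ^ 6 * \<delta>')"
    have cd: "real (card ?G) * \<delta>' \<le> 8 * C ^ 3 * b ^ 6 * \<delta>'" using cardG \<delta>' by (intro mult_right_mono) auto
    have cd0: "0 \<le> real (card ?G) * \<delta>'" using \<delta>' by simp
    have "2 * ?\<phi> * ((\<Sum>t\<in>?G. ?g t) + (real (card (?T - ?G)) + real (card ?G) * \<delta>')) \<le> 2 * ?\<phi> * (main_sum m b + ?err)"
      using main1 rest cd cd0 by (intro mult_left_mono) auto
    then have u: "exceed m b - 2 * ?\<phi> * main_sum m b \<le> 2 * ?\<phi> * ?err" using up' by (simp add: algebra_simps)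
    have "2 * ?\<phi> * (main_sum m b - ?err) \<le> 2 * ?\<phi> * ((\<Sum>t\<in>?G. ?g t) - 2 * (real (card ?G) * \<delta>'))"
      using main2 rest cd cd0 by (intro mult_left_mono) auto
    then have l: "2 * ?\<phi> * main_sum m b - exceed m b \<le> 2 * ?\<phi> * ?err" using lo' by (simp add: algebra_simps)
    have "2 * ?\<phi> * ?err = \<delta> * (b ^ 6 * ?\<phi>)"
    proof -
      have "12 * C\<^sup>2 * \<epsilon> = \<delta> / 4" "8 * C ^ 3 * \<delta>' = \<delta> / 8" using C by (auto simp: \<epsilon>_def \<delta>'_def)
      moreover have "8 * C ^ 3 * b ^ 6 * \<delta>' = 8 * C ^ 3 * \<delta>' * b ^ 6" by simp
      ultimately have e: "?err = \<delta> / 4 * b ^ 6 + 2 * (\<delta> / 8 * b ^ 6)" by (simp only:)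
      show ?thesis unfolding e by simp
    qed
    then show ?thesis using u l by linarith
  qed
  moreover have "B \<ge> 1" using B1(1) by (simp add: B_def)
  ultimately show ?thesis by blast
qed

text \<open>The sum has the full order \<open>b\<^sup>6\<close>: triples whose segments have lengths between \<open>m / 8\<close> and \<open>m / 4\<close> are
  a positive fraction of all triples, and for them the arguments of \<open>never_up\<close> stay away from \<open>0\<close>.
  Hence an error \<open>o(b\<^sup>6 \<Phi>(-b))\<close> is negligible.\<close>

lemma main_sum_lower:
  assumes c: "c > 0" and C: "C \<ge> 1"
  shows "\<exists>\<kappa>>0. \<forall>b\<ge>1. \<forall>m\<ge>16. c * b\<^sup>2 \<le> real m \<longrightarrow> real m \<le> C * b\<^sup>2 \<longrightarrow> \<kappa> * b ^ 6 \<le> main_sum m b"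
proof -
  define x0 where "x0 = 1 / sqrt C"
  have x0: "x0 > 0" using C by (simp add: x0_def)
  define \<kappa> where "\<kappa> = c ^ 3 / 4096 * (never_up x0) ^ 6"
  have "\<kappa> * b ^ 6 \<le> main_sum m b" if b: "b \<ge> 1" and m: "m \<ge> 16" "c * b\<^sup>2 \<le> real m" "real m \<le> C * b\<^sup>2" for b m
  proof -
    define n where "n = m div 8"
    have n: "n \<ge> 1" "8 * n \<le> m" "m \<le> 16 * n" using m(1) by (auto simp: n_def)
    let ?f = "\<lambda>(i, u, v). (i, i + u, i + u + v) :: nat \<times> nat \<times> nat"
    let ?S = "{..<n} \<times> {n..<2*n} \<times> {n..<2*n}"
    have inj: "inj_on ?f ?S" by (auto simp: inj_on_def)
    have sub: "?f ` ?S \<subseteq> inner_triples m" using n by (auto simp: inner_triples_def)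
    have g: "(never_up x0) ^ 6 \<le> peak_limit b (real u) (real v)" if "u \<in> {n..<2*n}" "v \<in> {n..<2*n}" for u v
    proof -
      have uv: "real u \<ge> real n" "real v \<ge> real n" "real u \<le> 2 * real n" "real v \<le> 2 * real n" using that by auto
      have n0: "real n > 0" using n by simp
      have *: "x0 \<le> b * sqrt (y / (x * (x + y)))" if "x \<ge> real n" "y \<ge> real n" "x \<le> 2 * real n" "y \<le> 2 * real n" for x y
      proof -
        have "1 / real m \<le> 1 / (8 * real n)" using n n0 by (intro divide_left_mono) auto
        also have "\<dots> = real n / (2 * real n * (4 * real n))" using n0 by simp
        also have "\<dots> \<le> y / (x * (x + y))" using that n0 by (intro frac_le mult_mono mult_pos_pos) auto
        finally have le: "1 / real m \<le> y / (x * (x + y))" .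
        have "1 / (C * b\<^sup>2) \<le> 1 / real m" using m n b C by (intro divide_left_mono) auto
        then have "sqrt (1 / (C * b\<^sup>2)) \<le> sqrt (y / (x * (x + y)))" using le by (intro real_sqrt_le_mono) linarith
        then have "b * sqrt (1 / (C * b\<^sup>2)) \<le> b * sqrt (y / (x * (x + y)))" using b by (intro mult_left_mono) auto
        moreover have "b * sqrt (1 / (C * b\<^sup>2)) = x0" using b by (simp add: x0_def real_sqrt_divide real_sqrt_mult)
        ultimately show ?thesis by simp
      qed
      have a: "x0 \<le> b * ampL (real u) (real v)" unfolding ampL_def by (intro * uv)
      have e: "x0 \<le> b * ampR (real u) (real v)" unfolding ampR_def using *[of "real v" "real u"] uv by (simp add: add.commute)
      have pos: "real u > 0" "real v > 0" using uv n0 by linarith+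
      have "b * ampL (real u) (real v) \<le> b * ampM (real u) (real v)"
        using b ampM_eq[OF pos] ampR_pos[OF pos] by (intro mult_left_mono) auto
      then have w: "x0 \<le> b * ampM (real u) (real v)" using a by linarith
      have "(never_up x0) ^ 6 = (never_up x0)\<^sup>2 * (never_up x0)\<^sup>2 * (never_up x0)\<^sup>2" by (simp flip: power_add)
      also have "\<dots> \<le> peak_limit b (real u) (real v)"
        unfolding peak_limit_def using never_up_pos[of x0] x0 a e w
        by (intro mult_mono power_mono never_up_mono mult_nonneg_nonneg) (auto intro: less_imp_le)
      finally show ?thesis .
    qed
    have "c * b\<^sup>2 / 16 \<le> real n" using m n by linarith
    then have "(c * b\<^sup>2 / 16) ^ 3 \<le> real n ^ 3" using c by (intro power_mono) auto
    then have "\<kappa> * b ^ 6 \<le> real n ^ 3 * (never_up x0) ^ 6"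
    proof -
      assume le: "(c * b\<^sup>2 / 16) ^ 3 \<le> real n ^ 3"
      have "(b\<^sup>2) ^ 3 = b ^ 6" by (simp flip: power_mult)
      then have "\<kappa> * b ^ 6 = (c * b\<^sup>2 / 16) ^ 3 * (never_up x0) ^ 6"
        by (simp add: \<kappa>_def power_mult_distrib power_divide)
      also have "\<dots> \<le> real n ^ 3 * (never_up x0) ^ 6" using le never_up_pos[of x0] by (intro mult_right_mono) auto
      finally show ?thesis .
    qed
    also have "\<dots> = (\<Sum>p\<in>?S. (never_up x0) ^ 6)" by (simp add: card_cartesian_product power3_eq_cube)
    also have "\<dots> \<le> (\<Sum>p\<in>?S. (\<lambda>(i, j, k). peak_limit b (real j - real i) (real k - real j)) (?f p))"
      using g by (intro sum_mono) auto
    also have "\<dots> = (\<Sum>(i, j, k)\<in>?f ` ?S. peak_limit b (real j - real i) (real k - real j))"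
      by (subst sum.reindex[OF inj]) (simp add: o_def)
    also have "\<dots> \<le> main_sum m b"
      unfolding main_sum_def using sub by (intro sum_mono2) (auto simp: peak_limit_nonneg)
    finally show ?thesis .
  qed
  moreover have "\<kappa> > 0" using c never_up_pos[of x0] by (simp add: \<kappa>_def)
  ultimately show ?thesis by blast
qed

lemma main_sum_eq:
  assumes b: "b > 0"
  shows "b ^ 6 * Phi (- b) / 4 *
        (\<Sum>(u, v) \<in> {(u, v). u \<in> {1..m} \<and> v \<in> {1..m} \<and> u + v \<le> m}.
           (real m - real u - real v) / (real u * real v * (real u + real v))
           * nu (b * sqrt (real u / (real v * (real u + real v))))
           * nu (b * sqrt (real v / (real u * (real u + real v))))
           * nu (b * sqrt ((real u + real v) / (real u * real v))))
    = 2 * Phi (- b) * main_sum m b"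
proof -
  let ?S = "{(u, v). u \<in> {1..m} \<and> v \<in> {1..m} \<and> u + v \<le> m}"
  have finS: "finite ?S" by (rule finite_subset[of _ "{1..m} \<times> {1..m}"]) auto
  have summand: "b ^ 6 * Phi (- b) / 4 * ((real m - real u - real v) / (real u * real v * (real u + real v))
           * nu (b * sqrt (real u / (real v * (real u + real v))))
           * nu (b * sqrt (real v / (real u * (real u + real v))))
           * nu (b * sqrt ((real u + real v) / (real u * real v))))
      = 2 * Phi (- b) * (real (m - u - v) * peak_limit b (real u) (real v))" if "(u, v) \<in> ?S" for u v
  proof -
    have uv: "real u > 0" "real v > 0" "u + v \<le> m" using that by auto
    let ?u = "real u" and ?v = "real v"
    have p: "b * ampL ?u ?v \<noteq> 0" "b * ampR ?u ?v \<noteq> 0" "b * ampM ?u ?v \<noteq> 0"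
      using b ampL_pos[OF uv(1,2)] ampR_pos[OF uv(1,2)] ampM_pos[OF uv(1,2)] by auto
    have sq: "(ampL ?u ?v)\<^sup>2 * (ampM ?u ?v)\<^sup>2 * (ampR ?u ?v)\<^sup>2 = 1 / (?u * ?v * (?u + ?v))"
      using uv by (simp add: ampL_def ampM_def ampR_def)
    have "peak_limit b ?u ?v = ((b * ampL ?u ?v)\<^sup>2 / 2 * nu (b * ampL ?u ?v)) * ((b * ampM ?u ?v)\<^sup>2 / 2 * nu (b * ampM ?u ?v)) * ((b * ampR ?u ?v)\<^sup>2 / 2 * nu (b * ampR ?u ?v))"
      unfolding peak_limit_def nu_eq_never_up[OF p(1)] nu_eq_never_up[OF p(2)] nu_eq_never_up[OF p(3)] ..
    also have "\<dots> = (b\<^sup>2 * b\<^sup>2 * b\<^sup>2) / 8 * ((ampL ?u ?v)\<^sup>2 * (ampM ?u ?v)\<^sup>2 * (ampR ?u ?v)\<^sup>2) * (nu (b * ampR ?u ?v) * nu (b * ampL ?u ?v) * nu (b * ampM ?u ?v))"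
      by (simp add: power_mult_distrib)
    also have "b\<^sup>2 * b\<^sup>2 * b\<^sup>2 = b ^ 6" by (simp flip: power_add)
    finally have never_up: "peak_limit b ?u ?v = b ^ 6 / 8 * (1 / (?u * ?v * (?u + ?v))) * (nu (b * ampR ?u ?v) * nu (b * ampL ?u ?v) * nu (b * ampM ?u ?v))"
      unfolding sq .
    have muv: "real (m - u - v) = real m - ?u - ?v" using uv by (simp add: of_nat_diff)
    have "B * p / 4 * (x / w * n1 * n2 * n3) = 2 * p * (x * (B / 8 * (1 / w) * (n1 * n2 * n3)))" for B p x w n1 n2 n3 :: real
      by (simp add: mult_ac)
    then show ?thesis unfolding muv never_up ampL_def[symmetric] ampR_def[symmetric] ampM_def[symmetric] .
  qed
  have "b ^ 6 * Phi (- b) / 4 *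
        (\<Sum>(u, v) \<in> ?S.
           (real m - real u - real v) / (real u * real v * (real u + real v))
           * nu (b * sqrt (real u / (real v * (real u + real v))))
           * nu (b * sqrt (real v / (real u * (real u + real v))))
           * nu (b * sqrt ((real u + real v) / (real u * real v))))
     = (\<Sum>(u, v) \<in> ?S. 2 * Phi (- b) * (real (m - u - v) * peak_limit b (real u) (real v)))"
    unfolding sum_distrib_left
  proof (rule sum.cong[OF refl])
    fix p assume p: "p \<in> ?S"
    obtain u v where uv: "p = (u, v)" by (cases p)
    show "b ^ 6 * Phi (- b) / 4 * (case p of (u, v) \<Rightarrow> (real m - real u - real v) / (real u * real v * (real u + real v))
           * nu (b * sqrt (real u / (real v * (real u + real v))))
           * nu (b * sqrt (real v / (real u * (real u + real v))))
           * nu (b * sqrt ((real u + real v) / (real u * real v))))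
      = (case p of (u, v) \<Rightarrow> 2 * Phi (- b) * (real (m - u - v) * peak_limit b (real u) (real v)))"
      unfolding uv prod.case by (rule summand) (use p uv in simp)
  qed
  also have "\<dots> = 2 * Phi (- b) * (\<Sum>p\<in>?S. \<Sum>i<m - fst p - snd p. peak_limit b (real (fst p)) (real (snd p)))"
    unfolding sum_distrib_left[symmetric] by (simp add: case_prod_beta sum_distrib_left)
  also have "(\<Sum>p\<in>?S. \<Sum>i<m - fst p - snd p. peak_limit b (real (fst p)) (real (snd p)))
    = (\<Sum>(p, i)\<in>Sigma ?S (\<lambda>p. {..<m - fst p - snd p}). peak_limit b (real (fst p)) (real (snd p)))"
    by (rule sum.Sigma) (use finS in auto)
  also have "\<dots> = main_sum m b"
    unfolding main_sum_def
    by (rule sum.reindex_bij_witness[of _ "\<lambda>(i, j, k). ((j - i, k - j), i)" "\<lambda>((u, v), i). (i, i + u, i + u + v)"])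
       (auto simp: inner_triples_def)
  finally show ?thesis .
qed

section \<open>The scan statistic\<close>

text \<open>The centred observations have the same joint law as the first coordinates of the standard
  Gaussian sequence.\<close>

lemma prob_max_abs_Z:
  fixes X :: "nat \<Rightarrow> 'a \<Rightarrow> real"
  assumes "prob_space M" and indep: "prob_space.indep_vars M (\<lambda>_. borel) X {1..m}"
    and normal: "\<And>l. l \<in> {1..m} \<Longrightarrow> distributed M lborel (X l) (normal_density \<mu> 1)" and m: "m \<ge> 2"
  shows "\<P>(\<omega> in M. max_abs_Z X m \<omega> \<ge> b) = exceed m b"
proof -
  interpret prob_space M by fact
  let ?I = "{1..m}"
  let ?P = "PiM ?I (\<lambda>_. borel :: real measure)"
  define Y where "Y l \<omega> = X l \<omega> - \<mu>" for l \<omega>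
  have Xm: "X l \<in> borel_measurable M" if "l \<in> ?I" for l using normal[OF that] by (auto simp: distributed_def)
  then have Ym: "Y l \<in> borel_measurable M" if "l \<in> ?I" for l using that unfolding Y_def by measurable
  have indY: "indep_vars (\<lambda>_. borel) Y ?I"
    unfolding Y_def by (rule indep_vars_compose2[OF indep, where Y="\<lambda>_ x. x - \<mu>"]) auto
  have dY: "distr M borel (Y l) = std_normal_distribution" if "l \<in> ?I" for l
  proof -
    have "distributed M lborel (\<lambda>x. (X l x - \<mu>) / 1) std_normal_density"
      using normal_standard_normal_convert[of 1 "X l" \<mu>] normal[OF that] by simp
    then have "distr M lborel (Y l) = std_normal_distribution" by (simp add: distributed_def Y_def[abs_def])
    moreover have "distr M borel (Y l) = distr M lborel (Y l)" by (rule distr_cong) auto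
    ultimately show ?thesis by simp
  qed
  have ne: "?I \<noteq> {}" using m by simp
  have "distr M ?P (\<lambda>\<omega>. \<lambda>l\<in>?I. Y l \<omega>) = PiM ?I (\<lambda>l. distr M borel (Y l))"
    using indY indep_vars_iff_distr_eq_PiM'[OF ne, of Y "\<lambda>_. borel"] Ym by simp
  also have "\<dots> = PiM ?I (\<lambda>_. std_normal_distribution)" by (rule PiM_cong) (use dY in auto)
  finally have 1: "distr M ?P (\<lambda>\<omega>. \<lambda>l\<in>?I. Y l \<omega>) = PiM ?I (\<lambda>_. std_normal_distribution)" .
  have dG: "distr gauss borel (\<lambda>\<omega>. \<omega> l) = std_normal_distribution" for l
  proof -
    have "distr gauss borel (\<lambda>\<omega>. \<omega> l) = distr gauss lborel (\<lambda>\<omega>. \<omega> l)" by (rule distr_cong) auto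
    then show ?thesis using gauss_coordinate_distributed[of l] by (simp add: distributed_def)
  qed
  have "distr gauss ?P (\<lambda>\<omega>. \<lambda>l\<in>?I. \<omega> l) = PiM ?I (\<lambda>l. distr gauss borel (\<lambda>\<omega>. \<omega> l))"
    using gs.P.indep_vars_subset[OF gauss_coordinates_indep, of ?I] gs.P.indep_vars_iff_distr_eq_PiM'[OF ne, of "\<lambda>l \<omega>. \<omega> l" "\<lambda>_. borel"]
    by simp
  then have 2: "distr gauss ?P (\<lambda>\<omega>. \<lambda>l\<in>?I. \<omega> l) = PiM ?I (\<lambda>_. std_normal_distribution)" by (simp add: dG)
  define A where "A = {y \<in> space ?P. \<exists>t\<in>triples m. \<bar>lin ?I (contrast_of t) y\<bar> \<ge> b}"
  have A: "A \<in> sets ?P"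
  proof -
    have "lin ?I (contrast_of t) \<in> borel_measurable ?P" for t
      unfolding lin_def by (intro borel_measurable_sum borel_measurable_times borel_measurable_const measurable_component_singleton)
    then show ?thesis unfolding A_def by (intro sets.sets_Collect_finite_Ex borel_measurable_le borel_measurable_abs) auto
  qed
  have lin_restrict: "lin ?I g (\<lambda>l\<in>?I. y l) = lin ?I g y" for g y
    unfolding lin_def by (intro sum.cong) auto
  have "measure (distr M ?P (\<lambda>\<omega>. \<lambda>l\<in>?I. Y l \<omega>)) A = \<P>(\<omega> in M. \<exists>t\<in>triples m. \<bar>lin ?I (contrast_of t) (\<lambda>l. Y l \<omega>)\<bar> \<ge> b)"
    using A Ym by (subst measure_distr)
      (auto intro!: measurable_restrict arg_cong[where f="measure M"] simp: A_def lin_restrict space_PiM simp del: One_nat_def)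
  moreover have "measure (distr gauss ?P (\<lambda>\<omega>. \<lambda>l\<in>?I. \<omega> l)) A = exceed m b"
    unfolding exceed_def using A by (subst measure_distr)
      (auto intro!: measurable_restrict arg_cong[where f="measure gauss"] simp: A_def lin_restrict space_PiM simp del: One_nat_def)
  ultimately have eq: "\<P>(\<omega> in M. \<exists>t\<in>triples m. \<bar>lin ?I (contrast_of t) (\<lambda>l. Y l \<omega>)\<bar> \<ge> b) = exceed m b"
    using 1 2 by simp
  have "max_abs_Z X m \<omega> \<ge> b \<longleftrightarrow> (\<exists>t\<in>triples m. \<bar>lin ?I (contrast_of t) (\<lambda>l. Y l \<omega>)\<bar> \<ge> b)" for \<omega>
  proof -
    have set_eq: "{\<bar>Z_stat X i j k \<omega>\<bar> | i j k. i < j \<and> j < k \<and> k \<le> m} = (\<lambda>t. \<bar>lin ?I (contrast_of t) (\<lambda>l. Y l \<omega>)\<bar>) ` triples m"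
    proof -
      have "{\<bar>Z_stat X i j k \<omega>\<bar> | i j k. i < j \<and> j < k \<and> k \<le> m} = (\<lambda>(i, j, k). \<bar>Z_stat X i j k \<omega>\<bar>) ` triples m"
      proof (intro equalityI subsetI)
        fix x assume "x \<in> {\<bar>Z_stat X i j k \<omega>\<bar> | i j k. i < j \<and> j < k \<and> k \<le> m}"
        then obtain i j k where x: "x = \<bar>Z_stat X i j k \<omega>\<bar>" and "i < j \<and> j < k \<and> k \<le> m" by blast
        then have "(i, j, k) \<in> triples m" by (simp add: triples_def)
        then show "x \<in> (\<lambda>(i, j, k). \<bar>Z_stat X i j k \<omega>\<bar>) ` triples m" unfolding x by (rule rev_image_eqI) simp
      next
        fix x assume "x \<in> (\<lambda>(i, j, k). \<bar>Z_stat X i j k \<omega>\<bar>) ` triples m"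
        then show "x \<in> {\<bar>Z_stat X i j k \<omega>\<bar> | i j k. i < j \<and> j < k \<and> k \<le> m}"
          by (auto simp: triples_def)
      qed
      also have "\<dots> = (\<lambda>t. \<bar>lin ?I (contrast_of t) (\<lambda>l. Y l \<omega>)\<bar>) ` triples m"
      proof (rule image_cong[OF refl])
        fix t assume t: "t \<in> triples m"
        obtain i j k where t': "t = (i, j, k)" by (cases t)
        have "Z_stat X i j k \<omega> = lin ?I (contrast i j k) (\<lambda>l. X l \<omega> - \<mu>)"
          using t by (intro Z_stat_eq_lin) (auto simp: triples_def t')
        then show "(case t of (i, j, k) \<Rightarrow> \<bar>Z_stat X i j k \<omega>\<bar>) = \<bar>lin ?I (contrast_of t) (\<lambda>l. Y l \<omega>)\<bar>"
          by (simp add: t' contrast_of_def Y_def)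
      qed
      finally show ?thesis .
    qed
    have "(0, 1, 2) \<in> triples m" using m by (simp add: triples_def)
    then have "triples m \<noteq> {}" by blast
    then show ?thesis unfolding max_abs_Z_def set_eq by (subst Max_ge_iff) auto
  qed
  then show ?thesis using eq by simp
qed

theorem theorem2p1:
  fixes M :: "real \<Rightarrow> 'a measure"
    and m :: "real \<Rightarrow> nat"
    and \<mu> :: "real \<Rightarrow> real"
    and X :: "real \<Rightarrow> nat \<Rightarrow> 'a \<Rightarrow> real"
  assumes m_pos: "\<And>b. b > 0 \<Longrightarrow> m b > 0"
    and m_asymp: "(\<lambda>b. real (m b)) \<in> \<Theta>[at_top](\<lambda>b. b\<^sup>2)"
    and prob: "\<And>b. b > 0 \<Longrightarrow> prob_space (M b)"
    and indep: "\<And>b. b > 0 \<Longrightarrow>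
          prob_space.indep_vars (M b) (\<lambda>_. borel) (X b) {1..m b}"
    and normal: "\<And>b l. b > 0 \<Longrightarrow> l \<in> {1..m b} \<Longrightarrow>
          distributed (M b) lborel (X b l) (normal_density (\<mu> b) 1)"
  shows "(\<lambda>b. \<P>(\<omega> in M b. max_abs_Z (X b) (m b) \<omega> \<ge> b))
     \<sim>[at_top]
     (\<lambda>b. b ^ 6 * Phi (- b) / 4 *
        (\<Sum>(u, v) \<in> {(u, v). u \<in> {1..m b} \<and> v \<in> {1..m b} \<and> u + v \<le> m b}.
           (real (m b) - real u - real v) / (real u * real v * (real u + real v))
           * nu (b * sqrt (real u / (real v * (real u + real v))))
           * nu (b * sqrt (real v / (real u * (real u + real v))))
           * nu (b * sqrt ((real u + real v) / (real u * real v)))))"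
    (is "?f \<sim>[at_top] ?g")
proof -
  have bigO: "(\<lambda>b. real (m b)) \<in> O[at_top](\<lambda>b. b\<^sup>2)" and bigOm: "(\<lambda>b. real (m b)) \<in> \<Omega>[at_top](\<lambda>b. b\<^sup>2)"
    using m_asymp unfolding bigtheta_def by blast+
  obtain C0 where C0: "C0 > 0" "eventually (\<lambda>b. norm (real (m b)) \<le> C0 * norm (b\<^sup>2)) at_top"
    using landau_o.bigE[OF bigO] by blast
  obtain c where c: "c > 0" "eventually (\<lambda>b. norm (real (m b)) \<ge> c * norm (b\<^sup>2)) at_top"
    using landau_omega.bigE[OF bigOm] by blast
  define C where "C = max 1 C0"
  have C: "C \<ge> 1" by (simp add: C_def)
  have ev_m: "eventually (\<lambda>b. c * b\<^sup>2 \<le> real (m b) \<and> real (m b) \<le> C * b\<^sup>2 \<and> 16 \<le> m b \<and> b \<ge> 1) at_top"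
  proof -
    have "filterlim (\<lambda>b. c * b\<^sup>2) at_top at_top" using c(1) by real_asymp
    then have "eventually (\<lambda>b. c * b\<^sup>2 \<ge> 16) at_top" unfolding filterlim_at_top by blast
    with C0(2) c(2) eventually_ge_at_top[of "1::real"] show ?thesis
    proof eventually_elim
      case (elim b)
      have "C0 * b\<^sup>2 \<le> C * b\<^sup>2" by (intro mult_right_mono) (auto simp: C_def)
      moreover have "real (m b) \<le> C0 * b\<^sup>2" "c * b\<^sup>2 \<le> real (m b)" "16 \<le> real (m b)" "1 \<le> b" using elim by auto
      ultimately have "c * b\<^sup>2 \<le> real (m b)" "real (m b) \<le> C * b\<^sup>2" "16 \<le> real (m b)" "1 \<le> b" by linarith+
      then show ?case by simp
    qed
  qed
  obtain \<kappa> where \<kappa>: "\<kappa> > 0" "\<And>b m. b \<ge> 1 \<Longrightarrow> m \<ge> 16 \<Longrightarrow> c * b\<^sup>2 \<le> real m \<Longrightarrow> real m \<le> C * b\<^sup>2 \<Longrightarrow> \<kappa> * b ^ 6 \<le> main_sum m b"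
    using main_sum_lower[OF c(1) C] by blast
  have "((\<lambda>b. ?f b / ?g b) \<longlongrightarrow> 1) at_top"
  proof (rule tendstoI)
    fix e :: real assume e: "e > 0"
    obtain B where B: "\<And>b m. b \<ge> B \<Longrightarrow> real m \<le> C * b\<^sup>2 \<Longrightarrow> \<bar>exceed m b - 2 * Phi (- b) * main_sum m b\<bar> \<le> (e * \<kappa>) * (b ^ 6 * Phi (- b))"
      using exceed_main_sum[OF C, of "e * \<kappa>"] e \<kappa>(1) by auto
    show "eventually (\<lambda>b. dist (?f b / ?g b) 1 < e) at_top"
      using ev_m eventually_ge_at_top[of B]
    proof eventually_elim
      case (elim b)
      have b0: "b > 0" using elim by simp
      have f: "?f b = exceed (m b) b"
        by (rule prob_max_abs_Z[OF prob[OF b0] indep[OF b0] normal[OF b0]]) (use elim in auto)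
      have g: "?g b = 2 * Phi (- b) * main_sum (m b) b" by (rule main_sum_eq[OF b0])
      let ?G = "2 * Phi (- b) * main_sum (m b) b"
      have ms: "\<kappa> * b ^ 6 \<le> main_sum (m b) b" using elim by (intro \<kappa>(2)) auto
      have k6: "\<kappa> * b ^ 6 > 0" using \<kappa>(1) b0 by simp
      have Gpos: "?G > 0" using ms k6 Phi_pos[of "- b"] by simp
      have "\<bar>exceed (m b) b - ?G\<bar> \<le> (e * \<kappa>) * (b ^ 6 * Phi (- b))" using elim by (intro B) auto
      also have "\<dots> = e * (Phi (- b) * (\<kappa> * b ^ 6))" by simp
      also have "\<dots> \<le> e * (Phi (- b) * main_sum (m b) b)" using ms e by (intro mult_left_mono) auto
      also have "\<dots> < e * ?G" using Gpos e by simp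
      finally have lt: "\<bar>exceed (m b) b - ?G\<bar> < e * ?G" .
      have "dist (?f b / ?g b) 1 = \<bar>exceed (m b) b - ?G\<bar> / ?G"
      proof -
        have nz: "?G \<noteq> 0" using Gpos by linarith
        have "exceed (m b) b / ?G - 1 = (exceed (m b) b - ?G) / ?G"
          by (simp only: diff_divide_distrib divide_self[OF nz])
        then show ?thesis unfolding f g dist_real_def using Gpos by (simp only: abs_divide abs_of_pos)
      qed
      also have "\<dots> < e" using lt Gpos by (simp only: pos_divide_less_eq)
      finally show ?case .
    qed
  qed
  then show ?thesis by (rule asymp_equivI')
qed

end
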